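(* Let $d\ge1$, $1<p\le2$, and let $\mathbb X=L^p([0,1]^d)$ be endowed with the Littlewood–Paley norm $|||\cdot|||_p$. Let $\mathcal D=\mathcal H^d_p$ be the $d$-variate $L^p$-normalized Haar basis, and let $$h(p,d)=(d-1)\Big|\frac12-\frac1p\Big|.$$ Let $\tau\in(0,1]$. Then there exist $c=c(p,d,\tau)>0$ and a constant $C>0$ such that the Weak Chebyshev Greedy Algorithm with weakness parameter $\tau$ (run in $(\mathbb X,|||\cdot|||_p)$ with dictionary $\mathcal D$) satisfies, with $\phi(N)=\lfloor c\,(1+\log N)^{p'h(p,d)}\,N\rfloor$, $$|||f-\mathscr G_{\phi(N)}(f)|||_p\le C\,\sigma_N(f)\qquad\text{for all }N\ge1,\ f\in\mathbb X.$$ Moreover, suppose that $\psi:\mathbb N\to\mathbb N$ and $C>0$ are such that $$|||f-\mathscr G_{\psi(N)}(f)|||_p\le C\,\sigma_N(f)\qquad\text{for all }N\ge1,\ f\in\mathbb X.$$ Then there is $c'>0$ such that $\psi(N)\ge c'\,(1+\log N)^{p'h(p,d)}\,N$ for all $N\ge1$.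
   Context: Scalars are $\mathbb K=\mathbb R$ or $\mathbb C$; $p'=p/(p-1)$. Haar system: let $h_0=\mathbf 1_{[0,1)}$, $h=\mathbf 1_{[0,1/2)}-\mathbf 1_{[1/2,1)}$. For a dyadic interval $I=2^{-j}(k+[0,1))\subset[0,1]$ ($j\ge0$, $0\le k<2^j$) put $h_{I,p}(x)=2^{j/p}h(2^jx-k)$, and put $h_{0,p}=h_0$. Let $\mathscr D$ be the set of all such dyadic intervals and $\bar{\mathscr D}=\mathscr D\cup\{0\}$. Then $\mathcal H_p=\{h_{I,p}\}_{I\in\bar{\mathscr D}}$, and $\mathcal H_p^d=\{H_{I,p}\}$ is indexed by $I=(I_1,\dots,I_d)\in\bar{\mathscr R}_d:=\bar{\mathscr D}^d$, with $H_{I,p}(x_1,\dots,x_d)=\prod_{i=1}^dh_{I_i,p}(x_i)$. Each $f\in L^p([0,1]^d)$ is expanded as $f=\sum_Ic_I(f)H_{I,p}$ with $c_I(f)=\langle f,H_{I,p'}\rangle$, and $$|||f|||_p=\Big\|\Big(\sum_{I\in\bar{\mathscr R}_d}|c_I(f)H_{I,p}|^2\Big)^{1/2}\Big\|_{L^p([0,1]^d)},$$ which is an equivalent norm on $L^p([0,1]^d)$. For a dictionary $\mathcal D$ (unit vectors with dense span) in a Banach space $(\mathbb X,\|\cdot\|)$, $\Sigma_N$ is the set of linear combinations of at most $N$ elements of $\mathcal D$, $\sigma_N(f)=\inf_{a\in\Sigma_N}\|f-a\|$ (here $\|\cdot\|=|||\cdot|||_p$). For $f\neq0$, $F_f\in\mathbb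 X^*$ is the norming functional: $\|F_f\|_{\mathbb X^*}=1$, $F_f(f)=\|f\|$. Square brackets denote linear span. Weak Chebyshev Greedy Algorithm (WCGA) with parameter $\tau\in(0,1]$: given $f\neq0$ put $f_0=f$. At step $n+1$ choose any $\varphi_{i_{n+1}}\in\mathcal D$ with $|F_{f_n}(\varphi_{i_{n+1}})|\ge\tau\sup_{\varphi\in\mathcal D}|F_{f_n}(\varphi)|$; let $\mathscr G_{n+1}(f)$ be any element of $[\varphi_{i_1},\dots,\varphi_{i_{n+1}}]$ with $\|f-\mathscr G_{n+1}(f)\|=\mathrm{dist}(f,[\varphi_{i_1},\dots,\varphi_{i_{n+1}}])$; put $f_{n+1}=f-\mathscr G_{n+1}(f)$. Iterate indefinitely, or until the remainder is $0$ (in which case the later remainders are also taken to be $0$). Also $\mathscr G_0(f)=0$. Inequalities for $\|f-\mathscr G_n(f)\|$ (both in conclusions and in hypotheses) are understood to hold for every admissible run of the algorithm. *)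

theory Defs
  imports "HOL-Analysis.Analysis"
begin

section \<open>The Haar system\<close>

text \<open>
  \<open>None\<close> is the index \<open>0\<close> of the constant function; \<open>Some (j, k)\<close> with \<open>k < 2 ^ j\<close> stands for
  the dyadic interval \<open>2\<^sup>-\<^sup>j (k + [0,1))\<close>.
\<close>

type_synonym haar_index = "(nat \<times> nat) option"

definition haar_indices :: "haar_index set" where
  "haar_indices = insert None {Some (j, k) |j k. k < 2 ^ j}"

definition haar_mother :: "real \<Rightarrow> real" where
  "haar_mother x = indicat_real {0..<1/2} x - indicat_real {1/2..<1} x"

fun haar :: "real \<Rightarrow> haar_index \<Rightarrow> real \<Rightarrow> real" where
  "haar p None x = indicat_real {0..<1} x"
| "haar p (Some (j, k)) x = 2 powr (real j / p) * haar_mother (2 ^ j * x - real k)"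

definition multi_haar_indices :: "('n::finite \<Rightarrow> haar_index) set" where
  "multi_haar_indices = {I. \<forall>i. I i \<in> haar_indices}"

definition multi_haar :: "real \<Rightarrow> ('n::finite \<Rightarrow> haar_index) \<Rightarrow> real ^ 'n \<Rightarrow> real" where
  "multi_haar p I x = (\<Prod>i\<in>UNIV. haar p (I i) (x $ i))"

text \<open>
  The scalar field is a type \<open>'k\<close>.  The sort \<open>{real_normed_field, euclidean_space}\<close> used below has,
  up to isometric isomorphism, exactly the two members \<open>real\<close> and \<open>complex\<close>: its members are the
  finite-dimensional commutative real division algebras with a multiplicative norm.
\<close>

definition haar_dictionary :: "real \<Rightarrow> (real ^ 'n::finite \<Rightarrow> 'k::real_normed_field) set" where
  "haar_dictionary p = (\<lambda>I x. of_real (multi_haar p I x)) ` multi_haar_indices"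


section \<open>The space \<open>L\<^sup>p([0,1]\<^sup>d)\<close> with the Littlewood--Paley norm\<close>

text \<open>
  Elements of \<open>L\<^sup>p\<close> are represented by functions, and only their values on the cube matter.
\<close>

abbreviation cube_measure :: "(real ^ 'n::finite) measure" where
  "cube_measure \<equiv> lebesgue_on (cbox 0 1)"

definition Lp_cube :: "real \<Rightarrow> (real ^ 'n::finite \<Rightarrow> 'k::{real_normed_field, euclidean_space}) set" where
  "Lp_cube p = {f. f \<in> borel_measurable cube_measure \<and>
                   integrable cube_measure (\<lambda>x. norm (f x) powr p)}"

definition conj_exp :: "real \<Rightarrow> real" where
  "conj_exp p = p / (p - 1)"

text \<open>
  No complex conjugate is needed in the pairing, because the Haar functions are real-valued.
\<close>

definition haar_coeff ::
    "real \<Rightarrow> ('n::finite \<Rightarrow> haar_index) \<Rightarrow> (real ^ 'n \<Rightarrow> 'k::{real_normed_field, euclidean_space}) \<Rightarrow> 'k" where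
  "haar_coeff p I f = (LINT x|cube_measure. f x * of_real (multi_haar (conj_exp p) I x))"

definition square_function ::
    "real \<Rightarrow> (real ^ 'n::finite \<Rightarrow> 'k::{real_normed_field, euclidean_space}) \<Rightarrow> real ^ 'n \<Rightarrow> real" where
  "square_function p f x =
     sqrt (\<Sum>\<^sub>\<infinity>I\<in>multi_haar_indices. (norm (haar_coeff p I f * of_real (multi_haar p I x)))\<^sup>2)"

text \<open>
  For \<open>f \<in> Lp_cube p\<close> with \<open>1 < p < \<infinity>\<close> the sum converges almost everywhere and the integral is
  finite, by the Littlewood--Paley theorem; the default value \<open>0\<close> of a divergent sum or integral
  therefore has no influence on the norm of an element of \<open>L\<^sup>p\<close>.
\<close>

definition lp_norm :: "real \<Rightarrow> (real ^ 'n::finite \<Rightarrow> 'k::{real_normed_field, euclidean_space}) \<Rightarrow> real" where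
  "lp_norm p f = (LINT x|cube_measure. square_function p f x powr p) powr (1 / p)"


section \<open>Sparse approximation and the Weak Chebyshev Greedy Algorithm\<close>

text \<open>
  The algorithm is defined for a space \<open>X\<close> of scalar functions with a (semi)norm \<open>nrm\<close>, where
  functions at distance \<open>0\<close> represent the same vector; in particular \<open>f\<close> represents the zero
  vector iff \<open>nrm f = 0\<close>.
\<close>

text \<open>The linear span over the scalar field, for finite \<open>B\<close>.\<close>

definition lin_span :: "('x \<Rightarrow> 'k::real_normed_field) set \<Rightarrow> ('x \<Rightarrow> 'k) set" where
  "lin_span B = {\<lambda>x. \<Sum>b\<in>B. a b * b x |a. True}"

definition sparse :: "('x \<Rightarrow> 'k::real_normed_field) set \<Rightarrow> nat \<Rightarrow> ('x \<Rightarrow> 'k) set" where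
  "sparse D N = (\<Union>B\<in>{B. B \<subseteq> D \<and> finite B \<and> card B \<le> N}. lin_span B)"

definition dist_to ::
    "(('x \<Rightarrow> 'k) \<Rightarrow> real) \<Rightarrow> ('x \<Rightarrow> 'k::real_normed_field) \<Rightarrow> ('x \<Rightarrow> 'k) set \<Rightarrow> real" where
  "dist_to nrm f S = (INF g\<in>S. nrm (\<lambda>x. f x - g x))"

definition best_error ::
    "(('x \<Rightarrow> 'k) \<Rightarrow> real) \<Rightarrow> ('x \<Rightarrow> 'k::real_normed_field) set \<Rightarrow> nat \<Rightarrow> ('x \<Rightarrow> 'k) \<Rightarrow> real" where
  "best_error nrm D N f = dist_to nrm f (sparse D N)"

definition dual_space ::
    "('x \<Rightarrow> 'k) set \<Rightarrow> (('x \<Rightarrow> 'k) \<Rightarrow> real) \<Rightarrow> (('x \<Rightarrow> 'k) \<Rightarrow> 'k::real_normed_field) set" where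
  "dual_space X nrm = {F.
     (\<forall>f\<in>X. \<forall>g\<in>X. F (\<lambda>x. f x + g x) = F f + F g) \<and>
     (\<forall>f\<in>X. \<forall>a. F (\<lambda>x. a * f x) = a * F f) \<and>
     (\<exists>K. \<forall>f\<in>X. norm (F f) \<le> K * nrm f)}"

definition dual_norm ::
    "('x \<Rightarrow> 'k) set \<Rightarrow> (('x \<Rightarrow> 'k) \<Rightarrow> real) \<Rightarrow> (('x \<Rightarrow> 'k) \<Rightarrow> 'k::real_normed_field) \<Rightarrow> real" where
  "dual_norm X nrm F = (SUP f\<in>{f \<in> X. nrm f \<le> 1}. norm (F f))"

definition norming_functional ::
    "('x \<Rightarrow> 'k) set \<Rightarrow> (('x \<Rightarrow> 'k) \<Rightarrow> real) \<Rightarrow> ('x \<Rightarrow> 'k)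
       \<Rightarrow> (('x \<Rightarrow> 'k) \<Rightarrow> 'k::real_normed_field) \<Rightarrow> bool" where
  "norming_functional X nrm f F \<longleftrightarrow>
     F \<in> dual_space X nrm \<and> dual_norm X nrm F = 1 \<and> F f = of_real (nrm f)"

text \<open>
  \<open>wcga_run X nrm D \<tau> f \<phi> G\<close>: the algorithm applied to \<open>f\<close> may select the dictionary elements
  \<open>\<phi> 0, \<phi> 1, \<dots>\<close> (the choice in step \<open>n + 1\<close> is \<open>\<phi> n\<close>) and produce the approximants
  \<open>G 0, G 1, \<dots>\<close>.  After the remainder has become zero, \<open>G\<close> stays constant and \<open>\<phi>\<close> is irrelevant.
\<close>

definition wcga_run ::
    "('x \<Rightarrow> 'k) set \<Rightarrow> (('x \<Rightarrow> 'k) \<Rightarrow> real) \<Rightarrow> ('x \<Rightarrow> 'k::real_normed_field) set \<Rightarrow> real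
       \<Rightarrow> ('x \<Rightarrow> 'k) \<Rightarrow> (nat \<Rightarrow> 'x \<Rightarrow> 'k) \<Rightarrow> (nat \<Rightarrow> 'x \<Rightarrow> 'k) \<Rightarrow> bool" where
  "wcga_run X nrm D \<tau> f \<phi> G \<longleftrightarrow>
     G 0 = (\<lambda>x. 0) \<and>
     (\<forall>n. if nrm (\<lambda>x. f x - G n x) = 0 then G (Suc n) = G n
          else \<phi> n \<in> D \<and>
               (\<exists>F. norming_functional X nrm (\<lambda>x. f x - G n x) F \<and>
                    norm (F (\<phi> n)) \<ge> \<tau> * (SUP \<psi>\<in>D. norm (F \<psi>))) \<and>
               G (Suc n) \<in> lin_span (\<phi> ` {..n}) \<and>
               nrm (\<lambda>x. f x - G (Suc n) x) = dist_to nrm f (lin_span (\<phi> ` {..n})))"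

text \<open>
  For all \<open>N \<ge> 1\<close>, \<open>f \<in> X\<close> and all admissible runs, the error after \<open>\<nu> N\<close> steps is at most
  \<open>C \<sigma>\<^sub>N(f)\<close>.
\<close>

definition wcga_lebesgue_ineq ::
    "('x \<Rightarrow> 'k) set \<Rightarrow> (('x \<Rightarrow> 'k) \<Rightarrow> real) \<Rightarrow> ('x \<Rightarrow> 'k::real_normed_field) set \<Rightarrow> real
       \<Rightarrow> (nat \<Rightarrow> nat) \<Rightarrow> real \<Rightarrow> bool" where
  "wcga_lebesgue_ineq X nrm D \<tau> \<nu> C \<longleftrightarrow>
     (\<forall>N\<ge>1. \<forall>f\<in>X. \<forall>\<phi> G. wcga_run X nrm D \<tau> f \<phi> G \<longrightarrow>
        nrm (\<lambda>x. f x - G (\<nu> N) x) \<le> C * best_error nrm D N f)"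

definition h_exp :: "real \<Rightarrow> nat \<Rightarrow> real" where
  "h_exp p d = (real d - 1) * \<bar>1 / 2 - 1 / p\<bar>"

end

theory Submission
  imports Defs
begin

text \<open>
  Upper estimate.  The norm is that of \<open>L\<^sup>p\<close> of an \<open>\<ell>\<^sup>2\<close>-valued function, so for \<open>p \<le> 2\<close> the parallelogram law
  gives \<open>\<parallel>f + g\<parallel>\<^sup>p + \<parallel>f - g\<parallel>\<^sup>p \<le> 2 (\<parallel>f\<parallel>\<^sup>p + \<parallel>g\<parallel>\<^sup>p)\<close>.  With \<open>q\<close> the conjugate exponent of \<open>p\<close>, one step of the
  algorithm therefore decreases \<open>\<parallel>f\<^sub>n\<parallel>\<^sup>p\<close> by a factor \<open>1 - c s\<^sup>q\<close>, where \<open>s\<close> is the largest value of the norming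
  functional on the dictionary.  A lower bound for \<open>s\<close> comes from
  \<open>\<Sum>\<^sub>A |c\<^sub>I| \<le> C |A|\<^sup>1\<^sup>/\<^sup>q (1 + log N)\<^sup>h \<parallel>\<Sum>\<^sub>A c\<^sub>I H\<^sub>I\<parallel>\<close> for \<open>|A| \<le> N\<close>, which is dual to the upper democracy
  of the Haar system in \<open>L\<^sup>q\<close>; the latter follows by induction on the dimension, each coordinate but the first
  one contributing a logarithm.

  Lower estimate.  Add to the sum of \<open>N\<close> heavily overlapping Haar functions a multiple of the sum of \<open>M\<close> disjoint
  ones, the multiple being just large enough for the latter to be selected first.  The first sum is still untouched
  after \<open>M\<close> steps, so its norm is at most a constant times the norm of the second part.

  The default value of divergent sums in the definition of the norm is harmless by the Littlewood--Paley inequality.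
  All integrals of Haar polynomials are averages over dyadic grids, so this inequality and the democracy estimate
  reduce to finite sums over \<open>{..<2\<^sup>m}\<close>, treated one coordinate at a time.
\<close>

section \<open>The algorithm in a smooth space with an unconditional dictionary\<close>

text \<open>Both halves produce the exponent \<open>conj_exp p * h_exp p d\<close>. If
  \<open>V\<close> is the constant of the l1 estimate, then against \<open>a\<close> unchosen terms
  the norming functional reaches about \<open>1 / (V * a powr (1 / q))\<close> on the dictionary, so
  one step shrinks the p-th power of the error by a factor \<open>1 - c * V powr (- q) / a\<close>,
  and \<open>V powr q\<close> is the logarithmic factor. A bounded number of reductions by a
  constant factor is not enough, since the initial error is not controlled by the best error; steps
  must be paid for by the elements of the comparison set that they pick up. In the lower half,
  \<open>L\<close>-fold overlap depresses the norming functional by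
  \<open>L powr ((p - 2) / 2)\<close>. The balance
  \<open>b powr (p - 1) = 2 * L powr ((p - 2) / 2)\<close> for the coefficient \<open>b\<close> of
  the disjoint functions, put into the p-th powers of the two norms, leaves
  \<open>L powr (q / 2 - 1)\<close>, where \<open>L\<close> is of the order of the
  \<open>(d - 1)\<close>-st power of the logarithm.\<close>

lemma bernoulli_powr:
  fixes x p :: real
  assumes "1 \<le> p" "0 \<le> x"
  shows "1 + p * x \<le> (1 + x) powr p"
proof -
  have "((1 + x) powr p) powr (1/p) * 1 powr (1 - 1/p) \<le> (1/p) * (1 + x) powr p + (1 - 1/p) * 1"
    using assms by (intro Youngs_inequality_0) (auto simp: field_simps)
  then have "p * (1 + x) \<le> (1 + x) powr p + (p - 1)"
    using assms by (simp add: powr_powr divide_simps split: if_splits) (simp add: algebra_simps)?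
  then show ?thesis by (simp add: algebra_simps)
qed

text \<open>Coefficients are indexed by the functions themselves, so that one coefficient function
  serves all subsets of a comparison set.\<close>

definition lincomb :: "('x \<Rightarrow> 'k) set \<Rightarrow> (('x \<Rightarrow> 'k) \<Rightarrow> 'k) \<Rightarrow> 'x \<Rightarrow> 'k::real_normed_field" where
  "lincomb B c = (\<lambda>x. \<Sum>b\<in>B. c b * b x)"

lemma lin_span_eq: "lin_span B = range (lincomb B)"
  by (auto simp: lin_span_def lincomb_def)

text \<open>\<open>nrm_smooth\<close> plays two roles: it is the smoothness behind the descent step,
  and it yields a triangle inequality up to a factor 2. \<open>unconditional\<close> has constant 1
  because the Littlewood-Paley norm is monotone in the moduli of the Haar coefficients.\<close>

locale greedy_space =
  fixes X :: "('x \<Rightarrow> 'k::real_normed_field) set" and nrm :: "('x \<Rightarrow> 'k) \<Rightarrow> real"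
    and D :: "('x \<Rightarrow> 'k) set" and p :: real
  assumes p_gt_1: "1 < p" and p_le_2: "p \<le> 2"
    and D_sub: "D \<subseteq> X"
    and zero_in: "(\<lambda>x. 0) \<in> X"
    and add_in: "\<And>f g. f \<in> X \<Longrightarrow> g \<in> X \<Longrightarrow> (\<lambda>x. f x + g x) \<in> X"
    and scale_in: "\<And>f a. f \<in> X \<Longrightarrow> (\<lambda>x. a * f x) \<in> X"
    and nrm_nonneg: "\<And>f. 0 \<le> nrm f"
    and nrm_scale: "\<And>f a. f \<in> X \<Longrightarrow> nrm (\<lambda>x. a * f x) = norm a * nrm f"
    and nrm_smooth: "\<And>f g. f \<in> X \<Longrightarrow> g \<in> X \<Longrightarrow>
       nrm (\<lambda>x. f x + g x) powr p + nrm (\<lambda>x. f x - g x) powr p \<le> 2 * (nrm f powr p + nrm g powr p)"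
    and nrm_dict: "\<And>\<phi>. \<phi> \<in> D \<Longrightarrow> nrm \<phi> \<le> 1"
    and unconditional: "\<And>W A c. finite W \<Longrightarrow> W \<subseteq> D \<Longrightarrow> A \<subseteq> W \<Longrightarrow> nrm (lincomb A c) \<le> nrm (lincomb W c)"
begin

section \<open>Norming functionals and the descent step\<close>

lemma diff_in: "f \<in> X \<Longrightarrow> g \<in> X \<Longrightarrow> (\<lambda>x. f x - g x) \<in> X"
  using add_in[of f "\<lambda>x. -1 * g x"] scale_in[of g "-1"] by simp

lemma lincomb_in: "finite W \<Longrightarrow> W \<subseteq> D \<Longrightarrow> lincomb W c \<in> X"
proof (induction W rule: finite_induct)
  case empty then show ?case using zero_in by (simp add: lincomb_def)
next
  case (insert b W)
  then have "(\<lambda>x. c b * b x + lincomb W c x) \<in> X"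
    using D_sub by (intro add_in scale_in) auto
  then show ?case using insert by (simp add: lincomb_def)
qed

lemma nrm_zero: "nrm (\<lambda>x. 0) = 0"
  using nrm_scale[OF zero_in, of 0] by simp

lemma nrm_minus: "f \<in> X \<Longrightarrow> nrm (\<lambda>x. - f x) = nrm f"
  using nrm_scale[of f "-1"] by simp

text \<open>Dropping the difference term in \<open>nrm_smooth\<close> leaves twice the sum of the
  p-th powers, hence at most \<open>2 * (nrm f + nrm g) powr p\<close>; and 2 is at most
  \<open>2 powr p\<close>.\<close>

lemma nrm_quasi_triangle:
  assumes "f \<in> X" "g \<in> X"
  shows "nrm (\<lambda>x. f x + g x) \<le> 2 * (nrm f + nrm g)"
proof -
  let ?a = "nrm f" and ?b = "nrm g"
  have nn: "0 \<le> ?a" "0 \<le> ?b" by (auto simp: nrm_nonneg)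
  have le: "x powr p \<le> (?a + ?b) powr (p - 1) * x" if "0 \<le> x" "x \<le> ?a + ?b" for x
  proof (cases "x = 0")
    case False
    then have "x powr p = x powr (p - 1) * x"
      using that by (simp add: powr_diff)
    also have "\<dots> \<le> (?a + ?b) powr (p - 1) * x"
      using that p_gt_1 by (intro mult_right_mono powr_mono2) auto
    finally show ?thesis .
  qed (use p_gt_1 in auto)
  have "?a powr p + ?b powr p \<le> (?a + ?b) powr (p - 1) * ?a + (?a + ?b) powr (p - 1) * ?b"
    using nn by (intro add_mono le) auto
  also have "\<dots> = (?a + ?b) powr (p - 1) * (?a + ?b)" by (simp add: algebra_simps)
  also have "\<dots> = (?a + ?b) powr p"
    using nn by (cases "?a + ?b = 0") (auto simp: powr_diff)
  finally have "?a powr p + ?b powr p \<le> (?a + ?b) powr p" .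
  then have "nrm (\<lambda>x. f x + g x) powr p \<le> 2 * (?a + ?b) powr p"
    using nrm_smooth[OF assms] by (smt (verit) powr_ge_zero)
  also have "\<dots> \<le> 2 powr p * (?a + ?b) powr p"
    using powr_mono[of 1 p 2] p_gt_1 by (intro mult_right_mono) auto
  also have "\<dots> = (2 * (?a + ?b)) powr p"
    using nn by (subst powr_mult) auto
  finally have "nrm (\<lambda>x. f x + g x) powr p \<le> (2 * (?a + ?b)) powr p" .
  then show ?thesis
    using nn p_gt_1 nrm_nonneg powr_less_mono2[of p "2 * (nrm f + nrm g)" "nrm (\<lambda>x. f x + g x)"] by fastforce
qed

lemma dual_add: "F \<in> dual_space X nrm \<Longrightarrow> f \<in> X \<Longrightarrow> g \<in> X \<Longrightarrow> F (\<lambda>x. f x + g x) = F f + F g"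
  and dual_scale: "F \<in> dual_space X nrm \<Longrightarrow> f \<in> X \<Longrightarrow> F (\<lambda>x. a * f x) = a * F f"
  and dual_bounded: "F \<in> dual_space X nrm \<Longrightarrow> \<exists>K. \<forall>f\<in>X. norm (F f) \<le> K * nrm f"
  by (simp_all add: dual_space_def)

lemma dual_lincomb:
  assumes "F \<in> dual_space X nrm" "finite W" "W \<subseteq> D"
  shows "F (lincomb W c) = (\<Sum>b\<in>W. c b * F b)"
  using assms(2,3)
proof (induction W rule: finite_induct)
  case empty
  from dual_scale[OF assms(1) zero_in, of 0] show ?case by (simp add: lincomb_def)
next
  case (insert b W)
  note add = dual_add[OF assms(1)] and scale = dual_scale[OF assms(1)]
  have "F (\<lambda>x. c b * b x + lincomb W c x) = c b * F b + F (lincomb W c)"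
    using insert D_sub by (subst add) (auto simp: scale intro!: scale_in lincomb_in)
  then show ?case using insert by (simp add: lincomb_def)
qed

text \<open>Homogeneity reduces to the unit ball, where the dual norm is 1. Vectors of seminorm 0
  cannot be normalised; for them the bound in \<open>dual_space\<close> gives
  \<open>F g = 0\<close>.\<close>

lemma norming_le:
  assumes "norming_functional X nrm r F" "g \<in> X"
  shows "norm (F g) \<le> nrm g"
proof -
  have F: "F \<in> dual_space X nrm" and dn: "(SUP f\<in>{f \<in> X. nrm f \<le> 1}. norm (F f)) = 1"
    using assms(1) by (auto simp: norming_functional_def dual_norm_def)
  obtain K where K: "\<And>f. f \<in> X \<Longrightarrow> norm (F f) \<le> K * nrm f"
    using dual_bounded[OF F] by auto
  \<comment> \<open>The real \<open>SUP\<close> dominates its elements only for a set bounded above.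
    The constant \<open>K\<close> might be negative, hence the modulus.\<close>
  have bdd: "bdd_above ((\<lambda>f. norm (F f)) ` {f \<in> X. nrm f \<le> 1})"
  proof (rule bdd_aboveI2)
    fix f assume f: "f \<in> {f \<in> X. nrm f \<le> 1}"
    then have "norm (F f) \<le> \<bar>K\<bar> * nrm f"
      using K[of f] nrm_nonneg[of f] by (smt (verit) mem_Collect_eq mult_right_mono)
    also have "\<dots> \<le> \<bar>K\<bar> * 1" using f by (intro mult_left_mono) auto
    finally show "norm (F f) \<le> \<bar>K\<bar>" by simp
  qed
  show ?thesis
  proof (cases "nrm g = 0")
    case True
    then show ?thesis using K[OF assms(2)] by simp
  next
    case False
    then have pos: "0 < nrm g" using nrm_nonneg[of g] by simp
    let ?g = "\<lambda>x. of_real (1 / nrm g) * g x"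
    have "norm (F ?g) \<le> (SUP f\<in>{f \<in> X. nrm f \<le> 1}. norm (F f))"
    proof (intro cSUP_upper bdd CollectI conjI)
      show "?g \<in> X" by (rule scale_in[OF assms(2)])
      show "nrm ?g \<le> 1" using pos by (subst nrm_scale[OF assms(2)]) (simp add: norm_divide)
    qed
    moreover have "F ?g = of_real (1 / nrm g) * F g"
      by (rule dual_scale[OF F assms(2)])
    ultimately have "norm (of_real (1 / nrm g) * F g) \<le> 1" by (simp only: dn)
    then show ?thesis using pos unfolding norm_mult norm_of_real by (simp add: divide_simps)
  qed
qed

definition q where "q = p / (p - 1)"

lemma q_gt_1: "1 < q"
  using p_gt_1 by (simp add: q_def divide_simps)

lemma q_eq: "1 + 1 / (p - 1) = q"
  using p_gt_1 by (simp add: q_def field_simps)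

text \<open>Along \<open>r + a * \<phi>\<close> the functional forces growth by the factor
  \<open>1 + u * \<eta>\<close>, while smoothness bounds both directions together, so the opposite
  direction must descend. The gain \<open>p * u * \<eta>\<close> competes with the cost
  \<open>2 * u powr p\<close>.\<close>

lemma descent_direction:
  assumes F: "norming_functional X nrm r F" and r: "r \<in> X" "0 < nrm r"
    and \<phi>: "\<phi> \<in> D" and \<eta>: "0 < \<eta>" "\<eta> \<le> norm (F \<phi>)"
  shows "\<exists>a. nrm (\<lambda>x. r x - a * \<phi> x) powr p \<le> nrm r powr p * (1 - (\<eta> / 4) powr q)"
proof -
  \<comment> \<open>The choice \<open>u powr (p - 1) = \<eta> / 4\<close> makes the cost
    \<open>u * \<eta> / 2\<close>, at most half of the gain, and \<open>u * \<eta> / 4\<close>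
    equals \<open>(\<eta> / 4) powr q\<close>.\<close>
  define u where "u = (\<eta> / 4) powr (1 / (p - 1))"
  define t where "t = u * nrm r"
  \<comment> \<open>The unimodular factor rotates \<open>a * F \<phi>\<close> onto the positive real
    axis, so that it adds up with \<open>F r = nrm r\<close>.\<close>
  define a where "a = of_real t * (of_real (norm (F \<phi>)) / F \<phi>)"
  have u: "0 < u" using \<eta> by (simp add: u_def)
  have t: "0 < t" using u r by (simp add: t_def)
  have "F \<phi> \<noteq> 0" using \<eta> by auto
  then have na: "norm a = t" using \<eta> t by (simp add: a_def norm_mult norm_divide)
  have \<phi>X: "\<phi> \<in> X" using \<phi> D_sub by auto
  have "F (\<lambda>x. r x + a * \<phi> x) = F r + a * F \<phi>"
    using F r \<phi>X scale_in[OF \<phi>X, of a]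
    by (simp add: norming_functional_def dual_space_def)
  also have "\<dots> = of_real (nrm r + t * norm (F \<phi>))"
    using F \<open>F \<phi> \<noteq> 0\<close> by (simp add: norming_functional_def a_def)
  finally have "norm (F (\<lambda>x. r x + a * \<phi> x)) = nrm r + t * norm (F \<phi>)"
    using r t by (metis abs_of_nonneg add_nonneg_nonneg less_imp_le mult_nonneg_nonneg norm_ge_zero norm_of_real)
  then have "nrm r + t * norm (F \<phi>) \<le> nrm (\<lambda>x. r x + a * \<phi> x)"
    using norming_le[OF F, of "\<lambda>x. r x + a * \<phi> x"] r \<phi>X add_in scale_in by simp
  moreover have "t * \<eta> \<le> t * norm (F \<phi>)" using t \<eta> by simp
  ultimately have up: "nrm r * (1 + u * \<eta>) \<le> nrm (\<lambda>x. r x + a * \<phi> x)"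
    by (simp add: t_def algebra_simps)
  have "nrm r powr p * (1 + p * (u * \<eta>)) \<le> nrm r powr p * (1 + u * \<eta>) powr p"
    using p_gt_1 u \<eta> by (intro mult_left_mono bernoulli_powr) auto
  also have "\<dots> = (nrm r * (1 + u * \<eta>)) powr p"
    using r u \<eta> by (simp add: powr_mult)
  also have "\<dots> \<le> nrm (\<lambda>x. r x + a * \<phi> x) powr p"
    using up p_gt_1 u \<eta> r by (intro powr_mono2) auto
  finally have lower: "nrm r powr p * (1 + p * (u * \<eta>)) \<le> nrm (\<lambda>x. r x + a * \<phi> x) powr p" .
  have "nrm (\<lambda>x. a * \<phi> x) \<le> t"
    using nrm_scale[OF \<phi>X, of a] na nrm_dict[OF \<phi>] t by (simp add: mult_left_le)
  then have "nrm (\<lambda>x. a * \<phi> x) powr p \<le> (u * nrm r) powr p"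
    using nrm_nonneg p_gt_1 by (intro powr_mono2) (auto simp: t_def)
  also have "\<dots> = nrm r powr p * u powr p"
    using u r by (simp add: powr_mult)
  finally have small: "nrm (\<lambda>x. a * \<phi> x) powr p \<le> nrm r powr p * u powr p" .
  have "u powr p = u powr (p - 1) * u"
    using u by (simp add: powr_diff)
  also have "u powr (p - 1) = \<eta> / 4"
    using p_gt_1 \<eta> by (simp add: u_def powr_powr)
  finally have up_eq: "u powr p = \<eta> / 4 * u" .
  have uq: "(\<eta> / 4) powr q = \<eta> / 4 * u"
    unfolding q_eq[symmetric] powr_add u_def using \<eta> by simp
  have combine: "M \<le> 2 * (N + W') - L" if "P + M \<le> 2 * (N + W)" "L \<le> P" "W \<le> W'" for P M N W L W' :: real
    using that by argo
  have pu: "u * \<eta> \<le> p * (u * \<eta>)" using p_gt_1 u \<eta> by simp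
  have "nrm (\<lambda>x. r x - a * \<phi> x) powr p
      \<le> 2 * (nrm r powr p + nrm r powr p * (\<eta> / 4 * u)) - nrm r powr p * (1 + p * (u * \<eta>))"
    by (rule combine[OF nrm_smooth[OF r(1) scale_in[OF \<phi>X, of a]] lower small[unfolded up_eq]])
  also have "\<dots> = nrm r powr p * (1 + \<eta> / 2 * u - p * (u * \<eta>))"
    by (simp add: algebra_simps)
  also have "\<dots> \<le> nrm r powr p * (1 - \<eta> / 4 * u)"
    using pu u \<eta> by (intro mult_left_mono) (auto simp: algebra_simps)
  finally show ?thesis unfolding uq by blast
qed

text \<open>A nonzero value of \<open>F\<close> would let the descent step lower the norm strictly
  along \<open>\<phi>\<close>; this takes the place of differentiating the norm.\<close>

lemma norming_vanishes:
  assumes F: "norming_functional X nrm r F" and r: "r \<in> X" "0 < nrm r"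
    and \<phi>: "\<phi> \<in> D" and min: "\<And>a. nrm r \<le> nrm (\<lambda>x. r x - a * \<phi> x)"
  shows "F \<phi> = 0"
proof (rule ccontr)
  assume "F \<phi> \<noteq> 0"
  then obtain a where a: "nrm (\<lambda>x. r x - a * \<phi> x) powr p \<le> nrm r powr p * (1 - (norm (F \<phi>) / 4) powr q)"
    using descent_direction[OF F r \<phi>, of "norm (F \<phi>)"] by auto
  have "nrm r powr p \<le> nrm (\<lambda>x. r x - a * \<phi> x) powr p"
    using min[of a] r p_gt_1 by (intro powr_mono2) auto
  also note a
  also have "nrm r powr p * (1 - (norm (F \<phi>) / 4) powr q) < nrm r powr p * 1"
    using r \<open>F \<phi> \<noteq> 0\<close> by (intro mult_strict_left_mono) auto
  finally show False by simp
qed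

end

text \<open>A run together with a competitor \<open>lincomb T c\<close>. The estimate
  \<open>l1_bound\<close> concerns only subsets of \<open>T\<close> with these coefficients, so
  \<open>V\<close> may grow with the size of \<open>T\<close>; the logarithm enters here.\<close>

locale greedy_run = greedy_space X nrm D p
  for X :: "('x \<Rightarrow> 'k::real_normed_field) set" and nrm D p +
  fixes \<tau> V :: real and f \<phi> G and T :: "('x \<Rightarrow> 'k) set" and c :: "('x \<Rightarrow> 'k) \<Rightarrow> 'k"
  assumes \<tau>_pos: "0 < \<tau>" and \<tau>_le_1: "\<tau> \<le> 1" and V_ge_1: "1 \<le> V"
    and f_in: "f \<in> X" and run: "wcga_run X nrm D \<tau> f \<phi> G"
    and T: "finite T" "T \<subseteq> D"
    and l1_bound: "\<And>A. A \<subseteq> T \<Longrightarrow> (\<Sum>b\<in>A. norm (c b)) \<le> V * real (card A) powr (1 / (p / (p - 1))) * nrm (lincomb A c)"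
begin

definition e where "e n = nrm (\<lambda>x. f x - G n x)"
definition \<Gamma> where "\<Gamma> n = \<phi> ` {..<n}"
definition \<delta> where "\<delta> = nrm (\<lambda>x. f x - lincomb T c x)"

lemma e_nonneg: "0 \<le> e n" and \<delta>_nonneg: "0 \<le> \<delta>"
  by (auto simp: e_def \<delta>_def nrm_nonneg)

lemma finite_\<Gamma>: "finite (\<Gamma> n)" by (simp add: \<Gamma>_def)

lemma \<Gamma>_mono: "m \<le> n \<Longrightarrow> \<Gamma> m \<subseteq> \<Gamma> n" by (auto simp: \<Gamma>_def)

lemma dist_to_le: "g \<in> S \<Longrightarrow> dist_to nrm h S \<le> nrm (\<lambda>x. h x - g x)"
  unfolding dist_to_def by (intro cINF_lower bdd_belowI2[where m=0] nrm_nonneg)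

lemma run_step:
  assumes "e n \<noteq> 0"
  shows "\<phi> n \<in> D"
    and "\<exists>F. norming_functional X nrm (\<lambda>x. f x - G n x) F \<and> norm (F (\<phi> n)) \<ge> \<tau> * (SUP \<psi>\<in>D. norm (F \<psi>))"
    and "G (Suc n) \<in> range (lincomb (\<Gamma> (Suc n)))"
    and "e (Suc n) = dist_to nrm f (range (lincomb (\<Gamma> (Suc n))))"
  using run[unfolded wcga_run_def, THEN conjunct2, THEN spec, of n] assms
  by (simp_all add: e_def lin_span_eq \<Gamma>_def lessThan_Suc_atMost)

lemma e_stop: "e n = 0 \<Longrightarrow> e (Suc n) = 0"
  using run[unfolded wcga_run_def, THEN conjunct2, THEN spec, of n] by (simp add: e_def)

text \<open>Restricted to a nonzero remainder: once it vanishes, a run puts no condition on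
  \<open>\<phi>\<close>, and \<open>\<Gamma> n\<close> may leave the dictionary.\<close>

lemma run_invariant:
  assumes "e n \<noteq> 0"
  shows "\<Gamma> n \<subseteq> D \<and> G n \<in> range (lincomb (\<Gamma> n)) \<and> (\<forall>a. e n \<le> nrm (\<lambda>x. f x - lincomb (\<Gamma> n) a x))"
  using assms
proof (induction n)
  case 0
  then show ?case using run by (auto simp: wcga_run_def e_def \<Gamma>_def lincomb_def)
next
  case (Suc n)
  then have "e n \<noteq> 0" using e_stop by blast
  from Suc.IH[OF this] run_step[OF this] show ?case
    by (auto simp: \<Gamma>_def lessThan_Suc intro!: dist_to_le)
qed

lemma lincomb_superset:
  assumes "finite W" "A \<subseteq> W"
  shows "lincomb A a = lincomb W (\<lambda>b. if b \<in> A then a b else 0)"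
  unfolding lincomb_def using assms
  by (intro ext sum.mono_neutral_cong_left) auto

lemma e_le:
  assumes "A \<subseteq> \<Gamma> n" shows "e n \<le> nrm (\<lambda>x. f x - lincomb A a x)"
proof (cases "e n = 0")
  case False
  show ?thesis unfolding lincomb_superset[OF finite_\<Gamma> assms]
    using run_invariant[OF False] by blast
qed (simp add: nrm_nonneg)

lemma e_Suc_le: 
  assumes "e n \<noteq> 0" shows "e (Suc n) \<le> nrm (\<lambda>x. (f x - G n x) - a * \<phi> n x)"
proof (cases "e (Suc n) = 0")
  case False
  obtain g where g: "G n = lincomb (\<Gamma> n) g" using run_invariant[OF assms] by auto
  \<comment> \<open>The two terms are added because \<open>\<phi> n\<close> is allowed to lie in
    \<open>\<Gamma> n\<close> already.\<close>
  let ?g = "\<lambda>b. (if b \<in> \<Gamma> n then g b else 0) + (if b = \<phi> n then a else 0)"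
  have "lincomb (\<Gamma> (Suc n)) ?g x = G n x + a * \<phi> n x" for x
  proof -
    have "lincomb (\<Gamma> (Suc n)) ?g x = lincomb (\<Gamma> (Suc n)) (\<lambda>b. if b \<in> \<Gamma> n then g b else 0) x
      + (\<Sum>b\<in>\<Gamma> (Suc n). if b = \<phi> n then a * b x else 0)"
      by (auto simp: lincomb_def sum.distrib[symmetric] distrib_right intro!: sum.cong)
    also have "(\<Sum>b\<in>\<Gamma> (Suc n). if b = \<phi> n then a * b x else 0) = a * \<phi> n x"
      by (subst sum.delta) (auto simp: finite_\<Gamma>, auto simp: \<Gamma>_def)
    also have "lincomb (\<Gamma> (Suc n)) (\<lambda>b. if b \<in> \<Gamma> n then g b else 0) = G n"
      unfolding g using \<Gamma>_mono[of n "Suc n"] by (intro lincomb_superset[symmetric] finite_\<Gamma>) auto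
    finally show ?thesis .
  qed
  then have "(\<lambda>x. f x - lincomb (\<Gamma> (Suc n)) ?g x) = (\<lambda>x. (f x - G n x) - a * \<phi> n x)"
    by (simp add: algebra_simps)
  then show ?thesis using e_le[of "\<Gamma> (Suc n)" "Suc n" ?g] by simp
qed (simp add: nrm_nonneg)

lemma e_decreasing_Suc: "e (Suc n) \<le> e n"
proof (cases "e n = 0")
  case False
  then show ?thesis using e_Suc_le[OF False, of 0] by (simp add: e_def)
next
  case True
  then show ?thesis using e_stop[OF True] by simp
qed

lemma e_decreasing: "m \<le> n \<Longrightarrow> e n \<le> e m"
  by (rule lift_Suc_antimono_le[of e, OF e_decreasing_Suc])

lemma G_in: "e n \<noteq> 0 \<Longrightarrow> G n \<in> X"
  using run_invariant[of n] lincomb_in[OF finite_\<Gamma>, of n] by auto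

lemma remainder_in: "e n \<noteq> 0 \<Longrightarrow> (\<lambda>x. f x - G n x) \<in> X"
  by (intro diff_in f_in G_in)

text \<open>The coefficients of \<open>lincomb T c - G n\<close> on \<open>T - \<Gamma> n\<close>
  are exactly \<open>c\<close>, so unconditionality discards the rest; that difference is, up to
  signs, the sum of the two errors.\<close>

lemma nrm_lincomb_unchosen:
  assumes "e n \<noteq> 0" "A \<subseteq> T - \<Gamma> n"
  shows "nrm (lincomb A c) \<le> 2 * (\<delta> + e n)"
proof -
  obtain g where g: "G n = lincomb (\<Gamma> n) g" and \<Gamma>D: "\<Gamma> n \<subseteq> D" using run_invariant[OF assms(1)] by auto
  let ?W = "T \<union> \<Gamma> n"
  let ?a = "\<lambda>b. (if b \<in> T then c b else 0) - (if b \<in> \<Gamma> n then g b else 0)"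
  have fin: "finite ?W" "?W \<subseteq> D" using T finite_\<Gamma> \<Gamma>D by auto
  have "nrm (lincomb A c) = nrm (lincomb A ?a)"
    using assms(2) unfolding lincomb_def by (intro arg_cong[of _ _ nrm] ext sum.cong) auto
  also have "nrm (lincomb A ?a) \<le> nrm (lincomb ?W ?a)"
    using fin assms by (intro unconditional) auto
  also have "lincomb ?W ?a = (\<lambda>x. lincomb ?W (\<lambda>b. if b \<in> T then c b else 0) x - lincomb ?W (\<lambda>b. if b \<in> \<Gamma> n then g b else 0) x)"
    by (simp add: lincomb_def left_diff_distrib sum_subtractf)
  also have "\<dots> = (\<lambda>x. lincomb T c x - G n x)"
    unfolding g by (subst (1 2) lincomb_superset[OF fin(1), symmetric]) auto
  also have "\<dots> = (\<lambda>x. - (f x - lincomb T c x) + (f x - G n x))" by auto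
  also have "nrm \<dots> \<le> 2 * (nrm (\<lambda>x. - (f x - lincomb T c x)) + e n)"
    unfolding e_def using assms T f_in scale_in[of "\<lambda>x. f x - lincomb T c x" "-1"]
    by (intro nrm_quasi_triangle remainder_in) (auto simp: diff_in lincomb_in)
  also have "nrm (\<lambda>x. - (f x - lincomb T c x)) = \<delta>"
    unfolding \<delta>_def by (intro nrm_minus diff_in f_in lincomb_in T)
  finally show ?thesis .
qed

text \<open>The relative decrease per step will be \<open>\<kappa> / a\<close>. The 20 is the 4 of
  \<open>descent_direction\<close> times the 5 in the lower bound
  \<open>1 / (5 * V * a powr (1 / q))\<close> for the functional on the dictionary.\<close>

definition \<kappa> where "\<kappa> = (\<tau> / (20 * V)) powr q"

lemma \<kappa>: "0 < \<kappa>" "\<kappa> \<le> 1"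
  using \<tau>_pos \<tau>_le_1 V_ge_1 q_gt_1 by (auto simp: \<kappa>_def divide_simps intro!: powr_le1)

text \<open>\<open>B\<close> has negligible norm, \<open>A\<close> has few terms, and the rest of
  \<open>T\<close> is already chosen, where \<open>F\<close> vanishes. Hence
  \<open>lincomb A c\<close> carries at least half of \<open>F (f - G n) = e n\<close>, and the l1
  estimate turns this into a large value of \<open>F\<close> at a single dictionary element.\<close>

lemma decay_step:
  assumes en: "e n \<noteq> 0" and AB: "A \<subseteq> T" "B \<subseteq> T" "A \<inter> B = {}" "T \<subseteq> A \<union> B \<union> \<Gamma> n"
    and small: "4 * \<delta> \<le> e n" "4 * nrm (lincomb B c) \<le> e n"
    and a: "card A \<le> a" "0 < a"
  shows "e (Suc n) powr p \<le> e n powr p * (1 - \<kappa> / real a)"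
proof -
  let ?r = "\<lambda>x. f x - G n x"
  obtain F where F: "norming_functional X nrm ?r F" and sel: "norm (F (\<phi> n)) \<ge> \<tau> * (SUP \<psi>\<in>D. norm (F \<psi>))"
    using run_step[OF en] by blast
  have Fd: "F \<in> dual_space X nrm" and Fr: "F ?r = of_real (e n)"
    using F by (auto simp: norming_functional_def e_def)
  note add = dual_add[OF Fd]
  have en_pos: "0 < e n" using en e_nonneg[of n] by simp
  obtain g where g: "G n = lincomb (\<Gamma> n) g" and \<Gamma>D: "\<Gamma> n \<subseteq> D" using run_invariant[OF en] by auto
  \<comment> \<open>\<open>G n\<close> is a best approximation from the span of
    \<open>\<Gamma> n\<close>, so no multiple of a chosen element improves it and
    \<open>norming_vanishes\<close> applies.\<close>
  have van: "F b = 0" if "b \<in> \<Gamma> n" for b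
  proof (rule norming_vanishes[OF F remainder_in[OF en]])
    show "b \<in> D" using that \<Gamma>D by auto
    fix a
    let ?g = "\<lambda>b'. g b' + (if b' = b then a else 0)"
    have "lincomb (\<Gamma> n) ?g x = G n x + a * b x" for x
    proof -
      have "lincomb (\<Gamma> n) ?g x = G n x + (\<Sum>b'\<in>\<Gamma> n. if b' = b then a * b' x else 0)"
        by (auto simp: g lincomb_def sum.distrib[symmetric] distrib_right intro!: sum.cong)
      then show ?thesis using that by (simp add: sum.delta finite_\<Gamma>)
    qed
    then show "nrm ?r \<le> nrm (\<lambda>x. ?r x - a * b x)"
      using e_le[of "\<Gamma> n" n ?g] by (simp add: e_def algebra_simps)
  qed (use en_pos e_def in auto)
  define A' B' C where "A' = A - \<Gamma> n" and "B' = B - \<Gamma> n" and "C = T \<inter> \<Gamma> n"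
  have fins: "finite A'" "finite B'" "finite C" "A' \<subseteq> D" "B' \<subseteq> D" "C \<subseteq> D"
    using AB T finite_subset[OF AB(1) T(1)] finite_subset[OF AB(2) T(1)]
    unfolding A'_def B'_def C_def by auto
  let ?h = "\<lambda>x. f x - lincomb T c x"
  have hX: "?h \<in> X" by (intro diff_in f_in lincomb_in T)
  have Tsplit: "T = (A' \<union> B') \<union> C" "A' \<inter> B' = {}" "(A' \<union> B') \<inter> C = {}"
    using AB unfolding A'_def B'_def C_def by auto
  have "lincomb T c x = lincomb A' c x + lincomb B' c x + lincomb C c x" for x
    unfolding lincomb_def by (subst Tsplit(1)) (use fins Tsplit in \<open>simp add: sum.union_disjoint\<close>)
  then have dec: "?r = (\<lambda>x. (?h x + lincomb A' c x) + (lincomb B' c x + (lincomb C c x + - 1 * lincomb (\<Gamma> n) g x)))"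
    by (auto simp: g algebra_simps)
  have FC: "F (lincomb C c) = 0" "F (lincomb (\<Gamma> n) g) = 0"
    by (subst dual_lincomb[OF Fd], use fins \<Gamma>D finite_\<Gamma> van C_def in \<open>auto intro!: sum.neutral\<close>)+
  have sc: "F (\<lambda>x. - 1 * lincomb (\<Gamma> n) g x) = - 1 * F (lincomb (\<Gamma> n) g)"
    by (rule dual_scale[OF Fd lincomb_in[OF finite_\<Gamma> \<Gamma>D]])
  have X4: "lincomb A' c \<in> X" "lincomb B' c \<in> X" "lincomb C c \<in> X" "(\<lambda>x. - 1 * lincomb (\<Gamma> n) g x) \<in> X"
    using fins \<Gamma>D finite_\<Gamma> by (blast intro: lincomb_in scale_in)+
  have "F ?r = (F ?h + F (lincomb A' c)) + (F (lincomb B' c) + (F (lincomb C c) + - 1 * F (lincomb (\<Gamma> n) g)))"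
    unfolding dec sc[symmetric] using hX X4
    by (simp only: add[OF add_in add_in[OF _ add_in]] add[OF _ add_in] add)
  then have "of_real (e n) = F ?h + F (lincomb A' c) + F (lincomb B' c)"
    unfolding Fr FC by simp
  then have "norm (of_real (e n) :: 'k) \<le> norm (F ?h) + norm (F (lincomb A' c)) + norm (F (lincomb B' c))"
    by (metis add_right_mono norm_triangle_ineq norm_triangle_le)
  moreover have "norm (F ?h) \<le> \<delta>" unfolding \<delta>_def by (rule norming_le[OF F hX])
  moreover have "norm (F (lincomb B' c)) \<le> nrm (lincomb B' c)"
    using fins by (intro norming_le[OF F] lincomb_in)
  moreover have "nrm (lincomb B' c) \<le> nrm (lincomb B c)"
    using AB T finite_subset by (intro unconditional) (auto simp: B'_def)
  ultimately have half: "e n \<le> 2 * norm (F (lincomb A' c))" using small en_pos by simp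
  define s where "s = (SUP \<psi>\<in>D. norm (F \<psi>))"
  have s: "norm (F b) \<le> s" if "b \<in> D" for b
    unfolding s_def using that
  proof (rule cSUP_upper)
    show "bdd_above ((\<lambda>\<psi>. norm (F \<psi>)) ` D)"
      using norming_le[OF F] nrm_dict D_sub by (intro bdd_aboveI2[where M=1]) force
  qed
  have s0: "0 \<le> s" using s[OF run_step(1)[OF en]] norm_ge_zero order_trans by blast
  have "norm (F (lincomb A' c)) \<le> (\<Sum>b\<in>A'. norm (c b) * s)"
    unfolding dual_lincomb[OF Fd fins(1,4)]
    using fins s by (intro sum_norm_le) (auto simp: norm_mult intro!: mult_left_mono)
  also have "\<dots> = (\<Sum>b\<in>A'. norm (c b)) * s" by (simp add: sum_distrib_right)
  also have "\<dots> \<le> (V * real (card A') powr (1 / q) * nrm (lincomb A' c)) * s"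
    using AB l1_bound[of A'] s0 by (intro mult_right_mono) (auto simp: A'_def q_def)
  \<comment> \<open>\<open>5 / 2 * e n\<close> is \<open>2 * (\<delta> + e n)\<close> with
    \<open>\<delta>\<close> at most \<open>e n / 4\<close>.\<close>
  also have "\<dots> \<le> (V * real a powr (1 / q) * (5 / 2 * e n)) * s"
  proof (intro mult_right_mono mult_mono mult_left_mono powr_mono2)
    have "finite A" by (rule finite_subset[OF AB(1) T(1)])
    then show "real (card A') \<le> real a"
      using a card_mono[of A A'] by (auto simp: A'_def)
    show "nrm (lincomb A' c) \<le> 5 / 2 * e n"
      using nrm_lincomb_unchosen[OF en, of A'] small Diff_mono[OF AB(1) order_refl, of "\<Gamma> n"] by (simp add: A'_def)
  qed (use q_gt_1 V_ge_1 s0 nrm_nonneg in auto)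
  finally have "e n \<le> e n * (5 * V * real a powr (1 / q) * s)" using half by (simp add: algebra_simps)
  then have s1: "1 \<le> 5 * V * real a powr (1 / q) * s" using en_pos by simp
  define \<eta> where "\<eta> = \<tau> / (5 * V * real a powr (1 / q))"
  have den: "0 < 5 * V * real a powr (1 / q)" using V_ge_1 a by simp
  have \<eta>0: "0 < \<eta>" using den \<tau>_pos by (simp add: \<eta>_def)
  have "\<eta> * 1 \<le> \<eta> * (5 * V * real a powr (1 / q) * s)" using s1 \<eta>0 by (intro mult_left_mono) auto
  also have "\<dots> = \<tau> * s"
  proof -
    have "\<tau> / K * (K * s) = \<tau> * s" if "0 < K" for K using that by simp
    from this[OF den] show ?thesis by (simp only: \<eta>_def)
  qed
  also have "\<dots> \<le> norm (F (\<phi> n))" using sel by (simp add: s_def)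
  finally have "\<eta> \<le> norm (F (\<phi> n))" by simp
  from descent_direction[OF F remainder_in[OF en] _ run_step(1)[OF en] \<eta>0 this] en_pos
  obtain \<alpha> where \<alpha>: "nrm (\<lambda>x. ?r x - \<alpha> * \<phi> n x) powr p \<le> e n powr p * (1 - (\<eta> / 4) powr q)"
    by (auto simp: e_def)
  have "e (Suc n) powr p \<le> nrm (\<lambda>x. ?r x - \<alpha> * \<phi> n x) powr p"
    using e_Suc_le[OF en] p_gt_1 e_nonneg by (intro powr_mono2) auto
  also note \<alpha>
  also have "(\<eta> / 4) powr q = (\<tau> / (20 * V) / real a powr (1 / q)) powr q"
    by (simp add: \<eta>_def mult.assoc)
  also have "\<dots> = \<kappa> / (real a powr (1 / q)) powr q"
    unfolding \<kappa>_def using \<tau>_pos V_ge_1 a by (subst powr_divide) auto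
  also have "(real a powr (1 / q)) powr q = real a"
    using q_gt_1 a by (simp add: powr_powr)
  finally show ?thesis .
qed

text \<open>\<open>decay_step\<close> applies as long as the error exceeds the threshold; since the
  error never increases, falling below it once is permanent.\<close>

lemma decay:
  assumes AB: "A \<subseteq> T" "B \<subseteq> T" "A \<inter> B = {}" "T \<subseteq> A \<union> B \<union> \<Gamma> n"
    and a: "card A \<le> a" "0 < a"
  shows "e (n + r) \<le> 4 * max \<delta> (nrm (lincomb B c)) \<or> e (n + r) powr p \<le> e n powr p * (1 - \<kappa> / real a) ^ r"
proof (induction r)
  case (Suc r)
  show ?case
  proof (cases "e (n + Suc r) \<le> 4 * max \<delta> (nrm (lincomb B c))")
    case False
    have "e (n + Suc r) \<le> e (n + r)" by (intro e_decreasing) simp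
    then have big: "4 * max \<delta> (nrm (lincomb B c)) < e (n + r)" using False by simp
    then have IH: "e (n + r) powr p \<le> e n powr p * (1 - \<kappa> / real a) ^ r" using Suc by auto
    have "e (n + r) \<noteq> 0" using big \<delta>_nonneg by auto
    then have "e (Suc (n + r)) powr p \<le> e (n + r) powr p * (1 - \<kappa> / real a)"
      using big AB a \<Gamma>_mono[of n "n + r"] by (intro decay_step[of _ A B]) auto
    also have "\<dots> \<le> (e n powr p * (1 - \<kappa> / real a) ^ r) * (1 - \<kappa> / real a)"
      using IH \<kappa> a by (intro mult_right_mono) (auto simp: divide_simps)
    finally show ?thesis by (simp add: mult_ac)
  qed simp
qed simp

text \<open>A phase of \<open>\<rho> * a\<close> steps multiplies the p-th power of the error by at
  most \<open>exp (- \<kappa> * \<rho>)\<close>, and \<open>\<rho>\<close> brings this down to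
  \<open>20 powr (- p)\<close>.\<close>

definition \<rho> where "\<rho> = nat \<lceil>p * ln 20 / \<kappa>\<rceil>"

lemma phase:
  assumes AB: "A \<subseteq> T" "B \<subseteq> T" "A \<inter> B = {}" "T \<subseteq> A \<union> B \<union> \<Gamma> n"
    and a: "card A \<le> a" "0 < a"
  shows "e (n + \<rho> * a) \<le> max (4 * max \<delta> (nrm (lincomb B c))) (e n / 20)"
proof (cases "e (n + \<rho> * a) \<le> 4 * max \<delta> (nrm (lincomb B c))")
  case False
  then have "e (n + \<rho> * a) powr p \<le> e n powr p * (1 - \<kappa> / real a) ^ (\<rho> * a)"
    using decay[OF assms] by blast
  also have "(1 - \<kappa> / real a) ^ (\<rho> * a) \<le> exp (- (\<kappa> / real a)) ^ (\<rho> * a)"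
    using \<kappa> a exp_ge_add_one_self[of "- (\<kappa> / real a)"] by (intro power_mono) (auto simp: divide_simps)
  also have "\<dots> = exp (- (\<kappa> * real \<rho>))"
    using a by (simp add: exp_of_nat_mult[symmetric])
  also have "\<dots> \<le> exp (- (p * ln 20))"
  proof -
    have "p * ln 20 / \<kappa> \<le> real \<rho>" unfolding \<rho>_def by (rule of_nat_ceiling)
    then show ?thesis using \<kappa> by (simp add: divide_simps mult.commute)
  qed
  also have "\<dots> = 20 powr (- p)" by (simp add: powr_def)
  also have "e n powr p * 20 powr (- p) = (e n / 20) powr p"
    using e_nonneg[of n] by (simp add: powr_divide powr_minus_divide)
  finally have "e (n + \<rho> * a) powr p \<le> (e n / 20) powr p" by (simp add: mult_left_mono)
  then show ?thesis
    using p_gt_1 e_nonneg powr_less_mono2[of p "e n / 20" "e (n + \<rho> * a)"]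
    by (force simp: not_le[symmetric])
qed simp

text \<open>Amortized counting (after Livshitz and Temlyakov): \<open>\<beta> j\<close> is the best error when
  \<open>2\<^sup>j\<^sup>-\<^sup>1\<close> elements of the unchosen part of \<open>T\<close> are removed.  Up to the first index \<open>l\<close> where \<open>\<beta>\<close> drops
  by the factor \<open>20\<close>, the phases of lengths \<open>\<rho> 2\<^sup>j\<close> keep the error comparable to \<open>\<beta> j\<close>; after
  the drop the error is too small for fewer than \<open>2\<^sup>l\<^sup>-\<^sup>1\<close> new elements of \<open>T\<close> to have been chosen.  Hence
  the number of steps is proportional to the number of elements of \<open>T\<close> that they pick up.\<close>

lemma progress:
  assumes "T - \<Gamma> k \<noteq> {}"
  shows "\<exists>m\<ge>k. m \<le> k + 4 * \<rho> * card (T - \<Gamma> k) \<and> e m \<le> 4 * \<delta> \<or> (card (T - \<Gamma> m) < card (T - \<Gamma> k) \<and> m + 4 * \<rho> * card (T - \<Gamma> m) \<le> k + 4 * \<rho> * card (T - \<Gamma> k))"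
proof -
  define U where "U = T - \<Gamma> k"
  have U: "finite U" "U \<subseteq> T" using T by (auto simp: U_def)
  \<comment> \<open>At most \<open>a j\<close> terms are removed; \<open>a 0 = 0\<close>, so
    \<open>\<beta> 0\<close> is the norm of the whole unchosen part.\<close>
  define a where "a j = (if j = 0 then 0 else 2 ^ (j - 1) :: nat)" for j
  define Fam where "Fam j = {A. A \<subseteq> U \<and> card A \<le> a j}" for j
  define \<beta> where "\<beta> j = Min ((\<lambda>A. nrm (lincomb (U - A) c)) ` Fam j)" for j
  have Fam: "finite (Fam j)" "{} \<in> Fam j" for j
    using U finite_subset[of "Fam j" "Pow U"] by (auto simp: Fam_def)
  have \<beta>_le: "\<beta> j \<le> nrm (lincomb (U - A) c)" if "A \<subseteq> U" "card A \<le> a j" for A j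
    unfolding \<beta>_def using Fam that by (intro Min_le) (auto simp: Fam_def)
  have \<beta>_ex: "\<exists>A. A \<subseteq> U \<and> card A \<le> a j \<and> \<beta> j = nrm (lincomb (U - A) c)" for j
  proof -
    have "\<beta> j \<in> (\<lambda>A. nrm (lincomb (U - A) c)) ` Fam j"
      unfolding \<beta>_def using Fam[of j] by (intro Min_in) auto
    then show ?thesis by (auto simp: Fam_def)
  qed
  have \<beta>_nonneg: "0 \<le> \<beta> j" for j using \<beta>_ex[of j] nrm_nonneg by auto
  \<comment> \<open>Since \<open>2 ^ card U\<close> is at least \<open>card U\<close>, all of
    \<open>U\<close> may be removed at this index; \<open>\<beta>\<close> is 0 there, which
    guarantees that a drop occurs.\<close>
  have "\<beta> (Suc (card U)) \<le> nrm (lincomb (U - U) c)"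
    by (intro \<beta>_le) (auto simp: a_def less_imp_le)
  then have "20 * \<beta> (Suc (card U)) \<le> \<beta> (card U)"
    using nrm_zero \<beta>_nonneg[of "card U"] by (simp add: lincomb_def)
  then have ex: "\<exists>l. 20 * \<beta> (Suc l) \<le> \<beta> l" by blast
  define l where "l = (LEAST l. 20 * \<beta> (Suc l) \<le> \<beta> l)"
  have l: "20 * \<beta> (Suc l) \<le> \<beta> l" unfolding l_def using ex by (rule LeastI_ex)
  have lmin: "\<beta> j < 20 * \<beta> (Suc j)" if "j < l" for j
    using not_less_Least[of j "\<lambda>l. 20 * \<beta> (Suc l) \<le> \<beta> l"] that by (simp add: l_def)
  \<comment> \<open>\<open>\<rho> * (2 ^ j - 1)\<close> is the total length of the phases 1 to
    \<open>j\<close>, phase \<open>j\<close> taking \<open>\<rho> * a j\<close> steps.\<close>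
  define t where "t j = k + \<rho> * (2 ^ j - 1)" for j :: nat
  have t_Suc: "t (Suc j) = t j + \<rho> * a (Suc j)" for j
  proof -
    have "2 ^ Suc j - 1 = (2 ^ j - 1) + (2 ^ j :: nat)" by simp
    then show ?thesis by (simp only: t_def a_def distrib_left) simp
  qed
  have ph: "e (t (Suc j)) \<le> max (4 * max \<delta> (\<beta> (Suc j))) (e (t j) / 20)" for j
  proof -
    obtain A where A: "A \<subseteq> U" "card A \<le> a (Suc j)" "\<beta> (Suc j) = nrm (lincomb (U - A) c)"
      using \<beta>_ex by blast
    have "\<Gamma> k \<subseteq> \<Gamma> (t j)" by (intro \<Gamma>_mono) (simp add: t_def)
    then show ?thesis unfolding t_Suc A(3)
      using A U by (intro phase) (auto simp: a_def U_def)
  qed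
  have ek: "e k \<le> 4 * max \<delta> (\<beta> 0)"
  proof -
    obtain A where A: "A \<subseteq> U" "card A \<le> a 0" "\<beta> 0 = nrm (lincomb (U - A) c)"
      using \<beta>_ex by blast
    then have "A = {}" using finite_subset[OF A(1) U(1)] by (simp add: a_def)
    then have \<beta>0: "\<beta> 0 = nrm (lincomb U c)" using A by simp
    have "lincomb T c x = lincomb U c x + lincomb (T \<inter> \<Gamma> k) c x" for x
      unfolding lincomb_def U_def using T by (subst sum.Int_Diff[of T _ "\<Gamma> k"]) auto
    then have "(\<lambda>x. f x - lincomb (T \<inter> \<Gamma> k) c x) = (\<lambda>x. (f x - lincomb T c x) + lincomb U c x)"
      by (simp add: fun_eq_iff)
    then have "e k \<le> nrm (\<lambda>x. (f x - lincomb T c x) + lincomb U c x)"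
      using e_le[of "T \<inter> \<Gamma> k" k c] by simp
    also have "\<dots> \<le> 2 * (\<delta> + \<beta> 0)"
      unfolding \<beta>0 \<delta>_def using T U by (intro nrm_quasi_triangle diff_in f_in lincomb_in) auto
    finally show ?thesis by simp
  qed
  \<comment> \<open>A phase divides the error by 20 or reaches the next threshold; before the drop
    \<open>\<beta> j < 20 * \<beta> (Suc j)\<close>, so the first alternative also lands below the
    next threshold.\<close>
  have chain: "e (t j) \<le> 4 * max \<delta> (\<beta> j)" if "j \<le> l" for j
    using that
  proof (induction j)
    case 0
    then show ?case using ek by (simp add: t_def)
  next
    case (Suc j)
    then show ?case using ph[of j] lmin[of j] \<delta>_nonneg by (auto simp: max_def split: if_splits)
  qed
  define m where "m = t (Suc l)"
  have em: "e m \<le> 4 * max \<delta> (\<beta> l / 20)"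
    unfolding m_def using ph[of l] chain[of l] l \<delta>_nonneg by (auto simp: max_def split: if_splits)
  have km: "k \<le> m" by (simp add: m_def t_def)
  show ?thesis
  proof (cases "e m \<le> 4 * \<delta>")
    case False
    then have em2: "e m \<le> \<beta> l / 5" using em by (auto simp: max_def split: if_splits)
    have "e m \<noteq> 0" using False \<delta>_nonneg by auto
    then have "nrm (lincomb (T - \<Gamma> m) c) \<le> 2 * (\<delta> + e m)" by (rule nrm_lincomb_unchosen) simp
    \<comment> \<open>Here \<open>\<delta> < e m / 4\<close> and
      \<open>e m \<le> \<beta> l / 5\<close>, so the left side is below
      \<open>\<beta> l / 2\<close>.\<close>
    also have "\<dots> < \<beta> l" using False em2 \<delta>_nonneg by (simp add: field_simps)
    finally have lt: "nrm (lincomb (T - \<Gamma> m) c) < \<beta> l" .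
    have sub: "T - \<Gamma> m \<subseteq> U" using \<Gamma>_mono[OF km] by (auto simp: U_def)
    \<comment> \<open>The elements picked up between times \<open>k\<close> and \<open>m\<close>.
      What remains has norm below \<open>\<beta> l\<close>, so by minimality more than
      \<open>a l\<close> elements were removed.\<close>
    define Z where "Z = U - (T - \<Gamma> m)"
    have "U - Z = T - \<Gamma> m" using sub by (auto simp: Z_def)
    then have "a l < card Z" using \<beta>_le[of Z l] lt by (force simp: Z_def)
    have cZ: "card Z + card (T - \<Gamma> m) = card U"
      using sub U finite_subset[OF sub] unfolding Z_def by (metis card_Diff_subset card_mono le_add_diff_inverse2)
    \<comment> \<open>For \<open>l > 0\<close> the left side is \<open>4 * a l\<close>; this is the
      origin of the 4 in the budget \<open>4 * \<rho>\<close> per element.\<close>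
    have "2 ^ Suc l \<le> 4 * card Z"
    proof (cases l)
      case (Suc l')
      then show ?thesis using \<open>a l < card Z\<close> by (simp add: a_def)
    qed (use \<open>a l < card Z\<close> in \<open>simp add: a_def\<close>)
    then have "\<rho> * (2 ^ Suc l - 1) \<le> \<rho> * (4 * card Z)" by (intro mult_left_mono) auto
    then have "m + 4 * \<rho> * card (T - \<Gamma> m) \<le> k + \<rho> * (4 * card Z) + 4 * \<rho> * card (T - \<Gamma> m)"
      unfolding m_def t_def by simp
    also have "\<dots> = k + 4 * \<rho> * card U" unfolding cZ[symmetric] by (simp add: algebra_simps)
    finally show ?thesis using km \<open>a l < card Z\<close> cZ unfolding U_def by force
  next
    case True
    have "2 ^ Suc l \<le> 4 * card U"
    proof (cases l)
      case 0
      then show ?thesis using assms U by (simp add: U_def[symmetric] Suc_le_eq card_gt_0_iff)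
    next
      case (Suc l')
      \<comment> \<open>The absence of a drop at \<open>l - 1\<close> forces
        \<open>\<beta> l > 0\<close>, hence \<open>a l\<close> is not yet enough to remove all of
        \<open>U\<close>.\<close>
      have "\<beta> l \<noteq> 0" using lmin[of l'] \<beta>_nonneg[of l'] Suc by auto
      have "a l < card U"
      proof (rule ccontr)
        assume "\<not> a l < card U"
        then have "\<beta> l \<le> nrm (lincomb (U - U) c)" by (intro \<beta>_le) auto
        then show False using \<open>\<beta> l \<noteq> 0\<close> \<beta>_nonneg[of l] nrm_zero by (simp add: lincomb_def)
      qed
      then show ?thesis using Suc by (simp add: a_def)
    qed
    then have "\<rho> * (2 ^ Suc l - 1) \<le> \<rho> * (4 * card U)" by (intro mult_left_mono) auto
    then have "m \<le> k + 4 * \<rho> * card (T - \<Gamma> k)" by (simp add: m_def t_def U_def)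
    then show ?thesis using km True by blast
  qed
qed

text \<open>\<open>k + 4 * \<rho> * card (T - \<Gamma> k)\<close> does not increase under
  \<open>progress\<close> while the unchosen part shrinks, so its value at \<open>k = 0\<close>
  bounds the total time. Once all of \<open>T\<close> is chosen, the error is at most
  \<open>\<delta>\<close>.\<close>

lemma run_error_bound:
  assumes "4 * \<rho> * card T \<le> n"
  shows "e n \<le> 4 * \<delta>"
proof -
  have "\<exists>m \<le> k + 4 * \<rho> * card (T - \<Gamma> k). e m \<le> 4 * \<delta>" for k
  proof (induction "card (T - \<Gamma> k)" arbitrary: k rule: less_induct)
    case less
    show ?case
    proof (cases "T - \<Gamma> k = {}")
      case True
      then have "e k \<le> \<delta>" unfolding \<delta>_def by (intro e_le) auto
      then show ?thesis using \<delta>_nonneg by (intro exI[of _ k]) auto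
    next
      case False
      from progress[OF this] obtain m where m: "m \<ge> k"
        "m \<le> k + 4 * \<rho> * card (T - \<Gamma> k) \<and> e m \<le> 4 * \<delta> \<or> card (T - \<Gamma> m) < card (T - \<Gamma> k) \<and> m + 4 * \<rho> * card (T - \<Gamma> m) \<le> k + 4 * \<rho> * card (T - \<Gamma> k)"
        by blast
      show ?thesis
      proof (cases "card (T - \<Gamma> m) < card (T - \<Gamma> k) \<and> m + 4 * \<rho> * card (T - \<Gamma> m) \<le> k + 4 * \<rho> * card (T - \<Gamma> k)")
        case True
        with less[of m] show ?thesis by (meson order_trans)
      next
        case False
        then show ?thesis using m by blast
      qed
    qed
  qed
  from this[of 0] obtain m where "m \<le> 4 * \<rho> * card T" "e m \<le> 4 * \<delta>" by (auto simp: \<Gamma>_def)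
  then show ?thesis using e_decreasing[of m n] assms by linarith
qed

end

section \<open>Convexity inequalities\<close>

text \<open>A concave power lies below its tangent at \<open>w\<close>. With \<open>w\<close> a mean
  this becomes Jensen's inequality or the power mean inequality.\<close>

lemma powr_le_tangent:
  fixes x w \<alpha> :: real
  assumes "0 < \<alpha>" "\<alpha> \<le> 1" "0 \<le> x" "0 < w"
  shows "x powr \<alpha> \<le> w powr (\<alpha> - 1) * (\<alpha> * x + (1 - \<alpha>) * w)"
proof (cases "x = 0")
  case True
  then show ?thesis using assms by simp
next
  case False
  have "x powr \<alpha> * w powr (1 - \<alpha>) \<le> \<alpha> * x + (1 - \<alpha>) * w"
    using assms False by (intro Youngs_inequality_0) auto
  then have "w powr (\<alpha> - 1) * (x powr \<alpha> * w powr (1 - \<alpha>)) \<le> w powr (\<alpha> - 1) * (\<alpha> * x + (1 - \<alpha>) * w)"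
    by (intro mult_left_mono) auto
  moreover have "w powr (\<alpha> - 1) * (x powr \<alpha> * w powr (1 - \<alpha>)) = x powr \<alpha>"
    using assms by (simp add: mult.left_commute powr_add[symmetric])
  ultimately show ?thesis by simp
qed

lemma powr_concave:
  fixes x y s \<alpha> :: real
  assumes "0 < \<alpha>" "\<alpha> \<le> 1" "0 \<le> x" "0 \<le> y" "0 \<le> s" "s \<le> 1"
  shows "s * x powr \<alpha> + (1 - s) * y powr \<alpha> \<le> (s * x + (1 - s) * y) powr \<alpha>"
proof -
  define w where "w = s * x + (1 - s) * y"
  have w0: "0 \<le> w" using assms by (auto simp: w_def)
  show ?thesis
  proof (cases "w = 0")
    case True
    then have "s * x = 0" "(1 - s) * y = 0"
      using assms by (auto simp: w_def add_nonneg_eq_0_iff)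
    then have "s * x powr \<alpha> = 0" "(1 - s) * y powr \<alpha> = 0" by auto
    then have "s * x powr \<alpha> + (1 - s) * y powr \<alpha> = 0" by argo
    then show ?thesis by (metis powr_ge_zero)
  next
    case False
    then have w: "0 < w" using w0 by simp
    have "s * x powr \<alpha> + (1 - s) * y powr \<alpha>
       \<le> s * (w powr (\<alpha> - 1) * (\<alpha> * x + (1 - \<alpha>) * w)) + (1 - s) * (w powr (\<alpha> - 1) * (\<alpha> * y + (1 - \<alpha>) * w))"
      using assms w by (intro add_mono mult_left_mono powr_le_tangent) auto
    also have "\<dots> = w powr (\<alpha> - 1) * (\<alpha> * (s * x + (1 - s) * y) + (1 - \<alpha>) * w)"
      by (simp add: algebra_simps)
    also have "\<dots> = w powr (\<alpha> - 1) * w"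
      unfolding w_def[symmetric] by (simp add: algebra_simps)
    also have "\<dots> = w powr \<alpha>" using w by (simp add: powr_diff)
    finally show ?thesis by (simp add: w_def)
  qed
qed

text \<open>Karamata's inequality for a concave power: \<open>A\<close> and \<open>B\<close> are
  convex combinations of \<open>P\<close> and \<open>Q\<close> with interchanged weights. The case
  \<open>Q = 0\<close> is subadditivity.\<close>

lemma powr_sum_majorization:
  fixes A B P Q \<alpha> :: real
  assumes \<alpha>: "0 < \<alpha>" "\<alpha> \<le> 1" and "0 \<le> Q" "Q \<le> A" "A \<le> P" "A + B = P + Q"
  shows "P powr \<alpha> + Q powr \<alpha> \<le> A powr \<alpha> + B powr \<alpha>"
proof (cases "P = Q")
  case True
  then show ?thesis using assms by auto
next
  case False
  then have PQ: "0 < P - Q" using assms by auto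
  define s where "s = (A - Q) / (P - Q)"
  have s: "0 \<le> s" "s \<le> 1" using assms PQ by (auto simp: s_def divide_simps)
  have "s * (P - Q) = A - Q" using PQ by (simp add: s_def)
  then have A: "A = s * P + (1 - s) * Q" and B: "B = s * Q + (1 - s) * P"
    using assms(6) by (auto simp: algebra_simps)
  have "s * P powr \<alpha> + (1 - s) * Q powr \<alpha> \<le> A powr \<alpha>"
    unfolding A using assms s by (intro powr_concave) auto
  moreover have "s * Q powr \<alpha> + (1 - s) * P powr \<alpha> \<le> B powr \<alpha>"
    unfolding B using assms s by (intro powr_concave) auto
  ultimately show ?thesis by (simp add: algebra_simps)
qed

lemma square_powr_half: "(x\<^sup>2) powr (a / 2) = \<bar>x\<bar> powr a" for x a :: real
proof -
  have "(\<bar>x\<bar> powr 2) powr (a / 2) = \<bar>x\<bar> powr a" unfolding powr_powr by simp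
  then show ?thesis by simp
qed

lemma powr_le_linear:
  fixes x \<alpha> :: real
  assumes "0 < \<alpha>" "\<alpha> \<le> 1" "0 \<le> x"
  shows "(1 + x) powr \<alpha> \<le> 1 + \<alpha> * x"
  using powr_le_tangent[of \<alpha> "1 + x" 1] assms by (simp add: algebra_simps)

text \<open>The second derivative of the difference of the two sides is a positive multiple of
  \<open>(1 + x) powr (p - 2) + (1 - x) powr (p - 2) - 2\<close>. The product of these two powers is
  at least 1, so their sum is at least 2; integrating twice from 0 gives the claim.\<close>

lemma two_point_unit:
  fixes p t :: real
  assumes p: "1 < p" "p \<le> 2" and t: "0 \<le> t" "t \<le> 1"
  shows "2 + p * (p - 1) * t\<^sup>2 \<le> (1 + t) powr p + (1 - t) powr p"
proof -
  have two: "2 \<le> (1 + x) powr (p - 2) + (1 - x) powr (p - 2)" if "0 < x" "x < 1" for x :: real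
  proof -
    let ?a = "(1 + x) powr (p - 2)" and ?b = "(1 - x) powr (p - 2)"
    have "x\<^sup>2 < 1" using that by (simp add: power_less_one_iff)
    have "?a * ?b = (1 - x\<^sup>2) powr (p - 2)"
      using that by (simp add: powr_mult[symmetric] power2_eq_square algebra_simps)
    also have "1 \<le> \<dots>"
      using powr_mono'[of "p - 2" 0 "1 - x\<^sup>2"] \<open>x\<^sup>2 < 1\<close> p by simp
    finally have ab: "1 \<le> ?a * ?b" .
    have "0 + 2\<^sup>2 * 1 \<le> (?a - ?b)\<^sup>2 + 2\<^sup>2 * (?a * ?b)"
      by (intro add_mono mult_left_mono ab) auto
    also have "\<dots> = (?a + ?b)\<^sup>2" by (simp add: power2_eq_square algebra_simps)
    finally have "2\<^sup>2 \<le> (?a + ?b)\<^sup>2" unfolding add_0 mult_1_right .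
    then show ?thesis by (rule power2_le_imp_le) auto
  qed
  have first: "0 \<le> (1 + x) powr (p - 1) - (1 - x) powr (p - 1) - 2 * (p - 1) * x" if x: "0 \<le> x" "x < 1" for x :: real
  proof -
    let ?k = "\<lambda>x::real. (1 + x) powr (p - 1) - (1 - x) powr (p - 1) - 2 * (p - 1) * x"
    have "?k 0 \<le> ?k x"
    proof (rule DERIV_nonneg_imp_increasing_open[OF x(1)])
      fix y :: real assume y: "0 < y" "y < x"
      have "(?k has_real_derivative (p - 1) * ((1 + y) powr (p - 2) + (1 - y) powr (p - 2) - 2)) (at y)"
        using y x by (auto intro!: derivative_eq_intros simp: algebra_simps)
      moreover have "0 \<le> (p - 1) * ((1 + y) powr (p - 2) + (1 - y) powr (p - 2) - 2)"
        using two[of y] y x p by simp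
      ultimately show "\<exists>z. (?k has_real_derivative z) (at y) \<and> 0 \<le> z" by blast
    qed (use x p in \<open>auto intro!: continuous_intros\<close>)
    then show ?thesis by simp
  qed
  let ?g = "\<lambda>x::real. (1 + x) powr p + (1 - x) powr p - p * (p - 1) * x\<^sup>2"
  have "?g 0 \<le> ?g t"
  proof (rule DERIV_nonneg_imp_increasing_open[OF t(1)])
    fix y :: real assume y: "0 < y" "y < t"
    have "(?g has_real_derivative p * ((1 + y) powr (p - 1) - (1 - y) powr (p - 1) - 2 * (p - 1) * y)) (at y)"
      using y t by (auto intro!: derivative_eq_intros simp: algebra_simps)
    moreover have "0 \<le> p * ((1 + y) powr (p - 1) - (1 - y) powr (p - 1) - 2 * (p - 1) * y)"
      using first[of y] y t p by simp
    ultimately show "\<exists>z. (?g has_real_derivative z) (at y) \<and> 0 \<le> z" by blast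
  qed (use t p in \<open>auto intro!: continuous_intros continuous_on_powr'\<close>)
  then show ?thesis by simp
qed

text \<open>Powers of squares make the sign of \<open>x - y\<close> irrelevant. Homogeneity reduces
  the case \<open>y \<le> x\<close> to \<open>two_point_unit\<close>; the other case follows by
  interchanging the variables, as \<open>p - 1 \<le> 1\<close>.\<close>

lemma two_point:
  fixes p x y :: real
  assumes p: "1 < p" "p \<le> 2" and xy: "0 \<le> x" "0 \<le> y"
  shows "2 * (x\<^sup>2 + (p - 1) * y\<^sup>2) powr (p / 2) \<le> ((x + y)\<^sup>2) powr (p / 2) + ((x - y)\<^sup>2) powr (p / 2)"
proof -
  have main: "2 * (a\<^sup>2 + (p - 1) * b\<^sup>2) powr (p / 2) \<le> ((a + b)\<^sup>2) powr (p / 2) + ((a - b)\<^sup>2) powr (p / 2)"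
    if ab: "0 \<le> b" "b \<le> a" for a b :: real
  proof (cases "a = 0")
    case False
    then have a: "0 < a" using ab by simp
    define t where "t = b / a"
    have t: "0 \<le> t" "t \<le> 1" and b: "b = a * t" using ab a by (auto simp: t_def divide_simps)
    have sq: "(z\<^sup>2) powr (p / 2) = z powr p" if "0 \<le> z" for z :: real
      using that by (simp add: square_powr_half)
    have ap: "(a\<^sup>2 * z) powr (p / 2) = a powr p * z powr (p / 2)" if "0 \<le> z" for z
      using a that by (simp add: powr_mult sq)
    have "2 * (a\<^sup>2 + (p - 1) * b\<^sup>2) powr (p / 2) = 2 * (a\<^sup>2 * (1 + (p - 1) * t\<^sup>2)) powr (p / 2)"
      unfolding b by (simp add: algebra_simps power_mult_distrib)
    also have "\<dots> = a powr p * (2 * (1 + (p - 1) * t\<^sup>2) powr (p / 2))"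
      using p by (subst ap) auto
    also have "\<dots> \<le> a powr p * (2 * (1 + p / 2 * ((p - 1) * t\<^sup>2)))"
      using p by (intro mult_left_mono powr_le_linear) auto
    also have "\<dots> = a powr p * (2 + p * (p - 1) * t\<^sup>2)" by (simp add: algebra_simps)
    also have "\<dots> \<le> a powr p * ((1 + t) powr p + (1 - t) powr p)"
      using p t by (intro mult_left_mono two_point_unit) auto
    also have "\<dots> = (a * (1 + t)) powr p + (a * (1 - t)) powr p"
      using a t by (subst (1 2) powr_mult) (auto simp: algebra_simps)
    also have "\<dots> = ((a + b)\<^sup>2) powr (p / 2) + ((a - b)\<^sup>2) powr (p / 2)"
      using ab by (subst (1 2) sq) (auto simp: b algebra_simps)
    finally show ?thesis .
  qed (use ab in auto)
  show ?thesis
  proof (cases "y \<le> x")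
    case True
    then show ?thesis using main[of y x] xy by simp
  next
    case False
    have "(p - 1) * (y\<^sup>2 - x\<^sup>2) \<le> 1 * (y\<^sup>2 - x\<^sup>2)"
      using p xy False by (intro mult_right_mono) (auto simp: power_mono)
    then have "x\<^sup>2 + (p - 1) * y\<^sup>2 \<le> y\<^sup>2 + (p - 1) * x\<^sup>2" by (simp add: algebra_simps)
    then have "2 * (x\<^sup>2 + (p - 1) * y\<^sup>2) powr (p / 2) \<le> 2 * (y\<^sup>2 + (p - 1) * x\<^sup>2) powr (p / 2)"
      using p by (intro mult_left_mono powr_mono2) auto
    also have "\<dots> \<le> ((y + x)\<^sup>2) powr (p / 2) + ((y - x)\<^sup>2) powr (p / 2)"
      using main[of x y] False xy by simp
    finally show ?thesis by (simp add: add.commute power2_commute)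
  qed
qed

text \<open>One martingale step: \<open>x\<^sup>2\<close> and \<open>y\<^sup>2\<close> are the
  squared norms of the parent value and of the increment, \<open>A\<close> and \<open>B\<close>
  those of the children, and \<open>R\<close> is \<open>x\<^sup>2\<close> plus the square function
  so far. Majorization reduces vectors to the scalar two-point inequality. The weight
  \<open>(p - 1) / 2\<close> that places \<open>x\<^sup>2 + (p - 1) * y\<^sup>2\<close> between
  \<open>x\<^sup>2\<close> and \<open>x\<^sup>2 + 2 * y\<^sup>2\<close> is inverted in the constant
  \<open>2 / (p - 1)\<close>.\<close>

lemma square_increment_le:
  fixes A B R x y p :: real
  assumes p: "1 < p" "p \<le> 2" and nn: "0 \<le> x" "0 \<le> y" "0 \<le> A" "0 \<le> B"
    and sum: "A + B = 2 * (x\<^sup>2 + y\<^sup>2)" and le: "A \<le> (x + y)\<^sup>2" "B \<le> (x + y)\<^sup>2" and R: "x\<^sup>2 \<le> R"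
  shows "2 * (R + 2 * y\<^sup>2) powr (p / 2) + 2 * (2 / (p - 1)) * (x\<^sup>2) powr (p / 2)
    \<le> 2 * R powr (p / 2) + 2 / (p - 1) * (A powr (p / 2) + B powr (p / 2))"
proof -
  define \<alpha> where "\<alpha> = p / 2"
  have \<alpha>: "0 < \<alpha>" "\<alpha> \<le> 1" using p by (auto simp: \<alpha>_def)
  have "(x + y)\<^sup>2 powr \<alpha> + (x - y)\<^sup>2 powr \<alpha> \<le> A powr \<alpha> + B powr \<alpha>"
  proof (intro powr_sum_majorization \<alpha>)
    have PQ: "(x + y)\<^sup>2 + (x - y)\<^sup>2 = 2 * (x\<^sup>2 + y\<^sup>2)" by (simp add: power2_eq_square algebra_simps)
    then show "(x - y)\<^sup>2 \<le> A" "A + B = (x + y)\<^sup>2 + (x - y)\<^sup>2" using sum le(2) by linarith+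
  qed (use le in auto)
  then have AB: "2 * (x\<^sup>2 + (p - 1) * y\<^sup>2) powr \<alpha> \<le> A powr \<alpha> + B powr \<alpha>"
    using two_point[OF p nn(1,2)] by (simp add: \<alpha>_def)
  \<comment> \<open>Increments of a concave function decrease: adding \<open>2 * y\<^sup>2\<close>
    gains no more at \<open>R\<close> than at \<open>x\<^sup>2\<close>.\<close>
  have "(R + 2 * y\<^sup>2) powr \<alpha> + (x\<^sup>2) powr \<alpha> \<le> R powr \<alpha> + (x\<^sup>2 + 2 * y\<^sup>2) powr \<alpha>"
    using R by (intro powr_sum_majorization \<alpha>) auto
  moreover have "(p - 1) / 2 * (x\<^sup>2 + 2 * y\<^sup>2) powr \<alpha> + (1 - (p - 1) / 2) * (x\<^sup>2) powr \<alpha>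
      \<le> ((p - 1) / 2 * (x\<^sup>2 + 2 * y\<^sup>2) + (1 - (p - 1) / 2) * x\<^sup>2) powr \<alpha>"
    using p by (intro powr_concave \<alpha>) auto
  moreover have "(p - 1) / 2 * (x\<^sup>2 + 2 * y\<^sup>2) + (1 - (p - 1) / 2) * x\<^sup>2 = x\<^sup>2 + (p - 1) * y\<^sup>2"
    by (simp add: field_simps)
  ultimately have *: "(p - 1) / 2 * (x\<^sup>2 + 2 * y\<^sup>2) powr \<alpha> + (1 - (p - 1) / 2) * (x\<^sup>2) powr \<alpha>
      \<le> (A powr \<alpha> + B powr \<alpha>) / 2" and
     **: "(R + 2 * y\<^sup>2) powr \<alpha> + (x\<^sup>2) powr \<alpha> \<le> R powr \<alpha> + (x\<^sup>2 + 2 * y\<^sup>2) powr \<alpha>"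
    using AB by auto
  define X2 XY RR RY S where defs: "X2 = (x\<^sup>2) powr \<alpha>" "XY = (x\<^sup>2 + 2 * y\<^sup>2) powr \<alpha>" "RR = R powr \<alpha>" "RY = (R + 2 * y\<^sup>2) powr \<alpha>"
    "S = A powr \<alpha> + B powr \<alpha>"
  define k where "k = 2 / (p - 1)"
  have "p - 1 \<noteq> 0" using p by simp
  then have k: "0 < k" "k * (p - 1) = 2"
    using p k_def by (simp, metis nonzero_divide_eq_eq)
  have "k * ((p - 1) / 2 * XY + (1 - (p - 1) / 2) * X2) \<le> k * (S / 2)"
    using * k unfolding defs by (intro mult_left_mono) auto
  moreover have "k * ((p - 1) / 2 * XY + (1 - (p - 1) / 2) * X2) = XY + (k - 1) * X2"
  proof -
    have r: "k * ((p - 1) / 2) = 1" using k(2) by simp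
    have "k * (r * XY + (1 - r) * X2) = (k * r) * XY + (k - k * r) * X2" for r
      by (simp add: algebra_simps)
    from this[of "(p - 1) / 2"] show ?thesis unfolding r by (simp only: mult_1)
  qed
  ultimately have "XY + (k - 1) * X2 \<le> k * (S / 2)" by simp
  moreover have "RY + X2 \<le> RR + XY" using ** by (simp add: defs)
  ultimately have "2 * RY + 2 * k * X2 \<le> 2 * RR + k * S" by (simp add: algebra_simps)
  then show ?thesis by (simp add: defs k_def \<alpha>_def)
qed

section \<open>The Haar system on dyadic grids\<close>

text \<open>The levels below \<open>m\<close>: these \<open>2 ^ m\<close> functions are constant on
  dyadic intervals of length \<open>1 / 2 ^ m\<close>.\<close>

definition Lam :: "nat \<Rightarrow> haar_index set" where
  "Lam m = insert None {Some (j, k) |j k. j < m \<and> k < 2 ^ j}"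

text \<open>Sampling at the left endpoint of the \<open>k\<close>-th grid interval; for indices in
  \<open>Lam m\<close> this is the value on the whole half-open interval.\<close>

definition hv :: "real \<Rightarrow> nat \<Rightarrow> haar_index \<Rightarrow> nat \<Rightarrow> real" where
  "hv p m J k = haar p J (real k / 2 ^ m)"

lemma Lam_0: "Lam 0 = {None}" by (simp add: Lam_def)

lemma Lam_Suc: "Lam (Suc m) = Lam m \<union> (\<lambda>r. Some (m, r)) ` {..<2 ^ m}"
  by (auto simp: Lam_def less_Suc_eq)

lemma Lam_disjoint: "Lam m \<inter> (\<lambda>r. Some (m, r)) ` {..<2 ^ m} = {}"
  by (auto simp: Lam_def)

lemma finite_Lam: "finite (Lam m)"
  by (induction m) (auto simp: Lam_0 Lam_Suc)

lemma Lam_mono: "m \<le> n \<Longrightarrow> Lam m \<subseteq> Lam n"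
  by (auto simp: Lam_def)

lemma haar_mother_if:
  "haar_mother x = (if 0 \<le> x \<and> x < 1/2 then 1 else if 1/2 \<le> x \<and> x < 1 then -1 else 0)"
  by (auto simp: haar_mother_def indicator_def)

text \<open>The jumps are integers in grid units, so comparing \<open>y\<close> with them amounts to
  comparing its floor.\<close>

lemma haar_mother_floor:
  "haar_mother (y / 2 ^ Suc n - real r) = haar_mother (of_int \<lfloor>y\<rfloor> / 2 ^ Suc n - real r)"
proof -
  have *: "of_int a / 2 ^ Suc n \<le> y / 2 ^ Suc n \<longleftrightarrow> of_int a / 2 ^ Suc n \<le> (of_int \<lfloor>y\<rfloor> :: real) / 2 ^ Suc n" for a
    by (simp add: divide_le_cancel le_floor_iff)
  have "real r = of_int (int r * 2 ^ Suc n) / 2 ^ Suc n"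
    "real r + 1 / 2 = of_int ((2 * int r + 1) * 2 ^ n) / 2 ^ Suc n"
    "real r + 1 = of_int ((int r + 1) * 2 ^ Suc n) / 2 ^ Suc n"
    by (simp_all add: field_simps)
  then have "(real r \<le> y / 2 ^ Suc n) = (real r \<le> of_int \<lfloor>y\<rfloor> / 2 ^ Suc n)"
    "(real r + 1 / 2 \<le> y / 2 ^ Suc n) = (real r + 1 / 2 \<le> of_int \<lfloor>y\<rfloor> / 2 ^ Suc n)"
    "(real r + 1 \<le> y / 2 ^ Suc n) = (real r + 1 \<le> of_int \<lfloor>y\<rfloor> / 2 ^ Suc n)"
    using * by metis+
  then show ?thesis
    unfolding haar_mother_if by (auto simp: algebra_simps)
qed

lemma haar_floor:
  assumes "J \<in> Lam m" "0 \<le> x" "x < 1"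
  shows "haar p J x = hv p m J (nat \<lfloor>2 ^ m * x\<rfloor>)"
proof -
  let ?k = "nat \<lfloor>2 ^ m * x\<rfloor>"
  have k: "real ?k = of_int \<lfloor>2 ^ m * x\<rfloor>" using assms by simp
  show ?thesis
  proof (cases J)
    case None
    have "real ?k \<le> 2 ^ m * x" using assms by simp
    also have "\<dots> < 2 ^ m * 1" using assms by (intro mult_strict_left_mono) auto
    finally have "real ?k < 2 ^ m" by simp
    then show ?thesis using None assms by (simp add: hv_def)
  next
    case (Some a)
    then obtain j r where J: "J = Some (j, r)" "j < m" using assms by (auto simp: Lam_def)
    then obtain n where n: "m = j + Suc n" by (metis add_Suc_right less_imp_Suc_add)
    have "haar_mother (2 ^ j * x - real r) = haar_mother ((2 ^ m * x) / 2 ^ Suc n - real r)"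
      unfolding n by (simp add: power_add)
    also have "\<dots> = haar_mother (of_int \<lfloor>2 ^ m * x\<rfloor> / 2 ^ Suc n - real r)" by (rule haar_mother_floor)
    also have "\<dots> = haar_mother (2 ^ j * (real ?k / 2 ^ m) - real r)"
      unfolding k unfolding n by (simp add: power_add)
    finally show ?thesis using J by (simp add: hv_def)
  qed
qed

lemma hv_refine:
  assumes "J \<in> Lam m" "k < 2 ^ m"
  shows "hv p (Suc m) J (2 * k) = hv p m J k" "hv p (Suc m) J (Suc (2 * k)) = hv p m J k"
proof -
  show "hv p (Suc m) J (2 * k) = hv p m J k" by (simp add: hv_def)
  have k: "real (Suc (2 * k)) < 2 ^ Suc m"
  proof -
    have "Suc (2 * k) < 2 ^ Suc m" using assms by simp
    then show ?thesis by (metis of_nat_less_iff of_nat_numeral of_nat_power)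
  qed
  have "nat \<lfloor>2 ^ m * (real (Suc (2 * k)) / 2 ^ Suc m)\<rfloor> = k"
  proof -
    have "2 ^ m * (real (Suc (2 * k)) / 2 ^ Suc m) = real k + 1 / 2" by (simp add: field_simps)
    then show ?thesis by (simp add: floor_eq_iff nat_eq_iff)
  qed
  then show "hv p (Suc m) J (Suc (2 * k)) = hv p m J k"
    using haar_floor[OF assms(1), of "real (Suc (2 * k)) / 2 ^ Suc m" p] k by (simp add: hv_def)
qed

lemma hv_new:
  assumes "k < 2 ^ m"
  shows "hv p (Suc m) (Some (m, r)) (2 * k) = (if r = k then 2 powr (real m / p) else 0)"
    and "hv p (Suc m) (Some (m, r)) (Suc (2 * k)) = (if r = k then - (2 powr (real m / p)) else 0)"
proof -
  have 1: "2 ^ m * (real (2 * k) / 2 ^ Suc m) - real r = real k - real r"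
    "2 ^ m * (real (Suc (2 * k)) / 2 ^ Suc m) - real r = real k + 1 / 2 - real r"
    by (simp_all add: field_simps)
  have "r < k \<Longrightarrow> real r + 1 \<le> real k" "k < r \<Longrightarrow> real k + 1 \<le> real r" by simp_all
  then show "hv p (Suc m) (Some (m, r)) (2 * k) = (if r = k then 2 powr (real m / p) else 0)"
    "hv p (Suc m) (Some (m, r)) (Suc (2 * k)) = (if r = k then - (2 powr (real m / p)) else 0)"
    unfolding hv_def haar.simps 1 by (cases r k rule: linorder_cases; force simp: haar_mother_if)+
qed

lemma sum_pairs: "(\<Sum>k<2 ^ Suc m. g k) = (\<Sum>k<2 ^ m. g (2 * k) + g (Suc (2 * k)))"
  for g :: "nat \<Rightarrow> 'a::comm_monoid_add"
proof -
  have "(\<Sum>k<2 * n. g k) = (\<Sum>k<n. g (2 * k) + g (Suc (2 * k)))" for n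
    by (induction n) (auto simp: add.assoc)
  from this[of "2 ^ m"] show ?thesis by simp
qed

text \<open>Refining the grid duplicates the old products; a new function changes sign on a pair
  where an old one is constant; two new functions overlap only if they have the same index.\<close>

lemma hv_biorthogonal:
  assumes pq: "1 / p + 1 / q = (1::real)" and "J \<in> Lam m" "J' \<in> Lam m"
  shows "(\<Sum>k<2 ^ m. hv p m J k * hv q m J' k) / 2 ^ m = (if J = J' then 1 else 0)"
  using assms(2,3)
proof (induction m arbitrary: J J')
  case 0
  then show ?case by (auto simp: Lam_0 hv_def)
next
  case (Suc m)
  have pw: "2 powr (real m / p) * 2 powr (real m / q) = 2 ^ m"
  proof -
    have "2 powr (real m / p) * 2 powr (real m / q) = 2 powr (real m * (1 / p + 1 / q))"
      by (simp add: powr_add[symmetric] algebra_simps)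
    then show ?thesis unfolding pq by (simp add: powr_realpow)
  qed
  have old_new: "(\<Sum>k<2 ^ Suc m. hv p (Suc m) J k * hv q (Suc m) J' k) = 0"
    if "J \<in> Lam m" "J' = Some (m, r)" for J J' r p q
    unfolding sum_pairs using that
    by (intro sum.neutral) (auto simp: hv_refine hv_new)
  consider (old) "J \<in> Lam m" "J' \<in> Lam m" | (left) r where "J \<in> Lam m" "J' = Some (m, r)"
    | (right) r where "J = Some (m, r)" "J' \<in> Lam m"
    | (new) r r' where "J = Some (m, r)" "J' = Some (m, r')" "r < 2 ^ m"
    using Suc.prems by (auto simp: Lam_Suc)
  then show ?case
  proof cases
    case old
    have "(\<Sum>k<2 ^ Suc m. hv p (Suc m) J k * hv q (Suc m) J' k) = 2 * (\<Sum>k<2 ^ m. hv p m J k * hv q m J' k)"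
      unfolding sum_pairs sum_distrib_left using old by (intro sum.cong) (auto simp: hv_refine)
    then show ?thesis using Suc.IH[OF old] by simp
  next
    case left
    then have "J \<noteq> J'" by (auto simp: Lam_def)
    then show ?thesis using old_new[OF left] by simp
  next
    case right
    then have "J \<noteq> J'" by (auto simp: Lam_def)
    then show ?thesis using old_new[OF right(2,1), of q p] by (simp add: mult.commute)
  next
    case new
    have "(\<Sum>k<2 ^ Suc m. hv p (Suc m) J k * hv q (Suc m) J' k) = (\<Sum>k<2 ^ m. if k = r then (if r = r' then 2 ^ Suc m else 0) else 0)"
      unfolding sum_pairs using new pw by (intro sum.cong) (auto simp: hv_new)
    then show ?thesis using new by (simp add: sum.delta)
  qed
qed

section \<open>The Littlewood--Paley inequality on dyadic grids\<close>

definition cf :: "real \<Rightarrow> nat \<Rightarrow> haar_index \<Rightarrow> (nat \<Rightarrow> 'k::real_normed_field) \<Rightarrow> 'k" where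
  "cf q m J u = (\<Sum>k<2 ^ m. u k * of_real (hv q m J k)) / 2 ^ m"

lemma cf_old:
  assumes "J \<in> Lam m"
  shows "cf q (Suc m) J u = cf q m J (\<lambda>k. (u (2 * k) + u (Suc (2 * k))) / 2)"
proof -
  have "(\<Sum>k<2 ^ Suc m. u k * of_real (hv q (Suc m) J k))
    = 2 * (\<Sum>k<2 ^ m. (u (2 * k) + u (Suc (2 * k))) / 2 * of_real (hv q m J k))"
    unfolding sum_pairs sum_distrib_left using assms
    by (intro sum.cong refl) (simp add: hv_refine distrib_right)
  then show ?thesis by (simp add: cf_def)
qed

lemma cf_new:
  assumes "r < 2 ^ m"
  shows "cf q (Suc m) (Some (m, r)) u = (u (2 * r) - u (Suc (2 * r))) * of_real (2 powr (real m / q)) / 2 ^ Suc m"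
proof -
  have "(\<Sum>k<2 ^ Suc m. u k * of_real (hv q (Suc m) (Some (m, r)) k))
    = (\<Sum>k<2 ^ m. if k = r then (u (2 * r) - u (Suc (2 * r))) * of_real (2 powr (real m / q)) else 0)"
    unfolding sum_pairs by (intro sum.cong) (auto simp: hv_new left_diff_distrib)
  then show ?thesis using assms by (simp add: cf_def sum.delta)
qed

text \<open>\<open>W\<close> makes \<open>u\<close> vector-valued with l2 norm; in the iteration
  over coordinates it holds the Haar indices of the coordinates already treated.\<close>

definition sqf :: "real \<Rightarrow> real \<Rightarrow> nat \<Rightarrow> 'w set \<Rightarrow> (nat \<Rightarrow> 'w \<Rightarrow> 'k::real_normed_field) \<Rightarrow> nat \<Rightarrow> real" where
  "sqf p q m W u k = (\<Sum>w\<in>W. \<Sum>J\<in>Lam m. (norm (cf q m J (\<lambda>l. u l w) * of_real (hv p m J k)))\<^sup>2)"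

text \<open>Averaging over pairs gives the previous square function, and the only new function alive
  at \<open>k'\<close> contributes half the difference. Both children of \<open>k\<close> thus carry
  the same value, so the square function is known one step ahead.\<close>

lemma sqf_Suc:
  assumes pq: "1 / p + 1 / q = (1::real)" and k: "k < 2 ^ m" and k': "k' = 2 * k \<or> k' = Suc (2 * k)"
  shows "sqf p q (Suc m) W u k' = sqf p q m W (\<lambda>k w. (u (2 * k) w + u (Suc (2 * k)) w) / 2) k
     + (\<Sum>w\<in>W. (norm ((u (2 * k) w - u (Suc (2 * k)) w) / 2))\<^sup>2)"
proof -
  have pw: "2 powr (real m / q) * 2 powr (real m / p) = 2 ^ m"
  proof -
    have "2 powr (real m / q) * 2 powr (real m / p) = 2 powr (real m * (1 / p + 1 / q))"
      by (simp add: powr_add[symmetric] algebra_simps)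
    then show ?thesis unfolding pq by (simp add: powr_realpow)
  qed
  have new: "(\<Sum>J\<in>(\<lambda>r. Some (m, r)) ` {..<2 ^ m}. (norm (cf q (Suc m) J (\<lambda>l. u l w) * of_real (hv p (Suc m) J k')))\<^sup>2)
     = (norm ((u (2 * k) w - u (Suc (2 * k)) w) / 2))\<^sup>2" (is "?L = ?R") for w
  proof -
    have "?L = (\<Sum>r<2 ^ m. (norm (cf q (Suc m) (Some (m, r)) (\<lambda>l. u l w) * of_real (hv p (Suc m) (Some (m, r)) k')))\<^sup>2)"
      by (subst sum.reindex) (auto simp: inj_on_def)
    also have "\<dots> = (\<Sum>r<2 ^ m. if r = k then ?R else 0)"
    proof (intro sum.cong refl)
      fix r assume "r \<in> {..<2 ^ m :: nat}"
      then have r: "r < 2 ^ m" by simp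
      have "norm ((u (2 * k) w - u (Suc (2 * k)) w) * of_real (2 powr (real m / q)) / 2 ^ Suc m * of_real (hv p (Suc m) (Some (m, k)) k'))
        = norm ((u (2 * k) w - u (Suc (2 * k)) w)) * (2 powr (real m / q) * 2 powr (real m / p)) / 2 ^ Suc m"
        using k' k by (auto simp: hv_new norm_mult norm_divide norm_power)
      also have "\<dots> = norm ((u (2 * k) w - u (Suc (2 * k)) w) / 2)"
        unfolding pw by (simp add: norm_divide)
      finally show "(norm (cf q (Suc m) (Some (m, r)) (\<lambda>l. u l w) * of_real (hv p (Suc m) (Some (m, r)) k')))\<^sup>2 = (if r = k then ?R else 0)"
        using k k' r cf_new[OF k, of q "\<lambda>l. u l w"] by (cases "r = k") (auto simp: hv_new simp del: of_real_mult)
    qed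
    also have "\<dots> = ?R" using k by (simp add: sum.delta)
    finally show ?thesis .
  qed
  have old: "(\<Sum>J\<in>Lam m. (norm (cf q (Suc m) J (\<lambda>l. u l w) * of_real (hv p (Suc m) J k')))\<^sup>2)
    = (\<Sum>J\<in>Lam m. (norm (cf q m J (\<lambda>k. (u (2 * k) w + u (Suc (2 * k)) w) / 2) * of_real (hv p m J k)))\<^sup>2)" for w
    using k' k by (intro sum.cong) (auto simp: cf_old hv_refine)
  show ?thesis
    unfolding sqf_def Lam_Suc
    by (subst sum.union_disjoint[OF finite_Lam _ Lam_disjoint]) (simp_all add: new old sum.distrib)
qed

text \<open>With \<open>N\<close> the squared norm of the current martingale value and \<open>S\<close> the square function so far,
  \<open>(N + S) powr (p / 2) - 2 / (p - 1) * N powr (p / 2)\<close> is a supermartingale along the dyadic filtration.\<close>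

lemma sqf_bound_aux:
  fixes u :: "nat \<Rightarrow> 'w \<Rightarrow> 'k::{real_normed_field, euclidean_space}"
  assumes p: "1 < p" "p \<le> 2" and pq: "1 / p + 1 / q = (1::real)"
  shows "(\<Sum>k<2 ^ m. ((\<Sum>w\<in>W. (norm (u k w))\<^sup>2) + sqf p q m W u k) powr (p / 2))
     \<le> 2 / (p - 1) * (\<Sum>k<2 ^ m. (\<Sum>w\<in>W. (norm (u k w))\<^sup>2) powr (p / 2))"
proof (induction m arbitrary: u)
  case 0
  let ?N = "\<Sum>w\<in>W. (norm (u 0 w))\<^sup>2"
  have N: "0 \<le> ?N" by (intro sum_nonneg) auto
  have "sqf p q 0 W u 0 = ?N" by (simp add: sqf_def Lam_0 cf_def hv_def)
  then have "(?N + sqf p q 0 W u 0) powr (p / 2) = 2 powr (p / 2) * ?N powr (p / 2)"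
    using N by (simp add: powr_mult flip: mult_2)
  also have "\<dots> \<le> 2 powr 1 * ?N powr (p / 2)"
    using p by (intro mult_right_mono powr_mono) auto
  also have "\<dots> \<le> 2 / (p - 1) * ?N powr (p / 2)"
    using p by (intro mult_right_mono) (auto simp: divide_simps)
  finally show ?case by simp
next
  case (Suc m)
  let ?C = "2 / (p - 1)"
  define N where "N v = (\<Sum>w\<in>W. (norm (v w))\<^sup>2)" for v :: "'w \<Rightarrow> 'k"
  have N0: "0 \<le> N v" for v unfolding N_def by (intro sum_nonneg) auto
  define a where "a k w = (u (2 * k) w + u (Suc (2 * k)) w) / 2" for k w
  define d where "d k w = (u (2 * k) w - u (Suc (2 * k)) w) / 2" for k w
  define Y where "Y k = sqf p q m W a k" for k
  have Y0: "0 \<le> Y k" for k unfolding Y_def sqf_def by (intro sum_nonneg) auto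
  have step: "(N (u (2 * k)) + sqf p q (Suc m) W u (2 * k)) powr (p / 2)
      + (N (u (Suc (2 * k))) + sqf p q (Suc m) W u (Suc (2 * k))) powr (p / 2) + 2 * ?C * N (a k) powr (p / 2)
      \<le> 2 * (N (a k) + Y k) powr (p / 2) + ?C * (N (u (2 * k)) powr (p / 2) + N (u (Suc (2 * k))) powr (p / 2))"
    if k: "k < 2 ^ m" for k
  proof -
    let ?A = "N (u (2 * k))" and ?B = "N (u (Suc (2 * k)))"
    have ua: "u (2 * k) w = a k w + d k w" "u (Suc (2 * k)) w = a k w + - d k w" for w
      by (simp_all add: a_def d_def field_simps)
    have AB: "?A + ?B = 2 * (N (a k) + N (d k))"
      unfolding N_def ua sum.distrib[symmetric] sum_distrib_left
      by (intro sum.cong refl) (simp add: power2_norm_eq_inner inner_simps algebra_simps)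
    \<comment> \<open>Minkowski in l2 over \<open>W\<close>, for the upper bounds that majorization
      asks for.\<close>
    have tri: "N (\<lambda>w. v w + v' w) \<le> (sqrt (N v) + sqrt (N v'))\<^sup>2" for v v'
    proof -
      have "L2_set (\<lambda>w. norm (v w + v' w)) W \<le> L2_set (\<lambda>w. norm (v w) + norm (v' w)) W"
        by (intro L2_set_mono norm_triangle_ineq) auto
      also have "\<dots> \<le> L2_set (\<lambda>w. norm (v w)) W + L2_set (\<lambda>w. norm (v' w)) W"
        by (rule L2_set_triangle_ineq)
      finally have "sqrt (N (\<lambda>w. v w + v' w)) \<le> sqrt (N v) + sqrt (N v')" by (simp add: L2_set_def N_def)
      then have "(sqrt (N (\<lambda>w. v w + v' w)))\<^sup>2 \<le> (sqrt (N v) + sqrt (N v'))\<^sup>2"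
        using N0 by (intro power_mono) auto
      then show ?thesis using N0 by simp
    qed
    have A: "?A \<le> (sqrt (N (a k)) + sqrt (N (d k)))\<^sup>2"
      using tri[of "a k" "d k"] by (simp add: ua[abs_def] N_def)
    have B: "?B \<le> (sqrt (N (a k)) + sqrt (N (d k)))\<^sup>2"
      using tri[of "a k" "\<lambda>w. - d k w"] by (simp add: ua[abs_def] N_def)
    have sq: "(sqrt (N v))\<^sup>2 = N v" for v using N0 by simp
    have S: "sqf p q (Suc m) W u (2 * k) = Y k + N (d k)" "sqf p q (Suc m) W u (Suc (2 * k)) = Y k + N (d k)"
      unfolding Y_def a_def[abs_def] d_def[abs_def] N_def by (rule sqf_Suc[OF pq k]; simp)+
    \<comment> \<open>The children share the square function, so Jensen merges their terms into one
      at the mean, where the parallelogram law \<open>AB\<close> leaves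
      \<open>N (a k) + Y k + 2 * N (d k)\<close>.\<close>
    have "1 / 2 * (?A + (Y k + N (d k))) powr (p / 2) + (1 - 1 / 2) * (?B + (Y k + N (d k))) powr (p / 2)
       \<le> (1 / 2 * (?A + (Y k + N (d k))) + (1 - 1 / 2) * (?B + (Y k + N (d k)))) powr (p / 2)"
      using p N0 Y0 by (intro powr_concave) auto
    also have "1 / 2 * (?A + (Y k + N (d k))) + (1 - 1 / 2) * (?B + (Y k + N (d k))) = (?A + ?B) / 2 + (Y k + N (d k))"
      by (simp add: field_simps)
    also have "\<dots> = (N (a k) + Y k) + 2 * N (d k)" unfolding AB by simp
    finally have con: "(?A + (Y k + N (d k))) powr (p / 2) + (?B + (Y k + N (d k))) powr (p / 2)
      \<le> 2 * ((N (a k) + Y k) + 2 * N (d k)) powr (p / 2)" by simp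
    have "2 * ((N (a k) + Y k) + 2 * (sqrt (N (d k)))\<^sup>2) powr (p / 2) + 2 * ?C * ((sqrt (N (a k)))\<^sup>2) powr (p / 2)
       \<le> 2 * (N (a k) + Y k) powr (p / 2) + ?C * (?A powr (p / 2) + ?B powr (p / 2))"
      using N0 Y0 AB A B by (intro square_increment_le p) (simp_all add: sq)
    then show ?thesis using con unfolding S sq by linarith
  qed
  have IH: "(\<Sum>k<2 ^ m. (N (a k) + Y k) powr (p / 2)) \<le> ?C * (\<Sum>k<2 ^ m. N (a k) powr (p / 2))"
    using Suc[of a] by (simp add: N_def Y_def)
  have "(\<Sum>k<2 ^ m. (N (u (2 * k)) + sqf p q (Suc m) W u (2 * k)) powr (p / 2)
      + (N (u (Suc (2 * k))) + sqf p q (Suc m) W u (Suc (2 * k))) powr (p / 2) + 2 * ?C * N (a k) powr (p / 2))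
      \<le> (\<Sum>k<2 ^ m. 2 * (N (a k) + Y k) powr (p / 2) + ?C * (N (u (2 * k)) powr (p / 2) + N (u (Suc (2 * k))) powr (p / 2)))"
    by (intro sum_mono step) simp
  then have "(\<Sum>k<2 ^ Suc m. (N (u k) + sqf p q (Suc m) W u k) powr (p / 2)) + 2 * ?C * (\<Sum>k<2 ^ m. N (a k) powr (p / 2))
     \<le> 2 * (\<Sum>k<2 ^ m. (N (a k) + Y k) powr (p / 2)) + ?C * (\<Sum>k<2 ^ Suc m. N (u k) powr (p / 2))"
    unfolding sum_pairs by (simp only: sum.distrib sum_distrib_left distrib_left)
  then have "(\<Sum>k<2 ^ Suc m. (N (u k) + sqf p q (Suc m) W u k) powr (p / 2)) \<le> ?C * (\<Sum>k<2 ^ Suc m. N (u k) powr (p / 2))"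
    using IH by linarith
  then show ?case by (simp add: N_def)
qed

lemma sqf_bound:
  fixes u :: "nat \<Rightarrow> 'w \<Rightarrow> 'k::{real_normed_field, euclidean_space}"
  assumes p: "1 < p" "p \<le> 2" and pq: "1 / p + 1 / q = (1::real)"
  shows "(\<Sum>k<2 ^ m. sqf p q m W u k powr (p / 2))
     \<le> 2 / (p - 1) * (\<Sum>k<2 ^ m. (\<Sum>w\<in>W. (norm (u k w))\<^sup>2) powr (p / 2))"
proof -
  have "(\<Sum>k<2 ^ m. sqf p q m W u k powr (p / 2)) \<le> (\<Sum>k<2 ^ m. ((\<Sum>w\<in>W. (norm (u k w))\<^sup>2) + sqf p q m W u k) powr (p / 2))"
    using p by (intro sum_mono powr_mono2) (auto simp: sqf_def intro!: sum_nonneg add_nonneg_nonneg)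
  also note sqf_bound_aux[OF assms]
  finally show ?thesis .
qed

section \<open>Product grids and the multivariate square function\<close>

definition grid :: "nat \<Rightarrow> ('n::finite \<Rightarrow> nat) set" where
  "grid m = PiE UNIV (\<lambda>_. {..<2 ^ m})"

definition MLam :: "nat \<Rightarrow> ('n::finite \<Rightarrow> haar_index) set" where
  "MLam m = PiE UNIV (\<lambda>_. Lam m)"

definition MH :: "real \<Rightarrow> nat \<Rightarrow> ('n::finite \<Rightarrow> haar_index) \<Rightarrow> ('n \<Rightarrow> nat) \<Rightarrow> real" where
  "MH p m I k = (\<Prod>i\<in>UNIV. hv p m (I i) (k i))"

lemma finite_grid: "finite (grid m)"
  by (auto simp: grid_def intro!: finite_PiE)

lemma finite_MLam: "finite (MLam m)"
  by (auto simp: MLam_def finite_Lam intro!: finite_PiE)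

lemma in_grid: "k \<in> grid m \<longleftrightarrow> (\<forall>i. k i < 2 ^ m)"
  by (auto simp: grid_def)

lemma in_MLam: "I \<in> MLam m \<longleftrightarrow> (\<forall>i. I i \<in> Lam m)"
  by (auto simp: MLam_def)

lemma card_grid: "card (grid m :: ('n::finite \<Rightarrow> nat) set) = 2 ^ (m * CARD('n))"
  by (simp add: grid_def card_PiE power_mult)

lemma MLam_mono: "m \<le> n \<Longrightarrow> MLam m \<subseteq> MLam n"
  using Lam_mono by (fastforce simp: in_MLam)

text \<open>Fubini in one coordinate: exchanging \<open>k i\<close> and \<open>l\<close> is an
  involution of the pairs \<open>(k, l)\<close>, after which the summand is free of
  \<open>l\<close>.\<close>

lemma sum_grid_update:
  fixes g :: "('n::finite \<Rightarrow> nat) \<Rightarrow> real"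
  shows "(\<Sum>k\<in>grid m. \<Sum>l<2 ^ m. g (k(i := l))) = 2 ^ m * (\<Sum>k\<in>grid m. g k)"
proof -
  have "(\<Sum>k\<in>grid m. \<Sum>l<2 ^ m. g (k(i := l))) = (\<Sum>(k, l)\<in>grid m \<times> {..<2 ^ m :: nat}. g (k(i := l)))"
    by (simp add: sum.cartesian_product)
  also have "\<dots> = (\<Sum>(k, l)\<in>grid m \<times> {..<2 ^ m :: nat}. g k)"
    by (rule sum.reindex_bij_witness[of _ "\<lambda>(k, l). (k(i := l), k i)" "\<lambda>(k, l). (k(i := l), k i)"])
       (auto simp: in_grid)
  also have "\<dots> = (\<Sum>k\<in>grid m. 2 ^ m * g k)"
    by (subst sum.cartesian_product[symmetric]) simp
  finally show ?thesis by (simp add: sum_distrib_left)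
qed

lemma MH_biorthogonal:
  fixes I J :: "'n::finite \<Rightarrow> haar_index"
  assumes pq: "1 / p + 1 / q = (1::real)" and "I \<in> MLam m" "J \<in> MLam m"
  shows "(\<Sum>k\<in>grid m. MH p m I k * MH q m J k) / 2 ^ (m * CARD('n)) = (if I = J then 1 else 0)"
proof -
  have "(\<Sum>k\<in>grid m. MH p m I k * MH q m J k) = (\<Sum>k\<in>grid m. \<Prod>i\<in>UNIV. hv p m (I i) (k i) * hv q m (J i) (k i))"
    by (simp add: MH_def prod.distrib)
  also have "\<dots> = (\<Prod>i\<in>UNIV. \<Sum>k<2 ^ m. hv p m (I i) k * hv q m (J i) k)"
    unfolding grid_def by (rule prod_sum_PiE[symmetric]) auto
  finally have "(\<Sum>k\<in>grid m. MH p m I k * MH q m J k) / 2 ^ (m * CARD('n))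
    = (\<Prod>i\<in>(UNIV::'n set). (\<Sum>k<2 ^ m. hv p m (I i) k * hv q m (J i) k) / 2 ^ m)"
    by (simp add: prod_dividef power_mult)
  also have "\<dots> = (\<Prod>i\<in>(UNIV::'n set). if I i = J i then 1 else 0)"
    using assms(2,3) by (intro prod.cong hv_biorthogonal[OF pq]) (auto simp: in_MLam)
  also have "\<dots> = (if I = J then 1 else 0)"
    by (auto simp: fun_eq_iff intro!: prod_zero)
  finally show ?thesis .
qed

text \<open>The Haar projection onto \<open>I\<close> in the coordinates \<open>S\<close> only, the other coordinates being
  parameters.\<close>

definition haar_part :: "real \<Rightarrow> real \<Rightarrow> nat \<Rightarrow> 'n set \<Rightarrow> ('n::finite \<Rightarrow> haar_index) \<Rightarrow> (('n \<Rightarrow> nat) \<Rightarrow> 'k::real_normed_field)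
    \<Rightarrow> ('n \<Rightarrow> nat) \<Rightarrow> 'k" where
  "haar_part p q m S I a k = (\<Sum>l\<in>PiE S (\<lambda>_. {..<2 ^ m}). a (override_on k l S) * of_real (\<Prod>i\<in>S. hv q m (I i) (l i)))
      / 2 ^ (m * card S) * of_real (\<Prod>i\<in>S. hv p m (I i) (k i))"

lemma haar_part_empty: "haar_part p q m {} I a k = a k"
  by (simp add: haar_part_def)

text \<open>A new coordinate applies the one-dimensional projection to the partial projection
  regarded as a function of that coordinate.\<close>

lemma haar_part_insert:
  assumes i: "i \<notin> S"
  shows "haar_part p q m (insert i S) (I(i := J)) a k = cf q m J (\<lambda>y. haar_part p q m S I a (k(i := y))) * of_real (hv p m J (k i))"
proof -
  have hvI: "(\<Prod>s\<in>S. hv p m ((I(i := J)) s) (k s)) = (\<Prod>s\<in>S. hv p m (I s) (k s))" for p k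
    using i by (intro prod.cong) auto
  let ?P = "PiE S (\<lambda>_. {..<2 ^ m :: nat})"
  have "(\<Sum>l\<in>PiE (insert i S) (\<lambda>_. {..<2 ^ m}). a (override_on k l (insert i S)) * of_real (\<Prod>s\<in>insert i S. hv q m ((I(i := J)) s) (l s)))
    = (\<Sum>(y, g)\<in>{..<2 ^ m} \<times> ?P. a (override_on (k(i := y)) g S) * of_real (hv q m J y * (\<Prod>s\<in>S. hv q m (I s) (g s))))"
    unfolding PiE_insert_eq
  proof (subst sum.reindex, goal_cases)
    case 1
    show ?case using i by (rule inj_combinator)
  next
    case 2
    have "a (override_on k (g(i := y)) (insert i S)) * of_real (\<Prod>s\<in>insert i S. hv q m ((I(i := J)) s) ((g(i := y)) s))
      = a (override_on (k(i := y)) g S) * of_real (hv q m J y * (\<Prod>s\<in>S. hv q m (I s) (g s)))" for g y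
    proof -
      have "override_on k (g(i := y)) (insert i S) = override_on (k(i := y)) g S"
        using i by (auto simp: override_on_def)
      moreover have "(\<Prod>s\<in>S. hv q m ((I(i := J)) s) ((g(i := y)) s)) = (\<Prod>s\<in>S. hv q m (I s) (g s))"
        using i by (intro prod.cong) auto
      ultimately show ?thesis using i by (simp add: prod.insert)
    qed
    then show ?case by (intro sum.cong) auto
  qed
  also have "\<dots> = (\<Sum>y<2 ^ m. (\<Sum>g\<in>?P. a (override_on (k(i := y)) g S) * of_real (\<Prod>s\<in>S. hv q m (I s) (g s))) * of_real (hv q m J y))"
    unfolding sum.cartesian_product[symmetric] sum_distrib_right
    by (intro sum.cong) (auto simp: mult_ac)
  finally have *: "(\<Sum>l\<in>PiE (insert i S) (\<lambda>_. {..<2 ^ m}). a (override_on k l (insert i S)) * of_real (\<Prod>s\<in>insert i S. hv q m ((I(i := J)) s) (l s)))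
    = (\<Sum>y<2 ^ m. (\<Sum>g\<in>?P. a (override_on (k(i := y)) g S) * of_real (\<Prod>s\<in>S. hv q m (I s) (g s))) * of_real (hv q m J y))" .
  have kp: "(\<Prod>s\<in>S. hv p m (I s) ((k(i := y)) s)) = (\<Prod>s\<in>S. hv p m (I s) (k s))" for y
    using i by (intro prod.cong) auto
  have "cf q m J (\<lambda>y. haar_part p q m S I a (k(i := y)))
    = (\<Sum>y<2 ^ m. (\<Sum>g\<in>?P. a (override_on (k(i := y)) g S) * of_real (\<Prod>s\<in>S. hv q m (I s) (g s))) * of_real (hv q m J y))
       / 2 ^ (m * card (insert i S)) * of_real (\<Prod>s\<in>S. hv p m (I s) (k s))"
    unfolding cf_def haar_part_def kp sum_divide_distrib sum_distrib_right using i
    by (intro sum.cong) (auto simp: power_add mult_ac)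
  then show ?thesis
    unfolding haar_part_def * using i by (simp add: hvI[of p k, simplified])
qed

text \<open>The square function over \<open>insert i S\<close> is the one-dimensional square
  function of the vector of projections over \<open>S\<close>. This is why the one-dimensional
  inequality is stated for l2-valued functions; each coordinate contributes one factor.\<close>

lemma haar_part_square_bound:
  fixes a :: "('n::finite \<Rightarrow> nat) \<Rightarrow> 'k::{real_normed_field, euclidean_space}"
  assumes p: "1 < p" "p \<le> 2" and pq: "1 / p + 1 / q = (1::real)"
  shows "(\<Sum>k\<in>grid m. (\<Sum>I\<in>PiE S (\<lambda>_. Lam m). (norm (haar_part p q m S I a k))\<^sup>2) powr (p / 2))
    \<le> (2 / (p - 1)) ^ card S * (\<Sum>k\<in>grid m. ((norm (a k))\<^sup>2) powr (p / 2))"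
  using finite[of S]
proof (induction S rule: finite_induct)
  case empty
  then show ?case by (simp add: haar_part_empty)
next
  case (insert i S)
  let ?C = "2 / (p - 1)" and ?W = "PiE S (\<lambda>_. Lam m)"
  define Q where "Q S k = (\<Sum>I\<in>PiE S (\<lambda>_. Lam m). (norm (haar_part p q m S I a k))\<^sup>2)" for S k
  have Q: "Q (insert i S) (k(i := l)) = sqf p q m ?W (\<lambda>y I. haar_part p q m S I a (k(i := y))) l" for k l
  proof -
    have "Q (insert i S) (k(i := l)) = (\<Sum>(J, I)\<in>Lam m \<times> ?W. (norm (haar_part p q m (insert i S) (I(i := J)) a (k(i := l))))\<^sup>2)"
      unfolding Q_def PiE_insert_eq using insert(2)
      by (subst sum.reindex) (auto intro!: inj_combinator sum.cong)
    also have "\<dots> = (\<Sum>J\<in>Lam m. \<Sum>I\<in>?W. (norm (cf q m J (\<lambda>y. haar_part p q m S I a (k(i := y))) * of_real (hv p m J l)))\<^sup>2)"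
      unfolding sum.cartesian_product[symmetric] using insert(2) by (simp add: haar_part_insert)
    finally show ?thesis unfolding sqf_def by (subst sum.swap) simp
  qed
  have "2 ^ m * (\<Sum>k\<in>grid m. Q (insert i S) k powr (p / 2)) = (\<Sum>k\<in>grid m. \<Sum>l<2 ^ m. Q (insert i S) (k(i := l)) powr (p / 2))"
    by (rule sum_grid_update[symmetric])
  also have "\<dots> \<le> (\<Sum>k\<in>grid m. ?C * (\<Sum>l<2 ^ m. Q S (k(i := l)) powr (p / 2)))"
    unfolding Q unfolding Q_def by (intro sum_mono sqf_bound p pq)
  also have "\<dots> = ?C * (2 ^ m * (\<Sum>k\<in>grid m. Q S k powr (p / 2)))"
    using sum_grid_update[of "\<lambda>k. Q S k powr (p / 2)" i m] by (simp only: sum_distrib_left[symmetric])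
  finally have "2 ^ m * (\<Sum>k\<in>grid m. Q (insert i S) k powr (p / 2)) \<le> 2 ^ m * (?C * (\<Sum>k\<in>grid m. Q S k powr (p / 2)))"
    by (simp add: mult_ac)
  then have "(\<Sum>k\<in>grid m. Q (insert i S) k powr (p / 2)) \<le> ?C * (\<Sum>k\<in>grid m. Q S k powr (p / 2))"
    by (rule mult_left_le_imp_le) simp
  also have "\<dots> \<le> ?C * (?C ^ card S * (\<Sum>k\<in>grid m. ((norm (a k))\<^sup>2) powr (p / 2)))"
    using insert.IH p unfolding Q_def by (intro mult_left_mono) auto
  finally show ?case using insert(1,2) by (simp add: Q_def)
qed

definition gcoef :: "real \<Rightarrow> nat \<Rightarrow> ('n::finite \<Rightarrow> haar_index) \<Rightarrow> (('n \<Rightarrow> nat) \<Rightarrow> 'k::real_normed_field) \<Rightarrow> 'k" where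
  "gcoef q m I a = (\<Sum>k\<in>grid m. a k * of_real (MH q m I k)) / 2 ^ (m * CARD('n))"

theorem grid_littlewood_paley:
  fixes a :: "('n::finite \<Rightarrow> nat) \<Rightarrow> 'k::{real_normed_field, euclidean_space}"
  assumes p: "1 < p" "p \<le> 2" and pq: "1 / p + 1 / q = (1::real)"
  shows "(\<Sum>k\<in>grid m. (\<Sum>I\<in>MLam m. (norm (gcoef q m I a * of_real (MH p m I k)))\<^sup>2) powr (p / 2))
    \<le> (2 / (p - 1)) ^ CARD('n) * (\<Sum>k\<in>grid m. norm (a k) powr p)"
proof -
  have ov: "override_on k l UNIV = l" for k l :: "'n \<Rightarrow> nat" by auto
  have "haar_part p q m UNIV I a k = gcoef q m I a * of_real (MH p m I k)" for I k
    unfolding haar_part_def gcoef_def MH_def ov grid_def ..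
  moreover have "((norm (a k))\<^sup>2) powr (p / 2) = norm (a k) powr p" for k
    by (simp add: square_powr_half)
  ultimately show ?thesis using haar_part_square_bound[OF assms, of m UNIV a] by (simp add: MLam_def)
qed

section \<open>The upper democracy estimate\<close>

lemma power_mean_sum:
  fixes x :: "'a \<Rightarrow> real"
  assumes s: "1 \<le> s" and fin: "finite T" and x: "\<And>i. i \<in> T \<Longrightarrow> 0 \<le> x i"
  shows "(\<Sum>i\<in>T. x i) powr s \<le> real (card T) powr (s - 1) * (\<Sum>i\<in>T. x i powr s)"
proof (cases "(\<Sum>i\<in>T. x i powr s) = 0")
  case True
  then have "x i = 0" if "i \<in> T" for i
    using that fin by (simp add: sum_nonneg_eq_0_iff)
  then show ?thesis using s by simp
next
  case False
  define n where "n = real (card T)"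
  define w where "w = (\<Sum>i\<in>T. x i powr s) / n"
  have "T \<noteq> {}" using False by auto
  then have n: "0 < n" using fin by (simp add: n_def card_gt_0_iff)
  have w: "0 < w" using False n by (simp add: w_def sum_nonneg less_le)
  have "x i \<le> w powr (1 / s - 1) * (1 / s * x i powr s + (1 - 1 / s) * w)" if "i \<in> T" for i
    using powr_le_tangent[of "1 / s" "x i powr s" w] s w x[OF that] by (simp add: powr_powr)
  then have "(\<Sum>i\<in>T. x i) \<le> (\<Sum>i\<in>T. w powr (1 / s - 1) * (1 / s * x i powr s + (1 - 1 / s) * w))"
    by (rule sum_mono)
  also have "\<dots> = w powr (1 / s - 1) * (1 / s * (\<Sum>i\<in>T. x i powr s) + n * ((1 - 1 / s) * w))"
    unfolding sum_distrib_left[symmetric] sum.distrib by (simp add: n_def)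
  also have "(\<Sum>i\<in>T. x i powr s) = n * w" using n by (simp add: w_def)
  also have "1 / s * (n * w) + n * ((1 - 1 / s) * w) = n * w" by (simp add: algebra_simps)
  also have "w powr (1 / s - 1) * (n * w) = n * w powr (1 / s)" using w by (simp add: powr_diff)
  finally have "(\<Sum>i\<in>T. x i) powr s \<le> (n * w powr (1 / s)) powr s"
    using s x by (intro powr_mono2) (auto intro: sum_nonneg)
  also have "\<dots> = n powr s * w" using n w s by (simp add: powr_mult powr_powr)
  also have "\<dots> = n powr (s - 1) * (\<Sum>i\<in>T. x i powr s)" using n by (simp add: w_def powr_diff)
  finally show ?thesis by (simp add: n_def)
qed

fun lev :: "haar_index \<Rightarrow> nat" where
  "lev None = 0" | "lev (Some (j, k)) = j"

text \<open>\<open>hv 1 m J k \<noteq> 0\<close> serves as an exponent-free test for the support; on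
  it the modulus depends on the level alone.\<close>

lemma hv_abs:
  assumes "k < 2 ^ m"
  shows "\<bar>hv q m J k\<bar> = (if hv 1 m J k \<noteq> 0 then 2 powr (real (lev J) / q) else 0)"
proof (cases J)
  case None
  have "real k < real (2 ^ m)" using assms by (subst of_nat_less_iff)
  then have "real k / 2 ^ m < 1" by simp
  then show ?thesis using None by (simp add: hv_def)
next
  case (Some a)
  then show ?thesis by (cases a) (auto simp: hv_def haar_mother_if abs_mult)
qed

text \<open>The two normalisations have the same sign and support, and their powers of 2 combine
  through \<open>1 / p + 1 / q = 1\<close>.\<close>

lemma hv_conj:
  assumes pq: "1 / p + 1 / q = (1::real)" and p: "0 < p" and k: "k < 2 ^ m"
  shows "hv p m J k * hv q m J k = \<bar>hv p m J k\<bar> powr p"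
proof -
  have "0 \<le> hv p m J k * hv q m J k"
    by (cases J rule: lev.cases) (auto simp: hv_def haar_mother_if)
  then have "hv p m J k * hv q m J k = \<bar>hv p m J k\<bar> * \<bar>hv q m J k\<bar>" by (simp add: abs_mult[symmetric])
  also have "\<dots> = (if hv 1 m J k \<noteq> 0 then 2 powr (real (lev J) * (1 / p + 1 / q)) else 0)"
    unfolding hv_abs[OF k] by (simp add: powr_add[symmetric] algebra_simps)
  also have "\<dots> = \<bar>hv p m J k\<bar> powr p"
    unfolding hv_abs[OF k] pq using p by (simp add: powr_powr)
  finally show ?thesis .
qed

lemma hv_power_sum:
  assumes q: "1 < q" and J: "J \<in> Lam m"
  shows "(\<Sum>k<2 ^ m. \<bar>hv q m J k\<bar> powr q) = 2 ^ m"
proof -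
  have pq: "1 / q + 1 / (q / (q - 1)) = 1" using q by (simp add: field_simps)
  have "(\<Sum>k<2 ^ m. \<bar>hv q m J k\<bar> powr q) = (\<Sum>k<2 ^ m. hv q m J k * hv (q / (q - 1)) m J k)"
    using q by (intro sum.cong refl hv_conj[OF pq, symmetric]) auto
  then show ?thesis using hv_biorthogonal[OF pq J J] by (simp add: divide_simps)
qed

text \<open>The interval of a given level containing the point is unique; the constant function
  shares level 0 with the first Haar function, hence 2.\<close>

lemma card_active_le_2:
  assumes k: "k < 2 ^ m"
  shows "card {J \<in> Lam m. lev J = j \<and> hv 1 m J k \<noteq> 0} \<le> 2"
proof -
  let ?r = "nat \<lfloor>2 ^ j * (real k / 2 ^ m)\<rfloor>"
  have "{J \<in> Lam m. lev J = j \<and> hv 1 m J k \<noteq> 0} \<subseteq> {None, Some (j, ?r)}"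
  proof
    fix J assume J: "J \<in> {J \<in> Lam m. lev J = j \<and> hv 1 m J k \<noteq> 0}"
    show "J \<in> {None, Some (j, ?r)}"
    proof (cases J rule: lev.cases)
      case (2 j' r)
      have "real r \<le> y \<and> y < real r + 1" if "haar_mother (y - real r) \<noteq> 0" for y
        using that by (auto simp: haar_mother_if split: if_splits)
      moreover have "haar_mother (2 ^ j * (real k / 2 ^ m) - real r) \<noteq> 0" using 2 J by (auto simp: hv_def)
      ultimately have "real r \<le> 2 ^ j * (real k / 2 ^ m)" "2 ^ j * (real k / 2 ^ m) < real r + 1" by blast+
      then have "\<lfloor>2 ^ j * (real k / 2 ^ m)\<rfloor> = int r" by (intro floor_unique) auto
      then show ?thesis using 2 J by auto
    qed auto
  qed
  then have "card {J \<in> Lam m. lev J = j \<and> hv 1 m J k \<noteq> 0} \<le> card {None, Some (j, ?r)}"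
    by (intro card_mono) auto
  then show ?thesis by simp
qed

text \<open>With \<open>x = 2 powr (1 / s)\<close>, the factor \<open>2 * x / (x - 1)\<close> bounds
  a geometric sum of ratio \<open>x\<close>, each level counted twice, by its last term.\<close>

definition K1 :: "real \<Rightarrow> real" where
  "K1 s = (2 * 2 powr (1 / s) / (2 powr (1 / s) - 1)) powr s"

text \<open>At a fixed point the active Haar functions have (at most doubled) distinct levels, so the sum is
  geometric and comparable to its largest term.\<close>

lemma democracy_pointwise:
  assumes s: "1 \<le> s" and E: "E \<subseteq> Lam m" and k: "k < 2 ^ m"
  shows "(\<Sum>J\<in>E. \<bar>hv (2 * s) m J k\<bar>\<^sup>2) powr s \<le> K1 s * (\<Sum>J\<in>E. \<bar>hv (2 * s) m J k\<bar> powr (2 * s))"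
proof -
  define E' where "E' = {J \<in> E. hv 1 m J k \<noteq> 0}"
  have finE: "finite E" using E finite_Lam finite_subset by blast
  then have fin: "finite E'" by (simp add: E'_def)
  define x where "x = 2 powr (1 / s)"
  have x: "1 < x" using s by (simp add: x_def)
  have xp: "x ^ n = 2 powr (real n / s)" for n
    using s by (simp add: x_def powr_powr flip: powr_realpow)
  have hv2: "\<bar>hv (2 * s) m J k\<bar>\<^sup>2 = (if hv 1 m J k \<noteq> 0 then x ^ lev J else 0)" for J
  proof -
    have "(2 powr (real n / (2 * s)))\<^sup>2 = x ^ n" for n
      unfolding xp power2_eq_square powr_add[symmetric]
      by (rule arg_cong[of _ _ "\<lambda>t. 2 powr t"]) (use s in \<open>simp add: field_simps\<close>)
    then show ?thesis unfolding hv_abs[OF k] by simp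
  qed
  have hvs: "\<bar>hv (2 * s) m J k\<bar> powr (2 * s) = (if hv 1 m J k \<noteq> 0 then 2 ^ lev J else 0)" for J
    using s by (simp add: hv_abs[OF k] powr_powr powr_realpow)
  have L: "(\<Sum>J\<in>E. \<bar>hv (2 * s) m J k\<bar>\<^sup>2) = (\<Sum>J\<in>E'. x ^ lev J)"
    unfolding hv2 E'_def using finE by (simp add: sum.inter_filter)
  have R: "(\<Sum>J\<in>E. \<bar>hv (2 * s) m J k\<bar> powr (2 * s)) = (\<Sum>J\<in>E'. 2 ^ lev J)"
    unfolding hvs E'_def using finE by (simp add: sum.inter_filter)
  show ?thesis
  proof (cases "E' = {}")
    case False
    define j where "j = Max (lev ` E')"
    have "j \<in> lev ` E'" unfolding j_def using fin False by (intro Max_in) auto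
    then obtain J0 where J0: "J0 \<in> E'" "lev J0 = j" by auto
    have le_j: "lev J \<le> j" if "J \<in> E'" for J
      unfolding j_def using that fin by (intro Max_ge) auto
    have "(\<Sum>J\<in>E'. x ^ lev J) = (\<Sum>i\<le>j. \<Sum>J\<in>{J \<in> E'. lev J = i}. x ^ lev J)"
      using fin le_j by (intro sum.group[symmetric]) auto
    also have "\<dots> \<le> (\<Sum>i\<le>j. 2 * x ^ i)"
    proof (intro sum_mono)
      fix i
      have "card {J \<in> E'. lev J = i} \<le> card {J \<in> Lam m. lev J = i \<and> hv 1 m J k \<noteq> 0}"
        using E finite_Lam by (intro card_mono) (auto simp: E'_def)
      also have "\<dots> \<le> 2" by (rule card_active_le_2[OF k])
      finally have "real (card {J \<in> E'. lev J = i}) * x ^ i \<le> 2 * x ^ i"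
        using x by (intro mult_right_mono) auto
      then show "(\<Sum>J\<in>{J \<in> E'. lev J = i}. x ^ lev J) \<le> 2 * x ^ i" by simp
    qed
    also have "\<dots> = 2 * ((x ^ Suc j - 1) / (x - 1))"
      using x geometric_sum[of x "Suc j"] by (simp add: sum_distrib_left[symmetric] lessThan_Suc_atMost)
    also have "\<dots> \<le> 2 * (x ^ Suc j / (x - 1))"
      using x by (intro mult_left_mono divide_right_mono) auto
    also have "\<dots> = 2 * x / (x - 1) * x ^ j" by simp
    finally have "(\<Sum>J\<in>E'. x ^ lev J) powr s \<le> (2 * x / (x - 1) * x ^ j) powr s"
      using s x by (intro powr_mono2) (auto intro!: sum_nonneg)
    also have "\<dots> = K1 s * (x ^ j) powr s"
      using x by (subst powr_mult) (auto simp: K1_def x_def)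
    also have "(x ^ j) powr s = 2 ^ lev J0"
      using s by (simp add: xp powr_powr J0 powr_realpow)
    also have "K1 s * 2 ^ lev J0 \<le> K1 s * (\<Sum>J\<in>E'. 2 ^ lev J)"
      using fin J0 by (intro mult_left_mono member_le_sum) (auto simp: K1_def)
    finally show ?thesis unfolding L R .
  next
    case True
    then show ?thesis unfolding L R using s by simp
  qed
qed

lemma democracy_unweighted:
  assumes s: "1 \<le> s" and E: "E \<subseteq> Lam m"
  shows "(\<Sum>k<2 ^ m. (\<Sum>J\<in>E. \<bar>hv (2 * s) m J k\<bar>\<^sup>2) powr s) \<le> K1 s * 2 ^ m * real (card E)"
proof -
  have "(\<Sum>k<2 ^ m. (\<Sum>J\<in>E. \<bar>hv (2 * s) m J k\<bar>\<^sup>2) powr s)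
     \<le> (\<Sum>k<2 ^ m. K1 s * (\<Sum>J\<in>E. \<bar>hv (2 * s) m J k\<bar> powr (2 * s)))"
    by (intro sum_mono democracy_pointwise assms) auto
  also have "\<dots> = K1 s * (\<Sum>J\<in>E. \<Sum>k<2 ^ m. \<bar>hv (2 * s) m J k\<bar> powr (2 * s))"
    unfolding sum_distrib_left[symmetric] by (subst sum.swap) simp
  also have "\<dots> = K1 s * (\<Sum>J\<in>E. 2 ^ m)"
    using s E by (intro arg_cong[of _ _ "\<lambda>x. K1 s * x"] sum.cong hv_power_sum) auto
  finally show ?thesis by (simp add: mult_ac)
qed

text \<open>\<open>2 powr s\<close> is lost by rounding the weights to powers of two, 1 by the last
  group, and \<open>2 powr (s - 1)\<close> because there are up to \<open>2 * (1 + ln N)\<close>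
  groups.\<close>

definition K2 :: "real \<Rightarrow> real" where "K2 s = 2 powr (s - 1) * K1 s * (2 powr s + 1)"

lemma K1_nonneg: "0 \<le> K1 s" by (simp add: K1_def)

text \<open>The weights are grouped dyadically relative to their maximum \<open>B\<close>; weights below \<open>B / N\<close> form a
  single last group, which is why only a logarithmic number of groups occurs.\<close>

lemma democracy_weighted:
  assumes s: "1 \<le> s" and E: "E \<subseteq> Lam m" and N: "card E \<le> N" "1 \<le> N"
    and b: "\<And>J. J \<in> E \<Longrightarrow> 0 \<le> b J"
  shows "(\<Sum>k<2 ^ m. (\<Sum>J\<in>E. b J * \<bar>hv (2 * s) m J k\<bar>\<^sup>2) powr s)
     \<le> K2 s * (1 + ln (real N)) powr (s - 1) * 2 ^ m * (\<Sum>J\<in>E. b J powr s)"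
proof (cases "\<forall>J\<in>E. b J = 0")
  case True
  then show ?thesis using s by simp
next
  case False
  have fin: "finite E" using E finite_Lam finite_subset by blast
  define B where "B = Max (b ` E)"
  have "E \<noteq> {}" using False by auto
  then have "B \<in> b ` E" unfolding B_def using fin by (intro Max_in) auto
  then obtain J0 where J0: "J0 \<in> E" "b J0 = B" by auto
  have bB: "b J \<le> B" if "J \<in> E" for J unfolding B_def using that fin by (intro Max_ge) auto
  have B: "0 < B" using False b bB by (metis less_eq_real_def order_less_le_trans)
  define M where "M = nat \<lceil>log 2 (real N)\<rceil>"
  have N_le: "real N \<le> 2 ^ M"
  proof -
    have "log 2 (real N) \<le> real M" unfolding M_def by (rule of_nat_ceiling)
    then have "real N \<le> 2 powr real M" using N by (simp add: log_le_iff)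
    then show ?thesis by (simp add: powr_realpow)
  qed
  \<comment> \<open>Class \<open>i < M\<close> holds the weights between
    \<open>B / 2 ^ Suc i\<close> and \<open>B / 2 ^ i\<close>; class \<open>M\<close> holds all
    those up to \<open>B / 2 ^ M\<close>.\<close>
  define cl where "cl J = (LEAST i. i = M \<or> B / 2 ^ Suc i < b J)" for J
  have cl: "cl J = M \<or> B / 2 ^ Suc (cl J) < b J" for J
    unfolding cl_def by (rule LeastI[of _ M]) simp
  have cl_le: "cl J \<le> M" for J unfolding cl_def by (rule Least_le) simp
  have b_le: "b J \<le> B / 2 ^ cl J" if "J \<in> E" for J
  proof (cases "cl J")
    case (Suc i)
    then have "\<not> (i = M \<or> B / 2 ^ Suc i < b J)"
      using not_less_Least[of i "\<lambda>i. i = M \<or> B / 2 ^ Suc i < b J"] by (simp add: cl_def)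
    then show ?thesis using Suc by simp
  qed (use bB[OF that] in simp)
  define Ei where "Ei i = {J \<in> E. cl J = i}" for i
  have Ei: "Ei i \<subseteq> Lam m" "finite (Ei i)" "Ei i \<subseteq> E" for i using E fin by (auto simp: Ei_def)
  have group: "(\<Sum>J\<in>E. g J) = (\<Sum>i\<le>M. \<Sum>J\<in>Ei i. g J)" for g :: "haar_index \<Rightarrow> real"
    unfolding Ei_def using fin cl_le by (intro sum.group[symmetric]) auto
  have sumE: "0 \<le> (\<Sum>J\<in>T. b J powr s)" for T by (intro sum_nonneg) auto
  have one: "(\<Sum>k<2 ^ m. (\<Sum>J\<in>Ei i. b J * \<bar>hv (2 * s) m J k\<bar>\<^sup>2) powr s)
     \<le> K1 s * 2 ^ m * (2 powr s * (\<Sum>J\<in>Ei i. b J powr s) + (if i = M then \<Sum>J\<in>E. b J powr s else 0))" for i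
  proof -
    have "(\<Sum>k<2 ^ m. (\<Sum>J\<in>Ei i. b J * \<bar>hv (2 * s) m J k\<bar>\<^sup>2) powr s)
      \<le> (\<Sum>k<2 ^ m. (B / 2 ^ i * (\<Sum>J\<in>Ei i. \<bar>hv (2 * s) m J k\<bar>\<^sup>2)) powr s)"
      unfolding sum_distrib_left using s b b_le Ei
      by (intro sum_mono powr_mono2 sum_nonneg mult_nonneg_nonneg mult_right_mono) (auto simp: Ei_def)
    also have "\<dots> = (B / 2 ^ i) powr s * (\<Sum>k<2 ^ m. (\<Sum>J\<in>Ei i. \<bar>hv (2 * s) m J k\<bar>\<^sup>2) powr s)"
      unfolding sum_distrib_left[of "(B / 2 ^ i) powr s"] using B
      by (intro sum.cong refl powr_mult)
    also have "\<dots> \<le> (B / 2 ^ i) powr s * (K1 s * 2 ^ m * real (card (Ei i)))"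
      using Ei by (intro mult_left_mono democracy_unweighted s) auto
    also have "\<dots> = K1 s * 2 ^ m * (real (card (Ei i)) * (B / 2 ^ i) powr s)" by (simp only: mult_ac)
    also have "\<dots> \<le> K1 s * 2 ^ m * (2 powr s * (\<Sum>J\<in>Ei i. b J powr s) + (if i = M then \<Sum>J\<in>E. b J powr s else 0))"
    proof (intro mult_left_mono)
      show "real (card (Ei i)) * (B / 2 ^ i) powr s \<le> 2 powr s * (\<Sum>J\<in>Ei i. b J powr s) + (if i = M then \<Sum>J\<in>E. b J powr s else 0)"
      proof (cases "i = M")
        case True
        \<comment> \<open>The s-th powers of at most \<open>N\<close> weights of size
          \<open>B / N\<close> add up to no more than the single largest term
          \<open>B powr s\<close>.\<close>
        have "real (card (Ei i)) \<le> real N" using N Ei fin card_mono[of E "Ei i"] by force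
        moreover have "B / 2 ^ i \<le> B / real N" using B N N_le True by (intro divide_left_mono) auto
        ultimately have "real (card (Ei i)) * (B / 2 ^ i) powr s \<le> real N * (B / real N) powr s"
          using s B by (intro mult_mono powr_mono2) auto
        also have "\<dots> = real N powr (1 - s) * B powr s"
          using N B by (simp add: powr_divide powr_diff)
        also have "\<dots> \<le> real N powr 0 * B powr s"
          using s N by (intro mult_right_mono powr_mono) auto
        also have "\<dots> \<le> (\<Sum>J\<in>E. b J powr s)"
          using N J0 fin member_le_sum[of J0 E "\<lambda>J. b J powr s"] by simp
        also have "\<dots> \<le> 2 powr s * (\<Sum>J\<in>Ei i. b J powr s) + (\<Sum>J\<in>E. b J powr s)"
          using sumE[of "Ei i"] by simp
        finally show ?thesis unfolding True by simp
      next
        case False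
        have "(\<Sum>J\<in>Ei i. (B / 2 ^ i) powr s) \<le> (\<Sum>J\<in>Ei i. (2 * b J) powr s)"
        proof (intro sum_mono powr_mono2)
          fix J assume "J \<in> Ei i"
          then have "B / 2 ^ Suc i < b J" using cl[of J] False by (auto simp: Ei_def)
          then show "B / 2 ^ i \<le> 2 * b J" by (simp add: field_simps)
        qed (use s B in auto)
        also have "\<dots> = 2 powr s * (\<Sum>J\<in>Ei i. b J powr s)"
          unfolding sum_distrib_left by (intro sum.cong refl powr_mult)
        finally show ?thesis using False by simp
      qed
    qed (simp add: K1_nonneg)
    finally show ?thesis .
  qed
  have M_le: "real (Suc M) \<le> 2 * (1 + ln (real N))"
  proof -
    have "exp (1 / 2) \<le> (2::real)" by (rule exp_half_le2)
    then have "1 / 2 \<le> ln (2::real)" by (subst ln_ge_iff) auto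
    then have "ln (real N) / ln 2 \<le> ln (real N) / (1 / 2)" using N by (intro divide_left_mono) auto
    then have log: "log 2 (real N) \<le> 2 * ln (real N)" by (simp add: log_def)
    have "0 \<le> log 2 (real N)" using N by simp
    then have "real M \<le> log 2 (real N) + 1" unfolding M_def by linarith
    then show ?thesis using log by simp
  qed
  have "(\<Sum>k<2 ^ m. (\<Sum>J\<in>E. b J * \<bar>hv (2 * s) m J k\<bar>\<^sup>2) powr s)
    \<le> (\<Sum>k<2 ^ m. real (card {..M}) powr (s - 1) * (\<Sum>i\<le>M. (\<Sum>J\<in>Ei i. b J * \<bar>hv (2 * s) m J k\<bar>\<^sup>2) powr s))"
    unfolding group using s b by (intro sum_mono power_mean_sum) (auto intro!: sum_nonneg simp: Ei_def)
  also have "\<dots> = real (Suc M) powr (s - 1) * (\<Sum>i\<le>M. \<Sum>k<2 ^ m. (\<Sum>J\<in>Ei i. b J * \<bar>hv (2 * s) m J k\<bar>\<^sup>2) powr s)"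
    unfolding sum_distrib_left[symmetric] by (subst sum.swap) simp
  also have "\<dots> \<le> real (Suc M) powr (s - 1) * (\<Sum>i\<le>M. K1 s * 2 ^ m * (2 powr s * (\<Sum>J\<in>Ei i. b J powr s) + (if i = M then \<Sum>J\<in>E. b J powr s else 0)))"
    by (intro mult_left_mono sum_mono one) auto
  also have "\<dots> = real (Suc M) powr (s - 1) * (K1 s * 2 ^ m * ((2 powr s + 1) * (\<Sum>J\<in>E. b J powr s)))"
    unfolding sum_distrib_left[symmetric] sum.distrib group[symmetric] by (simp add: sum.delta distrib_right)
  also have "\<dots> \<le> (2 * (1 + ln (real N))) powr (s - 1) * (K1 s * 2 ^ m * ((2 powr s + 1) * (\<Sum>J\<in>E. b J powr s)))"
    using M_le s sumE by (intro mult_right_mono powr_mono2 mult_nonneg_nonneg K1_nonneg) auto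
  also have "(2 * (1 + ln (real N))) powr (s - 1) = 2 powr (s - 1) * (1 + ln (real N)) powr (s - 1)"
    using N by (subst powr_mult) auto
  finally show ?thesis by (simp add: K2_def mult_ac)
qed

text \<open>Each coordinate after the first one costs one logarithmic factor: the one-dimensional weighted
  estimate is applied with the partial sums over the other coordinates as weights.\<close>

lemma democracy_partial:
  fixes A :: "('n::finite \<Rightarrow> haar_index) set"
  assumes s: "1 \<le> s" and S: "S \<noteq> {}" and A: "A \<subseteq> PiE S (\<lambda>_. Lam m)" and N: "card A \<le> N" "1 \<le> N"
  shows "(\<Sum>k\<in>grid m. (\<Sum>I\<in>A. \<Prod>i\<in>S. \<bar>hv (2 * s) m (I i) (k i)\<bar>\<^sup>2) powr s)
    \<le> (K1 s + K2 s) ^ card S * ((1 + ln (real N)) powr (s - 1)) ^ (card S - 1) * real (card (grid m :: ('n \<Rightarrow> nat) set)) * real (card A)"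
  using finite[of S] S A N(1)
proof (induction S arbitrary: A rule: finite_ne_induct)
  case (singleton i)
  let ?g = "\<lambda>J k. \<bar>hv (2 * s) m J k\<bar>\<^sup>2"
  have K2: "0 \<le> K2 s" by (simp add: K2_def K1_nonneg)
  have inj: "inj_on (\<lambda>I. I i) A"
    using singleton(1) by (intro inj_onI) (metis (no_types, lifting) PiE_ext singletonD subsetD)
  define E where "E = (\<lambda>I. I i) ` A"
  have E: "E \<subseteq> Lam m" "card E = card A" using singleton(1) by (auto simp: E_def card_image[OF inj])
  have sumA: "(\<Sum>I\<in>A. \<Prod>i\<in>{i}. ?g (I i) (k i)) = (\<Sum>J\<in>E. ?g J (k i))" for k
    unfolding E_def by (subst sum.reindex[OF inj]) simp
  have "2 ^ m * (\<Sum>k\<in>grid m. (\<Sum>J\<in>E. ?g J (k i)) powr s) = (\<Sum>k\<in>(grid m :: ('n \<Rightarrow> nat) set). \<Sum>l<2 ^ m. (\<Sum>J\<in>E. ?g J l) powr s)"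
    using sum_grid_update[of "\<lambda>k. (\<Sum>J\<in>E. ?g J (k i)) powr s" i m] by simp
  also have "\<dots> \<le> (\<Sum>k\<in>(grid m :: ('n \<Rightarrow> nat) set). K1 s * 2 ^ m * real (card E))"
    by (intro sum_mono democracy_unweighted s E)
  also have "\<dots> = 2 ^ m * (K1 s * real (card (grid m :: ('n \<Rightarrow> nat) set)) * real (card A))" by (simp add: E mult_ac)
  finally have "(\<Sum>k\<in>(grid m :: ('n \<Rightarrow> nat) set). (\<Sum>J\<in>E. ?g J (k i)) powr s) \<le> K1 s * real (card (grid m :: ('n \<Rightarrow> nat) set)) * real (card A)"
    by simp
  also have "\<dots> \<le> (K1 s + K2 s) * real (card (grid m :: ('n \<Rightarrow> nat) set)) * real (card A)"
    using K2 by (intro mult_right_mono) auto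
  finally show ?case unfolding sumA by simp
next
  case (insert i S)
  let ?g = "\<lambda>J k. \<bar>hv (2 * s) m J k\<bar>\<^sup>2"
  let ?l = "(1 + ln (real N)) powr (s - 1)" and ?M = "real (card (grid m :: ('n \<Rightarrow> nat) set))"
  have K2: "0 \<le> K2 s" by (simp add: K2_def K1_nonneg)
  \<comment> \<open>Slices of \<open>A\<close> along coordinate \<open>i\<close>. There are at most
    \<open>card A\<close> nonempty ones, each no larger than \<open>A\<close>, so the same
    \<open>N\<close> serves the one-dimensional estimate and the induction hypothesis.\<close>
  define AJ where "AJ J = {I \<in> PiE S (\<lambda>_. Lam m). I(i := J) \<in> A}" for J
  define E where "E = {J \<in> Lam m. AJ J \<noteq> {}}"
  have finAJ: "finite (AJ J)" for J
    by (rule finite_subset[of _ "PiE S (\<lambda>_. Lam m)"]) (auto simp: AJ_def finite_Lam intro!: finite_PiE)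
  have finE: "finite E" using finite_Lam by (simp add: E_def)
  have inj: "inj_on (\<lambda>(J, I). I(i := J)) (Sigma E AJ)"
    by (rule inj_on_subset[OF inj_combinator[OF \<open>i \<notin> S\<close>, of "\<lambda>_. Lam m"]]) (auto simp: E_def AJ_def)
  have img: "(\<lambda>(J, I). I(i := J)) ` (Sigma E AJ) = A"
  proof
    show "A \<subseteq> (\<lambda>(J, I). I(i := J)) ` (Sigma E AJ)"
    proof
      fix I' assume I': "I' \<in> A"
      then have "I' \<in> (\<lambda>(y, g). g(i := y)) ` (Lam m \<times> PiE S (\<lambda>_. Lam m))"
        using insert.prems(1) unfolding PiE_insert_eq by blast
      then obtain J I where "I' = I(i := J)" "J \<in> Lam m" "I \<in> PiE S (\<lambda>_. Lam m)" by auto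
      then show "I' \<in> (\<lambda>(J, I). I(i := J)) ` (Sigma E AJ)"
        using I' by (intro image_eqI[of _ _ "(J, I)"]) (auto simp: E_def AJ_def)
    qed
  qed (auto simp: AJ_def)
  have cardA: "card A = (\<Sum>J\<in>E. card (AJ J))"
    unfolding img[symmetric] card_image[OF inj] using finE finAJ by (simp add: card_SigmaI)
  have AJ_le: "card (AJ J) \<le> N" if "J \<in> E" for J
    using insert.prems(2) member_le_sum[of J E "\<lambda>J. card (AJ J)"] that finE by (simp add: cardA)
  have "card E = (\<Sum>J\<in>E. 1)" by simp
  also have "\<dots> \<le> card A" unfolding cardA
  proof (intro sum_mono)
    fix J assume "J \<in> E"
    then show "1 \<le> card (AJ J)" using finAJ[of J] by (simp add: E_def Suc_le_eq card_gt_0_iff)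
  qed
  finally have cardE: "card E \<le> N" using insert.prems(2) by simp
  define P where "P J k = (\<Sum>I\<in>AJ J. \<Prod>s\<in>S. ?g (I s) (k s))" for J k
  have P0: "0 \<le> P J k" for J k unfolding P_def by (intro sum_nonneg prod_nonneg) auto
  have sumA: "(\<Sum>I\<in>A. \<Prod>s\<in>insert i S. ?g (I s) (k s)) = (\<Sum>J\<in>E. P J k * ?g J (k i))" for k
  proof -
    have "(\<Sum>I\<in>A. \<Prod>s\<in>insert i S. ?g (I s) (k s)) = (\<Sum>(J, I)\<in>Sigma E AJ. \<Prod>s\<in>insert i S. ?g ((I(i := J)) s) (k s))"
      unfolding img[symmetric] by (subst sum.reindex[OF inj]) (auto intro!: sum.cong)
    also have "\<dots> = (\<Sum>(J, I)\<in>Sigma E AJ. (\<Prod>s\<in>S. ?g (I s) (k s)) * ?g J (k i))"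
    proof (intro sum.cong refl)
      fix x assume "x \<in> Sigma E AJ"
      obtain J I where x: "x = (J, I)" by fastforce
      have "(\<Prod>s\<in>S. ?g ((I(i := J)) s) (k s)) = (\<Prod>s\<in>S. ?g (I s) (k s))"
        using \<open>i \<notin> S\<close> by (intro prod.cong) auto
      then show "(case x of (J, I) \<Rightarrow> \<Prod>s\<in>insert i S. ?g ((I(i := J)) s) (k s)) = (case x of (J, I) \<Rightarrow> (\<Prod>s\<in>S. ?g (I s) (k s)) * ?g J (k i))"
        using \<open>i \<notin> S\<close> \<open>finite S\<close> x by (simp add: mult.commute)
    qed
    also have "\<dots> = (\<Sum>J\<in>E. \<Sum>I\<in>AJ J. (\<Prod>s\<in>S. ?g (I s) (k s)) * ?g J (k i))"
      using finE finAJ by (subst sum.Sigma) auto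
    finally show ?thesis by (simp add: P_def sum_distrib_right)
  qed
  \<comment> \<open>The weights do not depend on coordinate \<open>i\<close>, so the weighted
    estimate applies there with the other coordinates frozen.\<close>
  have Pi: "P J (k(i := l)) = P J k" for J k l
    unfolding P_def using \<open>i \<notin> S\<close> by (intro sum.cong prod.cong refl) auto
  have "2 ^ m * (\<Sum>k\<in>(grid m :: ('n \<Rightarrow> nat) set). (\<Sum>J\<in>E. P J k * ?g J (k i)) powr s)
     = (\<Sum>k\<in>(grid m :: ('n \<Rightarrow> nat) set). \<Sum>l<2 ^ m. (\<Sum>J\<in>E. P J k * ?g J l) powr s)"
    using sum_grid_update[of "\<lambda>k. (\<Sum>J\<in>E. P J k * ?g J (k i)) powr s" i m] by (simp add: Pi)
  also have "\<dots> \<le> (\<Sum>k\<in>(grid m :: ('n \<Rightarrow> nat) set). K2 s * ?l * 2 ^ m * (\<Sum>J\<in>E. P J k powr s))"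
    using cardE N(2) P0 by (intro sum_mono democracy_weighted s) (auto simp: E_def)
  also have "\<dots> = 2 ^ m * (K2 s * ?l * (\<Sum>J\<in>E. \<Sum>k\<in>(grid m :: ('n \<Rightarrow> nat) set). P J k powr s))"
    unfolding sum_distrib_left[symmetric] by (subst sum.swap) (simp only: mult_ac)
  finally have "(\<Sum>k\<in>(grid m :: ('n \<Rightarrow> nat) set). (\<Sum>J\<in>E. P J k * ?g J (k i)) powr s)
     \<le> K2 s * ?l * (\<Sum>J\<in>E. \<Sum>k\<in>(grid m :: ('n \<Rightarrow> nat) set). P J k powr s)" by simp
  also have "\<dots> \<le> K2 s * ?l * (\<Sum>J\<in>E. (K1 s + K2 s) ^ card S * ?l ^ (card S - 1) * ?M * real (card (AJ J)))"
    unfolding P_def using K2 AJ_le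
    by (intro mult_left_mono sum_mono insert.IH) (auto simp: AJ_def)
  also have "\<dots> = K2 s * (K1 s + K2 s) ^ card S * (?l * ?l ^ (card S - 1)) * ?M * real (card A)"
    unfolding cardA of_nat_sum sum_distrib_left[symmetric] by (simp only: mult_ac)
  also have "?l * ?l ^ (card S - 1) = ?l ^ (card (insert i S) - 1)"
    using \<open>finite S\<close> \<open>S \<noteq> {}\<close> \<open>i \<notin> S\<close> by (cases "card S") (auto simp: card_eq_0_iff)
  also have "K2 s * (K1 s + K2 s) ^ card S * ?l ^ (card (insert i S) - 1) * ?M * real (card A)
    \<le> (K1 s + K2 s) * (K1 s + K2 s) ^ card S * ?l ^ (card (insert i S) - 1) * ?M * real (card A)"
    using K2 K1_nonneg by (intro mult_right_mono) auto
  finally show ?case unfolding sumA using \<open>finite S\<close> \<open>i \<notin> S\<close> by simp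
qed

theorem upper_democracy:
  fixes A :: "('n::finite \<Rightarrow> haar_index) set"
  assumes q: "2 \<le> q"
  shows "\<exists>K>0. \<forall>m A N. A \<subseteq> (MLam m :: ('n \<Rightarrow> haar_index) set) \<longrightarrow> card A \<le> N \<longrightarrow> 1 \<le> N \<longrightarrow>
    (\<Sum>k\<in>grid m. (\<Sum>I\<in>A. (MH q m I k)\<^sup>2) powr (q / 2)) / 2 ^ (m * CARD('n))
    \<le> K * (1 + ln (real N)) powr ((q / 2 - 1) * (real CARD('n) - 1)) * real (card A)"
proof -
  define s where "s = q / 2"
  have s: "1 \<le> s" "q = 2 * s" using q by (auto simp: s_def)
  let ?K = "(K1 s + K2 s) ^ CARD('n)"
  have K0: "0 \<le> ?K" by (simp add: K1_nonneg K2_def)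
  have "(\<Sum>k\<in>grid m. (\<Sum>I\<in>A. (MH q m I k)\<^sup>2) powr (q / 2)) / 2 ^ (m * CARD('n))
    \<le> (?K + 1) * (1 + ln (real N)) powr ((q / 2 - 1) * (real CARD('n) - 1)) * real (card A)"
    if A: "A \<subseteq> (MLam m :: ('n \<Rightarrow> haar_index) set)" "card A \<le> N" "1 \<le> N" for m A N
  proof -
    have sq: "(MH q m I k)\<^sup>2 = (\<Prod>i\<in>UNIV. \<bar>hv (2 * s) m (I i) (k i)\<bar>\<^sup>2)" for I :: "'n \<Rightarrow> haar_index" and k
      by (simp add: MH_def s(2) prod_power_distrib)
    have l: "((1 + ln (real N)) powr (s - 1)) ^ (CARD('n) - 1) = (1 + ln (real N)) powr ((s - 1) * (real CARD('n) - 1))"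
    proof -
      have "0 < 1 + ln (real N)" using A(3) by (simp add: add_pos_nonneg)
      then show ?thesis
        by (subst powr_realpow[symmetric]) (auto simp: powr_powr of_nat_diff Suc_le_eq)
    qed
    have "(\<Sum>k\<in>grid m. (\<Sum>I\<in>A. (MH q m I k)\<^sup>2) powr s)
      \<le> ?K * (1 + ln (real N)) powr ((s - 1) * (real CARD('n) - 1)) * 2 ^ (m * CARD('n)) * real (card A)"
      using democracy_partial[OF s(1) _ A(1)[unfolded MLam_def] A(2,3)] unfolding sq l card_grid by simp
    then have "(\<Sum>k\<in>grid m. (\<Sum>I\<in>A. (MH q m I k)\<^sup>2) powr s) / 2 ^ (m * CARD('n))
      \<le> ?K * (1 + ln (real N)) powr ((s - 1) * (real CARD('n) - 1)) * real (card A)"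
      by (simp add: divide_simps mult_ac)
    also have "\<dots> \<le> (?K + 1) * (1 + ln (real N)) powr ((s - 1) * (real CARD('n) - 1)) * real (card A)"
      by (intro mult_right_mono) auto
    finally show ?thesis by (simp add: s_def)
  qed
  then show ?thesis using K0 by (intro exI[of _ "?K + 1"]) auto
qed

section \<open>Dyadic cells of the cube\<close>

definition unit_cube :: "(real ^ 'n::finite) set" where
  "unit_cube = {x. \<forall>i. 0 \<le> x $ i \<and> x $ i < 1}"

definition cell_index :: "nat \<Rightarrow> real ^ 'n::finite \<Rightarrow> 'n \<Rightarrow> nat" where
  "cell_index m x = (\<lambda>i. nat \<lfloor>2 ^ m * x $ i\<rfloor>)"

definition cell :: "nat \<Rightarrow> ('n::finite \<Rightarrow> nat) \<Rightarrow> (real ^ 'n) set" where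
  "cell m k = {x. \<forall>i. real (k i) / 2 ^ m \<le> x $ i \<and> x $ i < (real (k i) + 1) / 2 ^ m}"

text \<open>The value 0 off the half-open cube matches the Haar functions on the closed cube, all of
  which vanish where some coordinate equals 1.\<close>

definition step_fun :: "nat \<Rightarrow> (('n::finite \<Rightarrow> nat) \<Rightarrow> real) \<Rightarrow> real ^ 'n \<Rightarrow> real" where
  "step_fun m u x = (if x \<in> unit_cube then u (cell_index m x) else 0)"

lemma unit_cube_subset: "unit_cube \<subseteq> cbox 0 (1 :: real ^ 'n::finite)"
  by (auto simp: unit_cube_def mem_box_cart less_imp_le)

lemma cell_iff:
  assumes "k \<in> grid m"
  shows "x \<in> cell m k \<longleftrightarrow> x \<in> unit_cube \<and> cell_index m x = k"
proof
  assume x: "x \<in> cell m k"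
  have b: "real (k i) \<le> 2 ^ m * x $ i" "2 ^ m * x $ i < real (k i) + 1" for i
    using x by (auto simp: cell_def divide_simps mult.commute)
  have "\<lfloor>2 ^ m * x $ i\<rfloor> = int (k i)" for i
    using b[of i] by (intro floor_unique) auto
  then have "cell_index m x = k" by (simp add: cell_index_def)
  moreover have "0 \<le> x $ i \<and> x $ i < 1" for i
  proof -
    have "Suc (k i) \<le> 2 ^ m" using assms by (auto simp: in_grid Suc_le_eq)
    then have "real (Suc (k i)) \<le> 2 ^ m" by (metis of_nat_le_iff of_nat_numeral of_nat_power)
    then have "2 ^ m * x $ i < 2 ^ m * 1" by (intro order_less_le_trans[OF b(2)]) simp
    moreover have "0 \<le> x $ i"
      using x order_trans[of 0 "real (k i) / 2 ^ m" "x $ i"] by (simp add: cell_def)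
    ultimately show ?thesis by simp
  qed
  ultimately show "x \<in> unit_cube \<and> cell_index m x = k" by (simp add: unit_cube_def)
next
  assume x: "x \<in> unit_cube \<and> cell_index m x = k"
  have "real (k i) / 2 ^ m \<le> x $ i \<and> x $ i < (real (k i) + 1) / 2 ^ m" for i
  proof -
    have "0 \<le> 2 ^ m * x $ i" using x by (simp add: unit_cube_def)
    then have "real (k i) = of_int \<lfloor>2 ^ m * x $ i\<rfloor>" using x by (auto simp: cell_index_def)
    then have "real (k i) \<le> 2 ^ m * x $ i" "2 ^ m * x $ i < real (k i) + 1" by linarith+
    then show ?thesis by (simp add: divide_simps mult.commute)
  qed
  then show "x \<in> cell m k" by (simp add: cell_def)
qed

lemma cell_index_in: "x \<in> unit_cube \<Longrightarrow> cell_index m x \<in> grid m"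
  unfolding in_grid
proof
  fix i assume x: "x \<in> unit_cube"
  have "2 ^ m * x $ i < 2 ^ m * 1" using x by (intro mult_strict_left_mono) (auto simp: unit_cube_def)
  then have "\<lfloor>2 ^ m * x $ i\<rfloor> < 2 ^ m" by (simp add: floor_less_iff)
  then show "cell_index m x i < 2 ^ m" by (simp add: cell_index_def nat_less_iff)
qed

lemma step_fun_eq: "step_fun m u x = (\<Sum>k\<in>grid m. u k * indicator (cell m k) x)"
proof (cases "x \<in> unit_cube")
  case True
  have "(\<Sum>k\<in>grid m. u k * indicator (cell m k) x) = (\<Sum>k\<in>grid m. if k = cell_index m x then u k else 0)"
    using True by (intro sum.cong) (auto simp: cell_iff indicator_def)
  then show ?thesis using True cell_index_in[OF True, of m] by (simp add: step_fun_def sum.delta finite_grid)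
next
  case False
  then have "(\<Sum>k\<in>grid m. u k * indicator (cell m k) x) = 0"
    by (intro sum.neutral) (auto simp: cell_iff)
  then show ?thesis using False by (simp add: step_fun_def)
qed

lemma cell_borel[measurable]: "cell m k \<in> sets borel"
proof -
  have "cell m k = (\<Inter>i. {x. real (k i) / 2 ^ m \<le> x $ i} - {x. (real (k i) + 1) / 2 ^ m \<le> x $ i})"
    by (rule set_eqI) (simp add: cell_def not_le)
  also have "\<dots> \<in> sets borel"
    by (intro sets.countable_INT'' sets.Diff borel_closed closed_Collect_le continuous_intros) auto
  finally show ?thesis .
qed

lemma cell_subset: "k \<in> grid m \<Longrightarrow> cell m k \<subseteq> cbox 0 1"
  using unit_cube_subset by (auto simp: cell_iff)

text \<open>A half-open cell is squeezed between an open and a closed box of equal volume.\<close>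

lemma measure_cell: "measure lborel (cell m (k :: 'n::finite \<Rightarrow> nat)) = 1 / 2 ^ (m * CARD('n))"
proof -
  define l u :: "real ^ 'n" where "l = (\<chi> i. real (k i) / 2 ^ m)" and "u = (\<chi> i. (real (k i) + 1) / 2 ^ m)"
  have le: "l \<bullet> b \<le> u \<bullet> b" "(u - l) \<bullet> b = 1 / 2 ^ m" if "b \<in> Basis" for b
    using that by (auto simp: Basis_vec_def l_def u_def inner_axis divide_simps inner_diff_left)
  have P: "(\<Prod>b\<in>Basis. (u - l) \<bullet> b) = 1 / 2 ^ (m * CARD('n))"
    using le(2) by (simp add: power_divide power_mult)
  have "box l u \<subseteq> cell m k" "cell m k \<subseteq> cbox l u"
    by (auto simp: cell_def mem_box_cart l_def u_def less_imp_le)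
  then have "emeasure lborel (box l u) \<le> emeasure lborel (cell m k)" "emeasure lborel (cell m k) \<le> emeasure lborel (cbox l u)"
    by (auto intro!: emeasure_mono)
  then have "emeasure lborel (cell m k) = ennreal (\<Prod>b\<in>Basis. (u - l) \<bullet> b)"
    using le by (simp add: emeasure_lborel_cbox_eq antisym)
  then show ?thesis unfolding P by (simp add: measure_def)
qed

abbreviation cm :: "(real ^ 'n::finite) measure" where "cm \<equiv> cube_measure"

lemma finite_cm: "finite_measure (cm :: (real ^ 'n::finite) measure)"
  by (rule finite_measure_lebesgue_on) (rule lmeasurable_cbox)

lemma cell_sets: "k \<in> grid m \<Longrightarrow> cell m k \<in> sets cm"
  using cell_subset[of k m] cell_borel[of m k] by (auto simp: sets_restrict_space_iff)

lemma indicator_cell_measurable[measurable]: "indicat_real (cell m k) \<in> borel_measurable cm"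
  by (intro measurable_restrict_space1 measurable_completion) auto

lemma measure_cm_cell: 
  assumes "(k :: 'n::finite \<Rightarrow> nat) \<in> grid m"
  shows "measure cm (cell m k) = 1 / 2 ^ (m * CARD('n))"
proof -
  have "measure cm (cell m k) = measure lebesgue (cell m k)"
    using cell_subset[OF assms] by (intro measure_restrict_space) auto
  also have "\<dots> = measure lborel (cell m k)"
    by (simp add: measure_completion)
  finally show ?thesis by (simp add: measure_cell)
qed

lemma step_fun_measurable[measurable]: "step_fun m u \<in> borel_measurable cm"
  unfolding step_fun_eq[abs_def] by measurable

lemma integrable_indicator_cell: "k \<in> grid m \<Longrightarrow> integrable cm (\<lambda>x. u * indicat_real (cell m k) x)"
  using finite_measure.emeasure_finite[OF finite_cm, of "cell m k"]
  by (intro integrable_mult_right integrable_real_indicator cell_sets) (auto simp: less_top[symmetric])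

lemma integral_step_fun:
  fixes u :: "('n::finite \<Rightarrow> nat) \<Rightarrow> real"
  shows "integrable cm (step_fun m u)" "(LINT x|cm. step_fun m u x) = (\<Sum>k\<in>grid m. u k) / 2 ^ (m * CARD('n))"
proof -
  show "integrable cm (step_fun m u)"
    unfolding step_fun_eq[abs_def] by (intro Bochner_Integration.integrable_sum integrable_indicator_cell)
  have "(LINT x|cm. step_fun m u x) = (\<Sum>k\<in>grid m. LINT x|cm. u k * indicat_real (cell m k) x)"
    unfolding step_fun_eq[abs_def] by (intro Bochner_Integration.integral_sum integrable_indicator_cell)
  also have "\<dots> = (\<Sum>k\<in>grid m. u k * (1 / 2 ^ (m * CARD('n))))"
  proof (intro sum.cong refl)
    fix k :: "'n \<Rightarrow> nat" assume k: "k \<in> grid m"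
    have "(LINT x|cm. indicat_real (cell m k) x) = measure cm (cell m k \<inter> space cm)"
      by (rule Bochner_Integration.integral_indicator)
    also have "cell m k \<inter> space cm = cell m k" using cell_subset[OF k] by auto
    finally show "(LINT x|cm. u k * indicat_real (cell m k) x) = u k * (1 / 2 ^ (m * CARD('n)))"
      by (simp add: measure_cm_cell[OF k])
  qed
  finally show "(LINT x|cm. step_fun m u x) = (\<Sum>k\<in>grid m. u k) / 2 ^ (m * CARD('n))"
    by (simp add: sum_divide_distrib)
qed

lemma haar_index_cases: "J \<in> haar_indices \<longleftrightarrow> (\<exists>m. J \<in> Lam m)"
  by (auto simp: haar_indices_def Lam_def)

lemma multi_haar_indices_eq: "(multi_haar_indices :: ('n::finite \<Rightarrow> haar_index) set) = (\<Union>m. MLam m)"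
proof
  show "(multi_haar_indices :: ('n \<Rightarrow> haar_index) set) \<subseteq> (\<Union>m. MLam m)"
  proof
    fix I :: "'n \<Rightarrow> haar_index" assume "I \<in> multi_haar_indices"
    then have "\<forall>i. \<exists>m. I i \<in> Lam m" by (auto simp: multi_haar_indices_def haar_index_cases)
    then obtain f where f: "\<And>i. I i \<in> Lam (f i)" by metis
    have "I i \<in> Lam (Max (range f))" for i
      using Lam_mono[of "f i" "Max (range f)"] f[of i] by auto
    then have "I \<in> MLam (Max (range f))" by (simp add: in_MLam)
    then show "I \<in> (\<Union>m. MLam m)" by blast
  qed
qed (fastforce simp: multi_haar_indices_def haar_index_cases in_MLam)

lemma multi_haar_step:
  fixes x :: "real ^ 'n::finite"
  assumes I: "I \<in> MLam m" and x: "x \<in> cbox 0 1"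
  shows "multi_haar p I x = step_fun m (MH p m I) x"
proof (cases "x \<in> unit_cube")
  case True
  then have "haar p (I i) (x $ i) = hv p m (I i) (cell_index m x i)" for i
    using I unfolding cell_index_def by (intro haar_floor) (auto simp: in_MLam unit_cube_def)
  then show ?thesis using True by (simp add: step_fun_def multi_haar_def MH_def)
next
  case False
  then obtain i where i: "x $ i = 1"
    using x by (auto simp: unit_cube_def mem_box_cart not_less intro: antisym)
  have "haar p (I i) 1 = 0"
  proof (cases "I i")
    case (Some a)
    have "I i \<in> Lam m" using I by (simp add: in_MLam)
    then obtain j r where a: "I i = Some (j, r)" "r < 2 ^ j" using Some by (auto simp: Lam_def)
    then have "Suc r \<le> 2 ^ j" by simp
    then have "real (Suc r) \<le> 2 ^ j" by (metis of_nat_le_iff of_nat_numeral of_nat_power)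
    then show ?thesis by (simp add: a haar_mother_if)
  qed simp
  then have "multi_haar p I x = 0" unfolding multi_haar_def using i by (intro prod_zero bexI[of _ i]) auto
  then show ?thesis using False by (simp add: step_fun_def)
qed

section \<open>Haar coefficients and the square function\<close>

definition cell_avg :: "nat \<Rightarrow> (real ^ 'n::finite \<Rightarrow> 'k::{real_normed_field, euclidean_space}) \<Rightarrow> ('n \<Rightarrow> nat) \<Rightarrow> 'k" where
  "cell_avg m f k = (LINT x|cm. f x * of_real (indicat_real (cell m k) x)) * 2 ^ (m * CARD('n))"

lemma Lp_D:
  assumes "f \<in> Lp_cube p"
  shows "f \<in> borel_measurable cm" "integrable cm (\<lambda>x. norm (f x) powr p)"
  using assms by (auto simp: Lp_cube_def)

lemma Lp_integrable:
  assumes f: "f \<in> Lp_cube p" and p: "1 \<le> p"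
  shows "integrable cm f"
proof (rule Bochner_Integration.integrable_bound[OF _ Lp_D(1)[OF f]])
  show "integrable cm (\<lambda>x. 1 + norm (f x) powr p)"
    using finite_measure.integrable_const[OF finite_cm] Lp_D(2)[OF f]
    by (intro Bochner_Integration.integrable_add) auto
  have "t \<le> 1 + t powr p" if "0 \<le> t" for t :: real
  proof (cases "t \<le> 1")
    case False
    then show ?thesis using powr_mono[of 1 p t] p by simp
  qed (use powr_ge_zero[of t p] in linarith)
  then show "AE x in cm. norm (f x) \<le> norm (1 + norm (f x) powr p)"
    by (intro AE_I2) (simp add: order_trans[OF _ abs_ge_self])
qed

lemma integrable_times_step:
  fixes f :: "real ^ 'n::finite \<Rightarrow> 'k::{real_normed_field, euclidean_space}"
  assumes f: "integrable cm f"
  shows "integrable cm (\<lambda>x. f x * of_real (step_fun m u x))"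
proof (rule Bochner_Integration.integrable_bound)
  let ?B = "\<Sum>k\<in>grid m. \<bar>u k\<bar>"
  show "integrable cm (\<lambda>x. norm (f x) * ?B)" using f by (intro integrable_mult_left integrable_norm)
  show "(\<lambda>x. f x * of_real (step_fun m u x)) \<in> borel_measurable cm"
    using borel_measurable_integrable[OF f] by measurable
  have "\<bar>step_fun m u x\<bar> \<le> ?B" for x
    unfolding step_fun_def using member_le_sum[of "cell_index m x" "grid m" "\<lambda>k. \<bar>u k\<bar>"] cell_index_in[of x m]
    by (auto intro!: sum_nonneg simp: finite_grid)
  then show "AE x in cm. norm (f x * of_real (step_fun m u x)) \<le> norm (norm (f x) * ?B)"
    by (intro AE_I2) (auto simp: norm_mult abs_mult intro!: mult_left_mono order_trans[OF _ abs_ge_self])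
qed

lemma integrable_times_cell:
  fixes f :: "real ^ 'n::finite \<Rightarrow> 'k::{real_normed_field, euclidean_space}"
  assumes f: "integrable cm f" and k: "k \<in> grid m"
  shows "integrable cm (\<lambda>x. f x * of_real (indicat_real (cell m k) x))"
proof -
  have "indicat_real (cell m k) x = step_fun m (\<lambda>k'. if k' = k then 1 else 0) x" for x
    by (auto simp: step_fun_def indicator_def cell_iff[OF k])
  then show ?thesis using integrable_times_step[OF f] by simp
qed

lemma integral_times_step:
  fixes f :: "real ^ 'n::finite \<Rightarrow> 'k::{real_normed_field, euclidean_space}"
  assumes f: "integrable cm f"
  shows "(LINT x|cm. f x * of_real (step_fun m u x)) = (\<Sum>k\<in>grid m. cell_avg m f k * of_real (u k)) / 2 ^ (m * CARD('n))"
proof -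
  have "(LINT x|cm. f x * of_real (step_fun m u x)) = (LINT x|cm. (\<Sum>k\<in>grid m. of_real (u k) * (f x * of_real (indicat_real (cell m k) x))))"
    by (simp add: step_fun_eq sum_distrib_left mult_ac)
  also have "\<dots> = (\<Sum>k\<in>grid m. of_real (u k) * (LINT x|cm. f x * of_real (indicat_real (cell m k) x)))"
    by (subst Bochner_Integration.integral_sum) (auto intro!: integrable_mult_right integrable_times_cell f)
  also have "\<dots> = (\<Sum>k\<in>grid m. cell_avg m f k * of_real (u k)) / 2 ^ (m * CARD('n))"
    by (simp add: cell_avg_def sum_divide_distrib mult_ac)
  finally show ?thesis .
qed

text \<open>Haar functions with indices in \<open>MLam m\<close> are constant on the cells of level
  \<open>m\<close>, so they see \<open>f\<close> only through its cell averages.\<close>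

lemma haar_coeff_grid:
  fixes f :: "real ^ 'n::finite \<Rightarrow> 'k::{real_normed_field, euclidean_space}"
  assumes f: "integrable cm f" and I: "I \<in> MLam m"
  shows "haar_coeff p I f = gcoef (conj_exp p) m I (cell_avg m f)"
proof -
  have "haar_coeff p I f = (LINT x|cm. f x * of_real (step_fun m (MH (conj_exp p) m I) x))"
    unfolding haar_coeff_def by (intro Bochner_Integration.integral_cong) (auto simp: multi_haar_step[OF I])
  then show ?thesis by (simp add: integral_times_step[OF f] gcoef_def)
qed

lemma haar_coeff_add:
  fixes f g :: "real ^ 'n::finite \<Rightarrow> 'k::{real_normed_field, euclidean_space}"
  assumes "integrable cm f" "integrable cm g" "I \<in> multi_haar_indices"
  shows "haar_coeff p I (\<lambda>x. f x + g x) = haar_coeff p I f + haar_coeff p I g"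
proof -
  obtain m where I: "I \<in> MLam m" using assms(3) by (auto simp: multi_haar_indices_eq)
  have eq: "haar_coeff p I f = (LINT x|cm. f x * of_real (step_fun m (MH (conj_exp p) m I) x))"
    for f :: "real ^ 'n::finite \<Rightarrow> 'k::{real_normed_field, euclidean_space}"
    unfolding haar_coeff_def by (intro Bochner_Integration.integral_cong) (auto simp: multi_haar_step[OF I])
  show ?thesis
    unfolding eq distrib_right using assms(1,2) by (intro Bochner_Integration.integral_add integrable_times_step)
qed

lemma haar_coeff_scale: "haar_coeff p I (\<lambda>x. a * f x) = a * haar_coeff p I f"
  unfolding haar_coeff_def by (simp add: mult.assoc)

lemma sum_indicator_cells:
  "(\<Sum>k\<in>grid m. indicat_real (cell m k) x) \<le> 1"
proof -
  have "(\<Sum>k\<in>grid m. indicat_real (cell m k) x) = step_fun m (\<lambda>_. 1) x" by (simp add: step_fun_eq)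
  then show ?thesis by (simp add: step_fun_def)
qed

text \<open>Jensen's inequality on one cell, by integrating a linear bound in
  \<open>t powr p\<close> that is sharp at the mean \<open>A\<close>; it needs \<open>A > 0\<close>,
  and for \<open>A = 0\<close> nonnegativity suffices.\<close>

lemma cell_avg_powr_le:
  fixes f :: "real ^ 'n::finite \<Rightarrow> 'k::{real_normed_field, euclidean_space}"
  assumes f: "f \<in> Lp_cube p" and p: "1 < p" and k: "k \<in> grid m"
  shows "norm (cell_avg m f k) powr p \<le> 2 ^ (m * CARD('n)) * (LINT x|cm. norm (f x) powr p * indicat_real (cell m k) x)"
proof -
  define A where "A = (LINT x|cm. norm (f x) * indicat_real (cell m k) x) * 2 ^ (m * CARD('n))"
  define B where "B = (LINT x|cm. norm (f x) powr p * indicat_real (cell m k) x) * 2 ^ (m * CARD('n))"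
  have int: "integrable cm f" using Lp_integrable[OF f] p by simp
  have intc: "integrable cm (\<lambda>x. g x * indicat_real (cell m k) x)" if "integrable cm g" for g :: "real ^ 'n \<Rightarrow> real"
    using integrable_times_cell[OF that k] by simp
  have "norm (LINT x|cm. f x * of_real (indicat_real (cell m k) x)) \<le> (LINT x|cm. norm (f x * of_real (indicat_real (cell m k) x)))"
    by (rule integral_norm_bound)
  also have "\<dots> = (LINT x|cm. norm (f x) * indicat_real (cell m k) x)"
    by (simp add: norm_mult)
  finally have nA: "norm (cell_avg m f k) \<le> A"
    by (simp add: cell_avg_def A_def norm_mult norm_power)
  have A0: "0 \<le> A" using nA norm_ge_zero order_trans by blast
  have "A powr p \<le> B"
  proof (cases "A = 0")
    case True
    have "0 \<le> B" unfolding B_def by (intro mult_nonneg_nonneg Bochner_Integration.integral_nonneg) auto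
    then show ?thesis using True by simp
  next
    case False
    then have A: "0 < A" using A0 by simp
    let ?c = "A powr (1 - p) / p" and ?d = "(1 - 1 / p) * A"
    have young: "t \<le> ?c * t powr p + ?d" if "0 \<le> t" for t
    proof -
      have "t = (t powr p) powr (1 / p)" using that p by (simp add: powr_powr)
      also have "\<dots> \<le> (A powr p) powr (1 / p - 1) * (1 / p * t powr p + (1 - 1 / p) * A powr p)"
        using A p by (intro powr_le_tangent) auto
      also have "(A powr p) powr (1 / p - 1) = A powr (1 - p)"
        using p by (simp add: powr_powr algebra_simps)
      also have "A powr (1 - p) * (1 / p * t powr p + (1 - 1 / p) * A powr p)
        = ?c * t powr p + (1 - 1 / p) * (A powr (1 - p) * A powr p)" by (simp add: algebra_simps)
      also have "A powr (1 - p) * A powr p = A" using A by (simp add: powr_add[symmetric])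
      finally show ?thesis .
    qed
    have "(LINT x|cm. norm (f x) * indicat_real (cell m k) x)
      \<le> (LINT x|cm. ?c * (norm (f x) powr p * indicat_real (cell m k) x) + ?d * indicat_real (cell m k) x)"
    proof (intro Bochner_Integration.integral_mono)
      show "integrable cm (\<lambda>x. norm (f x) * indicat_real (cell m k) x)" by (intro intc integrable_norm int)
      show "integrable cm (\<lambda>x. ?c * (norm (f x) powr p * indicat_real (cell m k) x) + ?d * indicat_real (cell m k) x)"
        using Lp_D(2)[OF f] integrable_indicator_cell[OF k]
        by (intro Bochner_Integration.integrable_add integrable_mult_right intc) auto
      fix x
      have "norm (f x) * indicat_real (cell m k) x \<le> (?c * norm (f x) powr p + ?d) * indicat_real (cell m k) x"
        by (intro mult_right_mono young) auto
      then show "norm (f x) * indicat_real (cell m k) x \<le> ?c * (norm (f x) powr p * indicat_real (cell m k) x) + ?d * indicat_real (cell m k) x"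
        by (simp add: algebra_simps)
    qed
    also have "\<dots> = ?c * (LINT x|cm. norm (f x) powr p * indicat_real (cell m k) x) + ?d * (LINT x|cm. indicat_real (cell m k) x)"
      using Lp_D(2)[OF f] integrable_indicator_cell[OF k, of 1]
      by (subst Bochner_Integration.integral_add) (auto intro!: intc)
    also have "(LINT x|cm. indicat_real (cell m k) x) = 1 / 2 ^ (m * CARD('n))"
      using measure_cm_cell[OF k] cell_subset[OF k] by (simp add: Int_absorb2)
    finally have "A \<le> (?c * (LINT x|cm. norm (f x) powr p * indicat_real (cell m k) x) + ?d * (1 / 2 ^ (m * CARD('n)))) * 2 ^ (m * CARD('n))"
      unfolding A_def by (rule mult_right_mono) simp
    also have "\<dots> = ?c * B + ?d" by (simp add: B_def field_simps)
    finally have "A / p \<le> ?c * B" by (simp add: algebra_simps)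
    then have "A \<le> A powr (1 - p) * B" using p by (simp add: field_simps)
    then have "A powr (p - 1) * A \<le> A powr (p - 1) * (A powr (1 - p) * B)" by (intro mult_left_mono) auto
    also have "\<dots> = B" using A by (simp add: mult.assoc[symmetric] powr_add[symmetric])
    finally show ?thesis using A by (simp add: powr_diff)
  qed
  moreover have "norm (cell_avg m f k) powr p \<le> A powr p" using nA p by (intro powr_mono2) auto
  ultimately show ?thesis by (simp add: B_def mult.commute)
qed

section \<open>Convergence of the square function\<close>

definition partial_square :: "real \<Rightarrow> nat \<Rightarrow> (real ^ 'n::finite \<Rightarrow> 'k::{real_normed_field, euclidean_space}) \<Rightarrow> real ^ 'n \<Rightarrow> real" where
  "partial_square p m f x = (\<Sum>I\<in>MLam m. (norm (haar_coeff p I f * of_real (multi_haar p I x)))\<^sup>2)"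

lemma partial_square_step:
  assumes x: "x \<in> cbox 0 1"
  shows "partial_square p m f x = step_fun m (\<lambda>k. \<Sum>I\<in>MLam m. (norm (haar_coeff p I f * of_real (MH p m I k)))\<^sup>2) x"
  unfolding partial_square_def using x
  by (auto simp: multi_haar_step step_fun_def intro!: sum.cong)

lemma partial_square_measurable[measurable]: "partial_square p m f \<in> borel_measurable cm"
proof -
  have "partial_square p m f \<in> borel_measurable cm \<longleftrightarrow>
    step_fun m (\<lambda>k. \<Sum>I\<in>MLam m. (norm (haar_coeff p I f * of_real (MH p m I k)))\<^sup>2) \<in> borel_measurable cm"
    by (intro measurable_cong partial_square_step) auto
  then show ?thesis by simp
qed

lemma partial_square_nonneg: "0 \<le> partial_square p m f x"
  by (simp add: partial_square_def sum_nonneg)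

lemma partial_square_mono: "m \<le> n \<Longrightarrow> partial_square p m f x \<le> partial_square p n f x"
  unfolding partial_square_def by (intro sum_mono2 finite_MLam MLam_mono) auto

lemma conj_exp_sum: "1 < p \<Longrightarrow> 1 / p + 1 / conj_exp p = 1"
  by (simp add: conj_exp_def field_simps)

text \<open>The grid inequality for the cell averages, followed by Jensen on each cell. The bound is
  uniform in \<open>m\<close>, so it survives the passage to the supremum.\<close>

lemma partial_square_bound:
  fixes f :: "real ^ 'n::finite \<Rightarrow> 'k::{real_normed_field, euclidean_space}"
  assumes f: "f \<in> Lp_cube p" and p: "1 < p" "p \<le> 2"
  shows "(\<integral>\<^sup>+x. ennreal (partial_square p m f x powr (p / 2)) \<partial>cm)
    \<le> ennreal ((2 / (p - 1)) ^ CARD('n) * (LINT x|cm. norm (f x) powr p))"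
proof -
  let ?q = "conj_exp p" and ?M = "2 ^ (m * CARD('n)) :: real" and ?C = "(2 / (p - 1)) ^ CARD('n)"
  let ?u = "\<lambda>k. (\<Sum>I\<in>MLam m. (norm (gcoef ?q m I (cell_avg m f) * of_real (MH p m I k)))\<^sup>2)"
  have int: "integrable cm f" using Lp_integrable[OF f] p by simp
  have "(\<integral>\<^sup>+x. ennreal (partial_square p m f x powr (p / 2)) \<partial>cm) = (\<integral>\<^sup>+x. ennreal (step_fun m (\<lambda>k. ?u k powr (p / 2)) x) \<partial>cm)"
    by (intro nn_integral_cong) (auto simp: partial_square_step step_fun_def haar_coeff_grid[OF int])
  also have "\<dots> = ennreal (LINT x|cm. step_fun m (\<lambda>k. ?u k powr (p / 2)) x)"
    by (intro nn_integral_eq_integral integral_step_fun) (auto simp: step_fun_def)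
  also have "(LINT x|cm. step_fun m (\<lambda>k. ?u k powr (p / 2)) x) = (\<Sum>k\<in>grid m. ?u k powr (p / 2)) / ?M"
    by (rule integral_step_fun)
  also have "(\<Sum>k\<in>grid m. ?u k powr (p / 2)) / ?M \<le> ?C * (\<Sum>k\<in>grid m. norm (cell_avg m f k) powr p) / ?M"
    by (intro divide_right_mono grid_littlewood_paley[OF p conj_exp_sum[OF p(1)]]) auto
  also have "\<dots> \<le> ?C * (\<Sum>k\<in>grid m. ?M * (LINT x|cm. norm (f x) powr p * indicat_real (cell m k) x)) / ?M"
    using p by (intro divide_right_mono mult_left_mono sum_mono cell_avg_powr_le f) auto
  also have "\<dots> = ?C * (\<Sum>k\<in>grid m. (LINT x|cm. norm (f x) powr p * indicat_real (cell m k) x))"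
    by (simp add: sum_distrib_left[symmetric])
  also have "(\<Sum>k\<in>grid m. (LINT x|cm. norm (f x) powr p * indicat_real (cell m k) x))
     = (LINT x|cm. (\<Sum>k\<in>grid m. norm (f x) powr p * indicat_real (cell m k) x))"
    using integrable_times_cell[OF Lp_D(2)[OF f]] by (intro Bochner_Integration.integral_sum[symmetric]) auto
  also have "\<dots> \<le> (LINT x|cm. norm (f x) powr p)"
  proof (intro Bochner_Integration.integral_mono Lp_D f Bochner_Integration.integrable_sum)
    fix x
    show "(\<Sum>k\<in>grid m. norm (f x) powr p * indicat_real (cell m k) x) \<le> norm (f x) powr p"
      unfolding sum_distrib_left[symmetric] by (rule mult_left_le[OF sum_indicator_cells]) simp
  next
    fix k :: "'n \<Rightarrow> nat" assume "k \<in> grid m"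
    then show "integrable cm (\<lambda>x. norm (f x) powr p * indicat_real (cell m k) x)"
      using integrable_times_cell[OF Lp_D(2)[OF f]] by simp
  qed
  finally show ?thesis using p by (simp add: ennreal_leI mult_left_mono)
qed

text \<open>Where the series diverges its \<open>infsum\<close> is 0, and so is
  \<open>enn2real top\<close>. The default values agree, so the first identity holds at every point;
  measurability of the square function rests on it.\<close>

lemma partial_square_unbounded_or_limit:
  fixes f :: "real ^ 'n::finite \<Rightarrow> 'k::{real_normed_field, euclidean_space}" and p :: real
  defines "E x \<equiv> SUP m. ennreal (partial_square p m f x)"
  shows "(square_function p f x)\<^sup>2 = enn2real (E x)"
    and "E x < top \<Longrightarrow> (\<lambda>m. partial_square p m f x) \<longlonglongrightarrow> (square_function p f x)\<^sup>2"
proof -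
  let ?g = "\<lambda>I. (norm (haar_coeff p I f * of_real (multi_haar p I x)))\<^sup>2"
  let ?U = "multi_haar_indices :: ('n \<Rightarrow> haar_index) set"
  have inc: "incseq (\<lambda>m. ennreal (partial_square p m f x))"
    by (intro monoI ennreal_leI partial_square_mono)
  have sf: "(square_function p f x)\<^sup>2 = (\<Sum>\<^sub>\<infinity>I\<in>?U. ?g I)"
    unfolding square_function_def by (intro real_sqrt_pow2 infsum_nonneg) auto
  have lim: "(\<lambda>m. partial_square p m f x) \<longlonglongrightarrow> enn2real (E x)" if "E x < top"
  proof -
    have "(\<lambda>m. ennreal (partial_square p m f x)) \<longlonglongrightarrow> E x"
      unfolding E_def by (rule LIMSEQ_SUP[OF inc])
    then have "(\<lambda>m. enn2real (ennreal (partial_square p m f x))) \<longlonglongrightarrow> enn2real (E x)"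
      using that by (intro tendsto_enn2real) auto
    then show ?thesis by (simp add: partial_square_nonneg)
  qed
  have ev: "\<forall>\<^sub>F n in sequentially. finite (MLam n) \<and> Y \<subseteq> MLam n \<and> MLam n \<subseteq> ?U"
    if Y: "finite Y" "Y \<subseteq> ?U" for Y
  proof -
    have "\<exists>m. Y \<subseteq> MLam m" using Y
    proof (induction Y rule: finite_induct)
      case (insert I Y)
      then obtain m n where "Y \<subseteq> MLam m" "I \<in> MLam n" by (auto simp: multi_haar_indices_eq)
      then show ?case using MLam_mono[of m "max m n"] MLam_mono[of n "max m n"]
        by (intro exI[of _ "max m n"]) auto
    qed simp
    then obtain m where m: "Y \<subseteq> MLam m" by blast
    show "\<forall>\<^sub>F n in sequentially. finite (MLam n) \<and> Y \<subseteq> MLam n \<and> MLam n \<subseteq> ?U"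
      using eventually_ge_at_top[of m]
    proof eventually_elim
      case (elim n)
      then show ?case using m MLam_mono[of m n] by (auto simp: finite_MLam multi_haar_indices_eq)
    qed
  qed
  \<comment> \<open>The finite sets \<open>MLam m\<close> exhaust the index set, so a limit along
    finite subsets is also the limit of these partial sums.\<close>
  have flim: "filterlim (\<lambda>m. MLam m) (finite_subsets_at_top ?U) sequentially"
    unfolding filterlim_finite_subsets_at_top by (intro allI impI ev; elim conjE; assumption)
  have main: "(\<Sum>\<^sub>\<infinity>I\<in>?U. ?g I) = enn2real (E x)"
  proof (cases "?g summable_on ?U")
    case True
    then have hs: "(?g has_sum (\<Sum>\<^sub>\<infinity>I\<in>?U. ?g I)) ?U" by (rule has_sum_infsum)
    then have l: "(\<lambda>m. partial_square p m f x) \<longlonglongrightarrow> (\<Sum>\<^sub>\<infinity>I\<in>?U. ?g I)"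
      unfolding has_sum_def partial_square_def by (rule filterlim_compose[OF _ flim])
    have "partial_square p m f x \<le> (\<Sum>\<^sub>\<infinity>I\<in>?U. ?g I)" for m
      unfolding partial_square_def
      by (intro finite_sum_le_infsum True finite_MLam) (auto simp: multi_haar_indices_eq)
    then have "E x \<le> ennreal (\<Sum>\<^sub>\<infinity>I\<in>?U. ?g I)"
      unfolding E_def by (intro SUP_least ennreal_leI)
    then have "E x < top" by (rule le_less_trans) simp
    from lim[OF this] l show ?thesis by (rule LIMSEQ_unique[symmetric])
  next
    case False
    have "E x = top"
    proof (rule ccontr)
      assume "E x \<noteq> top"
      then have fin: "E x < top" by (simp add: less_top)
      have "?g summable_on ?U"
      proof (rule nonneg_bdd_above_summable_on)
        show "bdd_above (sum ?g ` {F. F \<subseteq> ?U \<and> finite F})"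
        proof (rule bdd_aboveI2)
          fix F assume F: "F \<in> {F. F \<subseteq> ?U \<and> finite F}"
          then have "\<forall>\<^sub>F n in sequentially. finite (MLam n) \<and> F \<subseteq> MLam n \<and> MLam n \<subseteq> ?U"
            by (intro ev) simp_all
          from eventually_happens[OF this] obtain n where n: "F \<subseteq> MLam n" by auto
          have le: "sum ?g F \<le> partial_square p n f x"
            unfolding partial_square_def using n by (intro sum_mono2 finite_MLam) auto
          have "ennreal (partial_square p n f x) \<le> E x"
            unfolding E_def by (intro SUP_upper) simp
          then have "partial_square p n f x \<le> enn2real (E x)"
            using fin partial_square_nonneg[of p n f x] enn2real_mono[of "ennreal (partial_square p n f x)" "E x"] by simp
          with le show "sum ?g F \<le> enn2real (E x)" by (rule order_trans)
        qed
      qed simp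
      then show False using False by simp
    qed
    then show ?thesis using infsum_not_exists[OF False] by simp
  qed
  show "(square_function p f x)\<^sup>2 = enn2real (E x)" unfolding sf main ..
  show "E x < top \<Longrightarrow> (\<lambda>m. partial_square p m f x) \<longlonglongrightarrow> (square_function p f x)\<^sup>2"
    unfolding sf main by (rule lim)
qed

lemma square_function_nonneg: "0 \<le> square_function p f x"
  unfolding square_function_def by (intro real_sqrt_ge_zero infsum_nonneg) auto

lemma square_function_eq: "square_function p f x = sqrt (enn2real (SUP m. ennreal (partial_square p m f x)))"
  unfolding partial_square_unbounded_or_limit(1)[symmetric] using square_function_nonneg[of p f x] by simp

lemma square_function_measurable[measurable]: "square_function p f \<in> borel_measurable cm"
  unfolding square_function_eq[abs_def] by measurable

lemma nn_integral_sup_square: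
  fixes f :: "real ^ 'n::finite \<Rightarrow> 'k::{real_normed_field, euclidean_space}"
  assumes f: "f \<in> Lp_cube p" and p: "1 < p" "p \<le> 2"
  shows "(\<integral>\<^sup>+x. (SUP m. ennreal (partial_square p m f x powr (p / 2))) \<partial>cm) < top"
proof -
  have "(\<integral>\<^sup>+x. (SUP m. ennreal (partial_square p m f x powr (p / 2))) \<partial>cm)
     = (SUP m. \<integral>\<^sup>+x. ennreal (partial_square p m f x powr (p / 2)) \<partial>cm)"
    using p by (intro nn_integral_monotone_convergence_SUP)
      (auto simp: incseq_def le_fun_def intro!: ennreal_leI powr_mono2 partial_square_mono partial_square_nonneg)
  also have "\<dots> \<le> ennreal ((2 / (p - 1)) ^ CARD('n) * (LINT x|cm. norm (f x) powr p))"
    by (intro SUP_least partial_square_bound assms)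
  also have "\<dots> < top" by simp
  finally show ?thesis .
qed

lemma square_le_sup:
  assumes p: "1 < p"
  shows "ennreal (square_function p f x powr p) \<le> (SUP m. ennreal (partial_square p m f x powr (p / 2)))"
proof (cases "(SUP m. ennreal (partial_square p m f x)) < top")
  case True
  have "(\<lambda>m. partial_square p m f x powr (p / 2)) \<longlonglongrightarrow> ((square_function p f x)\<^sup>2) powr (p / 2)"
    using p by (intro tendsto_powr' partial_square_unbounded_or_limit(2)[OF True] tendsto_const)
      (auto simp: partial_square_nonneg)
  also have "((square_function p f x)\<^sup>2) powr (p / 2) = square_function p f x powr p"
    using square_function_nonneg[of p f x] by (simp add: square_powr_half)
  finally have "(\<lambda>m. ennreal (partial_square p m f x powr (p / 2))) \<longlonglongrightarrow> ennreal (square_function p f x powr p)"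
    by (rule tendsto_ennrealI)
  then show ?thesis by (rule LIMSEQ_le_const2) (intro exI[of _ 0] allI impI SUP_upper UNIV_I)
next
  case False
  then have top: "(SUP m. ennreal (partial_square p m f x)) = top"
    using less_top by blast
  have "square_function p f x = 0"
    unfolding square_function_eq top by simp
  then show ?thesis using p by simp
qed

theorem square_function_integrable:
  assumes f: "f \<in> Lp_cube p" and p: "1 < p" "p \<le> 2"
  shows "integrable cm (\<lambda>x. square_function p f x powr p)"
proof (rule integrableI_bounded)
  have "(\<integral>\<^sup>+x. ennreal (norm (square_function p f x powr p)) \<partial>cm)
     \<le> (\<integral>\<^sup>+x. (SUP m. ennreal (partial_square p m f x powr (p / 2))) \<partial>cm)"
    using square_le_sup[OF p(1)] by (intro nn_integral_mono) auto
  also have "\<dots> < top" by (rule nn_integral_sup_square[OF assms])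
  finally show "(\<integral>\<^sup>+x. ennreal (norm (square_function p f x powr p)) \<partial>cm) < \<infinity>" by simp
qed measurable

text \<open>A finite integral makes the supremum finite almost everywhere, so the default value can
  occur only on a null set.\<close>

theorem partial_square_limit:
  assumes f: "f \<in> Lp_cube p" and p: "1 < p" "p \<le> 2"
  shows "AE x in cm. (\<lambda>m. partial_square p m f x) \<longlonglongrightarrow> (square_function p f x)\<^sup>2"
proof -
  have "AE x in cm. (SUP m. ennreal (partial_square p m f x powr (p / 2))) \<noteq> \<infinity>"
    using nn_integral_sup_square[OF assms] by (intro nn_integral_PInf_AE) auto
  then show ?thesis
  proof eventually_elim
    case (elim x)
    let ?s = "SUP m. ennreal (partial_square p m f x powr (p / 2))"
    have "partial_square p m f x \<le> enn2real ?s powr (2 / p)" for m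
    proof -
      have "ennreal (partial_square p m f x powr (p / 2)) \<le> ?s" by (intro SUP_upper) simp
      then have "enn2real (ennreal (partial_square p m f x powr (p / 2))) \<le> enn2real ?s"
        using elim by (intro enn2real_mono) (simp_all only: infinity_ennreal_def less_top)
      then have "(partial_square p m f x powr (p / 2)) powr (2 / p) \<le> enn2real ?s powr (2 / p)"
        using p by (intro powr_mono2) auto
      then show ?thesis using p partial_square_nonneg[of p m f x] by (simp add: powr_powr)
    qed
    then have "(SUP m. ennreal (partial_square p m f x)) \<le> ennreal (enn2real ?s powr (2 / p))"
      by (intro SUP_least ennreal_leI)
    then have "(SUP m. ennreal (partial_square p m f x)) < top" by (rule le_less_trans) simp
    then show ?case by (rule partial_square_unbounded_or_limit(2))
  qed
qed

section \<open>The Littlewood--Paley norm\<close>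

lemma Lp_zero: "(\<lambda>x. 0) \<in> Lp_cube p"
  by (simp add: Lp_cube_def)

lemma Lp_scale:
  fixes f :: "real ^ 'n::finite \<Rightarrow> 'k::{real_normed_field, euclidean_space}"
  assumes "f \<in> Lp_cube p" shows "(\<lambda>x. a * f x) \<in> Lp_cube p"
  using assms unfolding Lp_cube_def by (auto simp: norm_mult powr_mult)

lemma Lp_add:
  fixes f g :: "real ^ 'n::finite \<Rightarrow> 'k::{real_normed_field, euclidean_space}"
  assumes f: "f \<in> Lp_cube p" and g: "g \<in> Lp_cube p" and p: "0 < p"
  shows "(\<lambda>x. f x + g x) \<in> Lp_cube p"
proof -
  note [measurable] = Lp_D(1)[OF f] Lp_D(1)[OF g]
  have "integrable cm (\<lambda>x. norm (f x + g x) powr p)"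
  proof (rule Bochner_Integration.integrable_bound)
    show "integrable cm (\<lambda>x. 2 powr p * (norm (f x) powr p + norm (g x) powr p))"
      using Lp_D(2)[OF f] Lp_D(2)[OF g] by (intro integrable_mult_right Bochner_Integration.integrable_add)
    have "norm (f x + g x) powr p \<le> 2 powr p * (norm (f x) powr p + norm (g x) powr p)" for x
    proof -
      have "norm (f x + g x) \<le> 2 * max (norm (f x)) (norm (g x))"
        using norm_triangle_ineq[of "f x" "g x"] by (simp add: max_def)
      then have "norm (f x + g x) powr p \<le> (2 * max (norm (f x)) (norm (g x))) powr p"
        using p by (intro powr_mono2) auto
      also have "\<dots> = 2 powr p * max (norm (f x)) (norm (g x)) powr p" by (simp add: powr_mult)
      also have "\<dots> \<le> 2 powr p * (norm (f x) powr p + norm (g x) powr p)"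
        by (intro mult_left_mono) (auto simp: max_def)
      finally show ?thesis .
    qed
    then show "AE x in cm. norm (norm (f x + g x) powr p) \<le> norm (2 powr p * (norm (f x) powr p + norm (g x) powr p))"
      by (intro AE_I2) (auto intro: order_trans[OF _ abs_ge_self])
  qed measurable
  then show ?thesis by (simp add: Lp_cube_def)
qed

lemma lp_norm_nonneg: "0 \<le> lp_norm p f"
  by (simp add: lp_norm_def)

lemma lp_norm_powr:
  assumes "1 < p"
  shows "lp_norm p f powr p = (LINT x|cm. square_function p f x powr p)"
  using assms by (simp add: lp_norm_def powr_powr Bochner_Integration.integral_nonneg)

lemma square_function_scale: "square_function p (\<lambda>x. a * f x) x = norm a * square_function p f x"
proof -
  have "(norm (haar_coeff p I (\<lambda>x. a * f x) * of_real (multi_haar p I x)))\<^sup>2 =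
    (norm a)\<^sup>2 * (norm (haar_coeff p I f * of_real (multi_haar p I x)))\<^sup>2" for I
    by (simp add: haar_coeff_scale norm_mult power_mult_distrib)
  then show ?thesis
    unfolding square_function_def by (simp add: infsum_cmult_right' real_sqrt_mult)
qed

lemma lp_norm_scale:
  assumes "1 < p" shows "lp_norm p (\<lambda>x. a * f x) = norm a * lp_norm p f"
  using assms by (simp add: lp_norm_def square_function_scale powr_mult square_function_nonneg
      Bochner_Integration.integral_nonneg powr_powr)

text \<open>Pointwise, the parallelogram law relates the four squared square functions; concavity of
  the power \<open>p / 2\<close> merges the two terms on the left and subadditivity splits the
  right. The law is shown for partial sums, where no default value interferes, and passed to the
  limit.\<close>

lemma lp_norm_smooth:
  fixes f g :: "real ^ 'n::finite \<Rightarrow> 'k::{real_normed_field, euclidean_space}"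
  assumes f: "f \<in> Lp_cube p" and g: "g \<in> Lp_cube p" and p: "1 < p" "p \<le> 2"
  shows "lp_norm p (\<lambda>x. f x + g x) powr p + lp_norm p (\<lambda>x. f x - g x) powr p
    \<le> 2 * (lp_norm p f powr p + lp_norm p g powr p)"
proof -
  let ?a = "\<lambda>x. f x + g x" and ?b = "\<lambda>x. f x - g x"
  have a: "?a \<in> Lp_cube p" using Lp_add[OF f g] p by simp
  have mg: "(\<lambda>x. - 1 * g x) \<in> Lp_cube p" by (rule Lp_scale[OF g])
  have b: "?b \<in> Lp_cube p" using Lp_add[OF f mg] p by simp
  have int: "integrable cm f" "integrable cm g" "integrable cm (\<lambda>x. - 1 * g x)"
    using Lp_integrable f g mg p by fastforce+
  have coef: "haar_coeff p I ?a = haar_coeff p I f + haar_coeff p I g"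
    "haar_coeff p I ?b = haar_coeff p I f - haar_coeff p I g" if "I \<in> multi_haar_indices" for I
    using haar_coeff_add[OF int(1,2) that, of p] haar_coeff_add[OF int(1,3) that, of p]
    by (simp_all only: haar_coeff_scale) simp
  have par: "partial_square p m ?a x + partial_square p m ?b x = 2 * (partial_square p m f x + partial_square p m g x)" for m x
    unfolding partial_square_def sum.distrib[symmetric] sum_distrib_left
  proof (intro sum.cong refl)
    fix I :: "'n \<Rightarrow> haar_index" assume "I \<in> MLam m"
    then have I: "I \<in> multi_haar_indices" by (auto simp: multi_haar_indices_eq)
    have "(norm (u + v))\<^sup>2 + (norm (u - v))\<^sup>2 = 2 * ((norm u)\<^sup>2 + (norm v)\<^sup>2)" for u v :: 'k
      by (simp add: power2_norm_eq_inner inner_simps inner_commute)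
    from this[of "haar_coeff p I f * of_real (multi_haar p I x)" "haar_coeff p I g * of_real (multi_haar p I x)"]
    show "(norm (haar_coeff p I ?a * of_real (multi_haar p I x)))\<^sup>2 + (norm (haar_coeff p I ?b * of_real (multi_haar p I x)))\<^sup>2
      = 2 * ((norm (haar_coeff p I f * of_real (multi_haar p I x)))\<^sup>2 + (norm (haar_coeff p I g * of_real (multi_haar p I x)))\<^sup>2)"
      unfolding coef[OF I] by (simp add: algebra_simps)
  qed
  have pw: "s powr p = (s\<^sup>2) powr (p / 2)" if "0 \<le> s" for s :: real
    using that by (simp add: square_powr_half)
  have "AE x in cm. square_function p ?a x powr p + square_function p ?b x powr p
     \<le> 2 * (square_function p f x powr p + square_function p g x powr p)"
    using partial_square_limit[OF f p] partial_square_limit[OF g p] partial_square_limit[OF a p] partial_square_limit[OF b p]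
  proof eventually_elim
    case (elim x)
    let ?F = "(square_function p f x)\<^sup>2" and ?G = "(square_function p g x)\<^sup>2"
      and ?A = "(square_function p ?a x)\<^sup>2" and ?B = "(square_function p ?b x)\<^sup>2"
    have "(\<lambda>m. partial_square p m ?a x + partial_square p m ?b x) \<longlonglongrightarrow> ?A + ?B"
      by (intro tendsto_add elim)
    moreover have "(\<lambda>m. partial_square p m ?a x + partial_square p m ?b x) \<longlonglongrightarrow> 2 * (?F + ?G)"
      unfolding par by (intro tendsto_intros elim)
    ultimately have AB: "?A + ?B = 2 * (?F + ?G)" by (rule LIMSEQ_unique)
    have "1 / 2 * ?A powr (p / 2) + (1 - 1 / 2) * ?B powr (p / 2) \<le> (1 / 2 * ?A + (1 - 1 / 2) * ?B) powr (p / 2)"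
      using p by (intro powr_concave) auto
    also have "1 / 2 * ?A + (1 - 1 / 2) * ?B = (?F + ?G)" using AB by (simp add: field_simps)
    finally have 1: "?A powr (p / 2) + ?B powr (p / 2) \<le> 2 * (?F + ?G) powr (p / 2)" by simp
    have 2: "(?F + ?G) powr (p / 2) + 0 powr (p / 2) \<le> ?F powr (p / 2) + ?G powr (p / 2)"
      using p by (intro powr_sum_majorization) auto
    show ?case using 1 2 p by (simp add: pw[OF square_function_nonneg])
  qed
  then have "(LINT x|cm. square_function p ?a x powr p + square_function p ?b x powr p)
     \<le> (LINT x|cm. 2 * (square_function p f x powr p + square_function p g x powr p))"
    by (intro integral_mono_AE Bochner_Integration.integrable_add integrable_mult_right square_function_integrable a b f g p)
  then show ?thesis
    using p by (simp add: lp_norm_powr square_function_integrable a b f g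
        Bochner_Integration.integral_add)
qed

section \<open>Haar polynomials\<close>

definition haar_fun :: "real \<Rightarrow> ('n::finite \<Rightarrow> haar_index) \<Rightarrow> real ^ 'n \<Rightarrow> 'k::real_normed_field" where
  "haar_fun p I = (\<lambda>x. of_real (multi_haar p I x))"

definition haar_poly :: "real \<Rightarrow> ('n::finite \<Rightarrow> haar_index) set \<Rightarrow> (('n \<Rightarrow> haar_index) \<Rightarrow> 'k::real_normed_field) \<Rightarrow> real ^ 'n \<Rightarrow> 'k" where
  "haar_poly p T c = (\<lambda>x. \<Sum>I\<in>T. c I * haar_fun p I x)"

lemma haar_dictionary_eq: "haar_dictionary p = haar_fun p ` multi_haar_indices"
  by (simp add: haar_dictionary_def haar_fun_def[abs_def])

lemma multi_haar_measurable:
  assumes I: "I \<in> MLam m" shows "multi_haar p I \<in> borel_measurable cm"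
proof -
  have "multi_haar p I \<in> borel_measurable cm \<longleftrightarrow> step_fun m (MH p m I) \<in> borel_measurable cm"
    using multi_haar_step[OF I] by (intro measurable_cong) auto
  then show ?thesis by simp
qed

lemma haar_fun_in_Lp:
  assumes "I \<in> multi_haar_indices"
  shows "(haar_fun p I :: real ^ 'n::finite \<Rightarrow> 'k::{real_normed_field, euclidean_space}) \<in> Lp_cube p"
proof -
  obtain m where I: "I \<in> MLam m" using assms by (auto simp: multi_haar_indices_eq)
  note [measurable] = multi_haar_measurable[OF I, of p]
  have "integrable cm (step_fun m (\<lambda>k. \<bar>MH p m I k\<bar> powr p))" by (rule integral_step_fun)
  then have "integrable cm (\<lambda>x. norm (haar_fun p I x :: 'k) powr p)"
    by (subst Bochner_Integration.integrable_cong[OF refl, of _ _ "step_fun m (\<lambda>k. \<bar>MH p m I k\<bar> powr p)"])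
       (auto simp: haar_fun_def multi_haar_step[OF I] step_fun_def)
  moreover have "(haar_fun p I :: real ^ 'n \<Rightarrow> 'k) \<in> borel_measurable cm"
    unfolding haar_fun_def by measurable
  ultimately show ?thesis by (simp add: Lp_cube_def)
qed

lemma haar_poly_in_Lp:
  fixes c :: "('n::finite \<Rightarrow> haar_index) \<Rightarrow> 'k::{real_normed_field, euclidean_space}"
  assumes "finite T" "T \<subseteq> multi_haar_indices" "0 < p"
  shows "haar_poly p T c \<in> Lp_cube p"
  using assms
proof (induction T rule: finite_induct)
  case empty
  then show ?case by (simp add: haar_poly_def Lp_zero)
next
  case (insert I T)
  then have "(\<lambda>x. c I * haar_fun p I x + haar_poly p T c x) \<in> Lp_cube p"
    by (intro Lp_add Lp_scale haar_fun_in_Lp) auto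
  then show ?case using insert by (simp add: haar_poly_def)
qed

lemma haar_coeff_haar_fun:
  assumes p: "1 < p" and I: "I \<in> multi_haar_indices" and J: "J \<in> multi_haar_indices"
  shows "haar_coeff p J (haar_fun p I :: real ^ 'n::finite \<Rightarrow> 'k::{real_normed_field, euclidean_space}) = (if I = J then 1 else 0)"
proof -
  obtain m n where "I \<in> MLam m" "J \<in> MLam n" using I J by (auto simp: multi_haar_indices_eq)
  then obtain m where IJ: "I \<in> MLam m" "J \<in> MLam m"
    using MLam_mono[of m "max m n"] MLam_mono[of n "max m n"] by auto
  have "haar_coeff p J (haar_fun p I :: real ^ 'n \<Rightarrow> 'k) = (LINT x|cm. of_real (step_fun m (\<lambda>k. MH p m I k * MH (conj_exp p) m J k) x))"
    unfolding haar_coeff_def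
    by (intro Bochner_Integration.integral_cong) (auto simp: haar_fun_def multi_haar_step[OF IJ(1)] multi_haar_step[OF IJ(2)] step_fun_def)
  also have "\<dots> = of_real (LINT x|cm. step_fun m (\<lambda>k. MH p m I k * MH (conj_exp p) m J k) x)"
    by (rule integral_of_real) (rule integral_step_fun)
  also have "(LINT x|cm. step_fun m (\<lambda>k. MH p m I k * MH (conj_exp p) m J k) x) = (if I = J then 1 else 0)"
    unfolding integral_step_fun by (rule MH_biorthogonal[OF conj_exp_sum[OF p] IJ])
  finally show ?thesis by simp
qed

lemma haar_coeff_haar_poly:
  fixes c :: "('n::finite \<Rightarrow> haar_index) \<Rightarrow> 'k::{real_normed_field, euclidean_space}"
  assumes p: "1 < p" and T: "finite T" "T \<subseteq> multi_haar_indices" and J: "J \<in> multi_haar_indices"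
  shows "haar_coeff p J (haar_poly p T c) = (if J \<in> T then c J else 0)"
  using T
proof (induction T rule: finite_induct)
  case empty
  show ?case by (simp add: haar_poly_def haar_coeff_def)
next
  case (insert I T)
  have "integrable cm (\<lambda>x. c I * haar_fun p I x)" "integrable cm (haar_poly p T c)"
    using insert p by (auto intro!: Lp_integrable[of _ p] Lp_scale haar_fun_in_Lp haar_poly_in_Lp)
  then have "haar_coeff p J (\<lambda>x. c I * haar_fun p I x + haar_poly p T c x) = c I * haar_coeff p J (haar_fun p I) + haar_coeff p J (haar_poly p T c)"
    using J by (simp add: haar_coeff_add haar_coeff_scale)
  moreover have "(\<lambda>x. c I * haar_fun p I x + haar_poly p T c x) = haar_poly p (insert I T) c" using insert by (simp add: haar_poly_def)
  ultimately show ?case using insert J p by (auto simp: haar_coeff_haar_fun)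
qed

lemma square_function_haar_poly:
  fixes c :: "('n::finite \<Rightarrow> haar_index) \<Rightarrow> 'k::{real_normed_field, euclidean_space}"
  assumes p: "1 < p" and T: "finite T" "T \<subseteq> multi_haar_indices"
  shows "square_function p (haar_poly p T c) x = sqrt (\<Sum>I\<in>T. (norm (c I) * \<bar>multi_haar p I x\<bar>)\<^sup>2)"
proof -
  have "(\<Sum>\<^sub>\<infinity>I\<in>multi_haar_indices. (norm (haar_coeff p I (haar_poly p T c) * of_real (multi_haar p I x)))\<^sup>2)
     = (\<Sum>\<^sub>\<infinity>I\<in>T. (norm (c I) * \<bar>multi_haar p I x\<bar>)\<^sup>2)"
    using T by (intro infsum_cong_neutral) (auto simp: haar_coeff_haar_poly[OF p T] norm_mult)
  then show ?thesis using T by (simp add: square_function_def)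
qed

text \<open>The square function of a polynomial with indices in \<open>MLam m\<close> is constant on
  cells, so the norm becomes a finite average; the later estimates for polynomials rest on this
  formula.\<close>

lemma lp_norm_haar_poly:
  fixes c :: "('n::finite \<Rightarrow> haar_index) \<Rightarrow> 'k::{real_normed_field, euclidean_space}"
  assumes p: "1 < p" and T: "T \<subseteq> MLam m"
  shows "lp_norm p (haar_poly p T c) powr p = (\<Sum>k\<in>grid m. (\<Sum>I\<in>T. (norm (c I) * \<bar>MH p m I k\<bar>)\<^sup>2) powr (p / 2)) / 2 ^ (m * CARD('n))"
proof -
  have T': "finite T" "T \<subseteq> multi_haar_indices"
    using T finite_MLam finite_subset by (auto simp: multi_haar_indices_eq)
  let ?u = "\<lambda>k. (\<Sum>I\<in>T. (norm (c I) * \<bar>MH p m I k\<bar>)\<^sup>2)"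
  have "lp_norm p (haar_poly p T c) powr p = (LINT x|cm. step_fun m (\<lambda>k. ?u k powr (p / 2)) x)"
    unfolding lp_norm_powr[OF p]
  proof (intro Bochner_Integration.integral_cong refl)
    fix x :: "real ^ 'n" assume "x \<in> space cm"
    then have x: "x \<in> cbox 0 1" by simp
    have "square_function p (haar_poly p T c) x powr p = (\<Sum>I\<in>T. (norm (c I) * \<bar>multi_haar p I x\<bar>)\<^sup>2) powr (p / 2)"
      unfolding square_function_haar_poly[OF p T'] by (simp add: powr_half_sqrt[symmetric] powr_powr sum_nonneg)
    also have "(\<Sum>I\<in>T. (norm (c I) * \<bar>multi_haar p I x\<bar>)\<^sup>2) = step_fun m ?u x"
      using T x by (auto simp: multi_haar_step[OF subsetD[OF T]] step_fun_def intro!: sum.cong sum.neutral)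
    also have "step_fun m ?u x powr (p / 2) = step_fun m (\<lambda>k. ?u k powr (p / 2)) x"
      by (simp add: step_fun_def)
    finally show "square_function p (haar_poly p T c) x powr p = step_fun m (\<lambda>k. ?u k powr (p / 2)) x" .
  qed
  then show ?thesis by (simp add: integral_step_fun)
qed

lemma finite_in_MLam:
  assumes "finite T" "T \<subseteq> (multi_haar_indices :: ('n::finite \<Rightarrow> haar_index) set)"
  shows "\<exists>m. T \<subseteq> MLam m"
  using assms
proof (induction T rule: finite_induct)
  case (insert I T)
  then obtain m n where "T \<subseteq> MLam m" "I \<in> MLam n" by (auto simp: multi_haar_indices_eq)
  then show ?case using MLam_mono[of m "max m n"] MLam_mono[of n "max m n"]
    by (intro exI[of _ "max m n"]) auto
qed simp

lemma lp_norm_le_iff: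
  assumes "1 < p" shows "lp_norm p f powr p \<le> lp_norm p g powr p \<longleftrightarrow> lp_norm p f \<le> lp_norm p g"
  using assms lp_norm_nonneg[of p f] lp_norm_nonneg[of p g] powr_less_mono2[of p "lp_norm p g" "lp_norm p f"]
    powr_mono2[of p "lp_norm p f" "lp_norm p g"] by fastforce

lemma lp_norm_haar_poly_mono:
  fixes c :: "('n::finite \<Rightarrow> haar_index) \<Rightarrow> 'k::{real_normed_field, euclidean_space}"
  assumes p: "1 < p" and T: "finite T" "T \<subseteq> multi_haar_indices" and A: "A \<subseteq> T"
  shows "lp_norm p (haar_poly p A c) \<le> lp_norm p (haar_poly p T c)"
proof -
  obtain m where m: "T \<subseteq> MLam m" using finite_in_MLam[OF T] by blast
  have Am: "A \<subseteq> MLam m" using A m by simp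
  have "lp_norm p (haar_poly p A c) powr p \<le> lp_norm p (haar_poly p T c) powr p"
    unfolding lp_norm_haar_poly[OF p Am] lp_norm_haar_poly[OF p m] using p A T
    by (intro divide_right_mono sum_mono powr_mono2 sum_mono2 sum_nonneg) auto
  then show ?thesis by (simp add: lp_norm_le_iff[OF p])
qed

lemma MH_conj:
  assumes pq: "1 / p + 1 / q = (1::real)" and p: "0 < p" and k: "k \<in> grid m"
  shows "MH p m I k * MH q m I k = \<bar>MH p m I k\<bar> powr p"
proof -
  have "MH p m I k * MH q m I k = (\<Prod>i\<in>UNIV. \<bar>hv p m (I i) (k i)\<bar> powr p)"
    unfolding MH_def prod.distrib[symmetric] using k by (intro prod.cong hv_conj[OF pq p]) (auto simp: in_grid)
  also have "\<dots> = (\<Prod>i\<in>UNIV. \<bar>hv p m (I i) (k i)\<bar>) powr p" by (rule prod_powr_distrib[symmetric])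
  finally show ?thesis by (simp add: MH_def abs_prod)
qed

lemma lp_norm_haar_fun:
  assumes p: "1 < p" and I: "I \<in> multi_haar_indices"
  shows "lp_norm p (haar_fun p I :: real ^ 'n::finite \<Rightarrow> 'k::{real_normed_field, euclidean_space}) = 1"
proof -
  obtain m where m: "I \<in> MLam m" using I by (auto simp: multi_haar_indices_eq)
  have Hp: "(haar_fun p I :: real ^ 'n \<Rightarrow> 'k) = haar_poly p {I} (\<lambda>_. 1)" by (simp add: haar_poly_def)
  have "lp_norm p (haar_poly p {I} (\<lambda>_. 1 :: 'k)) powr p = (\<Sum>k\<in>grid m. (\<Sum>I\<in>{I}. (norm (1::'k) * \<bar>MH p m I k\<bar>)\<^sup>2) powr (p / 2)) / 2 ^ (m * CARD('n))"
    using m by (intro lp_norm_haar_poly p) auto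
  also have "\<dots> = (\<Sum>k\<in>grid m. MH p m I k * MH (conj_exp p) m I k) / 2 ^ (m * CARD('n))"
  proof (intro arg_cong2[of _ _ _ _ "(/)"] sum.cong refl)
    fix k :: "'n \<Rightarrow> nat" assume k: "k \<in> grid m"
    show "(\<Sum>I\<in>{I}. (norm (1::'k) * \<bar>MH p m I k\<bar>)\<^sup>2) powr (p / 2) = MH p m I k * MH (conj_exp p) m I k"
      using MH_conj[OF conj_exp_sum[OF p] _ k, of I] p by (simp add: square_powr_half)
  qed
  also have "\<dots> = 1" by (subst MH_biorthogonal[OF conj_exp_sum[OF p] m m]) simp
  finally have "lp_norm p (haar_fun p I :: real ^ 'n \<Rightarrow> 'k) powr p = 1" unfolding Hp .
  then have "(lp_norm p (haar_fun p I :: real ^ 'n \<Rightarrow> 'k) powr p) powr (1 / p) = 1" by simp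
  then show ?thesis using p lp_norm_nonneg[of p "haar_fun p I :: real ^ 'n \<Rightarrow> 'k"] by (simp add: powr_powr)
qed

section \<open>Duality between conjugate exponents\<close>

lemma holder_sum:
  fixes a b :: "'a \<Rightarrow> real"
  assumes pq: "1 / p + 1 / q = 1" "1 < p" "1 < q" and fin: "finite S"
    and nn: "\<And>k. k \<in> S \<Longrightarrow> 0 \<le> a k" "\<And>k. k \<in> S \<Longrightarrow> 0 \<le> b k"
  shows "(\<Sum>k\<in>S. a k * b k) \<le> (\<Sum>k\<in>S. a k powr p) powr (1 / p) * (\<Sum>k\<in>S. b k powr q) powr (1 / q)"
proof (cases "(\<Sum>k\<in>S. a k powr p) = 0 \<or> (\<Sum>k\<in>S. b k powr q) = 0")
  case True
  then have "(\<forall>k\<in>S. a k = 0) \<or> (\<forall>k\<in>S. b k = 0)"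
    using fin by (auto simp: sum_nonneg_eq_0_iff)
  then have "(\<Sum>k\<in>S. a k * b k) = 0" by (auto intro!: sum.neutral)
  then show ?thesis by simp
next
  case False
  define \<alpha> where "\<alpha> = (\<Sum>k\<in>S. a k powr p) powr (1 / p)"
  define \<beta> where "\<beta> = (\<Sum>k\<in>S. b k powr q) powr (1 / q)"
  have pos: "0 < (\<Sum>k\<in>S. a k powr p)" "0 < (\<Sum>k\<in>S. b k powr q)"
    using False by (auto simp: less_le sum_nonneg)
  have \<alpha>: "0 < \<alpha>" "\<alpha> powr p = (\<Sum>k\<in>S. a k powr p)" and \<beta>: "0 < \<beta>" "\<beta> powr q = (\<Sum>k\<in>S. b k powr q)"
    using pos pq by (auto simp: \<alpha>_def \<beta>_def powr_powr)
  have "(\<Sum>k\<in>S. a k / \<alpha> * (b k / \<beta>)) \<le> (\<Sum>k\<in>S. (a k / \<alpha>) powr p / p + (b k / \<beta>) powr q / q)"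
    using pq nn \<alpha> \<beta> by (intro sum_mono Youngs_inequality) auto
  also have "\<dots> = (\<Sum>k\<in>S. a k powr p) / \<alpha> powr p / p + (\<Sum>k\<in>S. b k powr q) / \<beta> powr q / q"
    using nn \<alpha> \<beta> unfolding sum.distrib sum_divide_distrib
    by (intro arg_cong2[of _ _ _ _ "(+)"] sum.cong refl) (simp_all add: powr_divide)
  also have "\<dots> = 1" using pos pq by (simp add: \<alpha>(2) \<beta>(2))
  finally have "(\<Sum>k\<in>S. a k * b k) / (\<alpha> * \<beta>) \<le> 1" by (simp add: sum_divide_distrib)
  then show ?thesis using \<alpha> \<beta> by (simp add: \<alpha>_def[symmetric] \<beta>_def[symmetric])
qed

lemma L2_set_powr: "L2_set f A powr r = (\<Sum>i\<in>A. (f i)\<^sup>2) powr (r / 2)"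
  unfolding L2_set_def by (simp add: powr_half_sqrt[symmetric] powr_powr sum_nonneg)

lemma conj_exp_ge_2: "1 < p \<Longrightarrow> p \<le> 2 \<Longrightarrow> 2 \<le> conj_exp p"
  by (simp add: conj_exp_def divide_simps)

text \<open>Biorthogonality writes the l1 sum as a pairing of the polynomial with coefficients
  \<open>norm (c I)\<close> and the plain sum of the dual Haar functions. Cauchy-Schwarz in
  \<open>I\<close> and Hoelder on the grid separate them, and \<open>upper_democracy\<close> bounds
  the second. The exponent is \<open>(d - 1) * (q / 2 - 1) / q\<close>, equal to
  \<open>h_exp\<close> since \<open>1 / 2 - 1 / q = 1 / p - 1 / 2\<close>.\<close>

theorem l1_bound:
  assumes p: "1 < p" "p \<le> 2"
  shows "\<exists>V0\<ge>1. \<forall>(A :: ('n::finite \<Rightarrow> haar_index) set) (c :: ('n \<Rightarrow> haar_index) \<Rightarrow> 'k::{real_normed_field, euclidean_space}) N.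
    finite A \<longrightarrow> A \<subseteq> multi_haar_indices \<longrightarrow> card A \<le> N \<longrightarrow> 1 \<le> N \<longrightarrow>
    (\<Sum>I\<in>A. norm (c I)) \<le> V0 * (1 + ln (real N)) powr h_exp p CARD('n) * real (card A) powr (1 / conj_exp p) * lp_norm p (haar_poly p A c)"
proof -
  let ?q = "conj_exp p"
  have q: "2 \<le> ?q" by (rule conj_exp_ge_2[OF p])
  note pq = conj_exp_sum[OF p(1)]
  obtain K where K: "0 < K" and dem: "\<And>m A N. A \<subseteq> (MLam m :: ('n \<Rightarrow> haar_index) set) \<Longrightarrow> card A \<le> N \<Longrightarrow> 1 \<le> N \<Longrightarrow>
    (\<Sum>k\<in>grid m. (\<Sum>I\<in>A. (MH ?q m I k)\<^sup>2) powr (?q / 2)) / 2 ^ (m * CARD('n))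
    \<le> K * (1 + ln (real N)) powr ((?q / 2 - 1) * (real CARD('n) - 1)) * real (card A)"
    using upper_democracy[OF q, where ?'n = 'n] by blast
  have "(\<Sum>I\<in>A. norm (c I)) \<le> max 1 (K powr (1 / ?q)) * (1 + ln (real N)) powr h_exp p CARD('n) * real (card A) powr (1 / ?q) * lp_norm p (haar_poly p A c)"
    if A: "finite A" "A \<subseteq> multi_haar_indices" "card A \<le> N" "1 \<le> N"
    for A :: "('n::finite \<Rightarrow> haar_index) set" and c :: "('n \<Rightarrow> haar_index) \<Rightarrow> 'k" and N
  proof -
    obtain m where m: "A \<subseteq> MLam m" using finite_in_MLam[OF A(1,2)] by blast
    let ?M = "2 ^ (m * CARD('n)) :: real"
    let ?L = "1 + ln (real N)"
    have L: "1 \<le> ?L" using A(4) by simp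
    define S where "S k = L2_set (\<lambda>I. norm (c I) * \<bar>MH p m I k\<bar>) A" for k
    define R where "R k = L2_set (\<lambda>I. MH ?q m I k) A" for k
    have "(\<Sum>I\<in>A. norm (c I)) = (\<Sum>I\<in>A. norm (c I) * ((\<Sum>k\<in>grid m. MH p m I k * MH ?q m I k) / ?M))"
      using m by (intro sum.cong refl) (subst MH_biorthogonal[OF pq], auto)
    also have "\<dots> = (\<Sum>I\<in>A. \<Sum>k\<in>grid m. norm (c I) * (MH p m I k * MH ?q m I k)) / ?M"
      unfolding sum_divide_distrib[where A = A]
      by (intro sum.cong refl) (simp only: times_divide_eq_right, simp only: sum_distrib_left)
    also have "(\<Sum>I\<in>A. \<Sum>k\<in>grid m. norm (c I) * (MH p m I k * MH ?q m I k))
        = (\<Sum>k\<in>grid m. \<Sum>I\<in>A. norm (c I) * (MH p m I k * MH ?q m I k))"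
      by (rule sum.swap)
    also have "(\<Sum>k\<in>grid m. \<Sum>I\<in>A. norm (c I) * (MH p m I k * MH ?q m I k)) / ?M \<le> (\<Sum>k\<in>grid m. S k * R k) / ?M"
    proof (intro divide_right_mono sum_mono)
      fix k :: "'n \<Rightarrow> nat"
      have "(\<Sum>I\<in>A. norm (c I) * (MH p m I k * MH ?q m I k)) \<le> (\<Sum>I\<in>A. \<bar>norm (c I) * \<bar>MH p m I k\<bar>\<bar> * \<bar>MH ?q m I k\<bar>)"
      proof (intro sum_mono)
        fix I
        have "norm (c I) * (MH p m I k * MH ?q m I k) \<le> norm (c I) * \<bar>MH p m I k * MH ?q m I k\<bar>"
          by (intro mult_left_mono abs_ge_self) auto
        then show "norm (c I) * (MH p m I k * MH ?q m I k) \<le> \<bar>norm (c I) * \<bar>MH p m I k\<bar>\<bar> * \<bar>MH ?q m I k\<bar>"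
          by (simp add: abs_mult mult.assoc)
      qed
      also have "\<dots> \<le> S k * R k" unfolding S_def R_def by (rule L2_set_mult_ineq)
      finally show "(\<Sum>I\<in>A. norm (c I) * (MH p m I k * MH ?q m I k)) \<le> S k * R k" .
    qed simp
    also have "\<dots> \<le> ((\<Sum>k\<in>grid m. S k powr p) powr (1 / p) * (\<Sum>k\<in>grid m. R k powr ?q) powr (1 / ?q)) / ?M"
      using pq p q by (intro divide_right_mono holder_sum) (auto simp: S_def R_def L2_set_nonneg finite_grid)
    also have "\<dots> = ((\<Sum>k\<in>grid m. S k powr p) / ?M) powr (1 / p) * ((\<Sum>k\<in>grid m. R k powr ?q) / ?M) powr (1 / ?q)"
    proof -
      have "?M powr (1 / p) * ?M powr (1 / ?q) = ?M" unfolding powr_add[symmetric] pq by simp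
      then show ?thesis by (simp add: powr_divide sum_nonneg)
    qed
    also have "(\<Sum>k\<in>grid m. S k powr p) / ?M = lp_norm p (haar_poly p A c) powr p"
      unfolding lp_norm_haar_poly[OF p(1) m] S_def L2_set_powr ..
    also have "(lp_norm p (haar_poly p A c) powr p) powr (1 / p) = lp_norm p (haar_poly p A c)"
      using p lp_norm_nonneg[of p "haar_poly p A c"] by (simp add: powr_powr)
    also have "lp_norm p (haar_poly p A c) * ((\<Sum>k\<in>grid m. R k powr ?q) / ?M) powr (1 / ?q)
      \<le> lp_norm p (haar_poly p A c) * (K * ?L powr ((?q / 2 - 1) * (real CARD('n) - 1)) * real (card A)) powr (1 / ?q)"
      unfolding R_def L2_set_powr using q
      by (intro mult_left_mono powr_mono2 dem m A divide_nonneg_nonneg sum_nonneg lp_norm_nonneg) auto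
    also have "(K * ?L powr ((?q / 2 - 1) * (real CARD('n) - 1)) * real (card A)) powr (1 / ?q) = K powr (1 / ?q) * ?L powr (((?q / 2 - 1) * (real CARD('n) - 1)) * (1 / ?q)) * real (card A) powr (1 / ?q)"
      using K L by (simp add: powr_mult powr_powr)
    also have "((?q / 2 - 1) * (real CARD('n) - 1)) * (1 / ?q) = h_exp p CARD('n)"
    proof -
      have "(?q / 2 - 1) * (1 / ?q) = 1 / 2 - 1 / ?q" using q by (simp add: field_simps)
      also have "\<dots> = 1 / p - 1 / 2" using pq by linarith
      also have "\<dots> = \<bar>1 / 2 - 1 / p\<bar>" using p by (simp add: divide_simps)
      finally have "(real CARD('n) - 1) * ((?q / 2 - 1) * (1 / ?q)) = h_exp p CARD('n)" by (simp only: h_exp_def)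
      then show ?thesis by (simp only: mult_ac)
    qed
    also have "lp_norm p (haar_poly p A c) * (K powr (1 / ?q) * ?L powr h_exp p CARD('n) * real (card A) powr (1 / ?q))
      \<le> lp_norm p (haar_poly p A c) * (max 1 (K powr (1 / ?q)) * ?L powr h_exp p CARD('n) * real (card A) powr (1 / ?q))"
      by (intro mult_left_mono mult_right_mono lp_norm_nonneg) auto
    finally show ?thesis by (simp only: mult_ac)
  qed
  then show ?thesis by (intro exI[of _ "max 1 (K powr (1 / ?q))"]) auto
qed

section \<open>The upper estimate\<close>

lemma haar_fun_inj:
  assumes p: "1 < p"
  shows "inj_on (haar_fun p :: ('n::finite \<Rightarrow> haar_index) \<Rightarrow> real ^ 'n \<Rightarrow> 'k::{real_normed_field, euclidean_space}) multi_haar_indices"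
proof (rule inj_onI)
  fix I J :: "'n \<Rightarrow> haar_index"
  assume IJ: "I \<in> multi_haar_indices" "J \<in> multi_haar_indices"
    and eq: "(haar_fun p I :: real ^ 'n \<Rightarrow> 'k) = haar_fun p J"
  have "haar_coeff p J (haar_fun p I :: real ^ 'n \<Rightarrow> 'k) = 1"
    unfolding eq using haar_coeff_haar_fun[OF p IJ(2,2), where ?'k = 'k] by simp
  then show "I = J" using haar_coeff_haar_fun[OF p IJ, where ?'k = 'k] by (simp split: if_splits)
qed

text \<open>The algorithm speaks of sets of functions, the norm formulas of sets of indices;
  \<open>haar_fun\<close> being injective, this translation preserves cardinalities.\<close>

definition idx :: "real \<Rightarrow> (real ^ 'n::finite \<Rightarrow> 'k::real_normed_field) set \<Rightarrow> ('n \<Rightarrow> haar_index) set" where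
  "idx p W = {I \<in> multi_haar_indices. haar_fun p I \<in> W}"

lemma idx_bij:
  assumes "1 < p" "W \<subseteq> (haar_dictionary p :: (real ^ 'n::finite \<Rightarrow> 'k::{real_normed_field, euclidean_space}) set)"
  shows "bij_betw (haar_fun p) (idx p W) W"
  unfolding bij_betw_def
proof
  show "inj_on (haar_fun p :: _ \<Rightarrow> real ^ 'n \<Rightarrow> 'k) (idx p W)"
    by (rule inj_on_subset[OF haar_fun_inj[OF assms(1)]]) (auto simp: idx_def)
  show "haar_fun p ` idx p W = W" using assms(2) by (auto simp: idx_def haar_dictionary_eq)
qed

lemma lincomb_haar_poly:
  assumes "1 < p" "W \<subseteq> (haar_dictionary p :: (real ^ 'n::finite \<Rightarrow> 'k::{real_normed_field, euclidean_space}) set)"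
  shows "lincomb W c = haar_poly p (idx p W) (\<lambda>I. c (haar_fun p I))"
  unfolding lincomb_def haar_poly_def using sum.reindex_bij_betw[OF idx_bij[OF assms], of "\<lambda>b. c b * b x" for x]
  by (intro ext) simp

lemma idx_finite:
  assumes "1 < p" "W \<subseteq> (haar_dictionary p :: (real ^ 'n::finite \<Rightarrow> 'k::{real_normed_field, euclidean_space}) set)" "finite W"
  shows "finite (idx p W)" "idx p W \<subseteq> multi_haar_indices" "card (idx p W) = card W"
  using bij_betw_finite[OF idx_bij[OF assms(1,2)]] bij_betw_same_card[OF idx_bij[OF assms(1,2)]] assms(3)
  by (auto simp: idx_def)

lemma Lp_greedy_space:
  assumes p: "1 < p" "p \<le> 2"
  shows "greedy_space (Lp_cube p :: (real ^ 'n::finite \<Rightarrow> 'k::{real_normed_field, euclidean_space}) set) (lp_norm p) (haar_dictionary p) p"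
proof
  show "haar_dictionary p \<subseteq> (Lp_cube p :: (real ^ 'n \<Rightarrow> 'k) set)"
    using haar_fun_in_Lp by (auto simp: haar_dictionary_eq)
  show "lp_norm p (\<lambda>x. f x + g x) powr p + lp_norm p (\<lambda>x. f x - g x) powr p \<le> 2 * (lp_norm p f powr p + lp_norm p g powr p)"
    if "f \<in> Lp_cube p" "g \<in> Lp_cube p" for f g :: "real ^ 'n \<Rightarrow> 'k"
    using that p by (rule lp_norm_smooth)
  show "lp_norm p \<phi> \<le> 1" if "\<phi> \<in> haar_dictionary p" for \<phi> :: "real ^ 'n \<Rightarrow> 'k"
    using that lp_norm_haar_fun[OF p(1), where ?'n = 'n and ?'k = 'k] by (auto simp: haar_dictionary_eq)
  show "lp_norm p (lincomb A c) \<le> lp_norm p (lincomb W c)"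
    if W: "finite W" "W \<subseteq> haar_dictionary p" "A \<subseteq> W" for W A :: "(real ^ 'n \<Rightarrow> 'k) set" and c
  proof -
    have A: "A \<subseteq> haar_dictionary p" using W by auto
    show ?thesis
      unfolding lincomb_haar_poly[OF p(1) W(2)] lincomb_haar_poly[OF p(1) A]
      using W(3) by (intro lp_norm_haar_poly_mono p idx_finite W) (auto simp: idx_def)
  qed
qed (use p in \<open>simp_all add: Lp_zero Lp_add Lp_scale lp_norm_nonneg lp_norm_scale\<close>)

theorem wcga_upper_estimate:
  assumes p: "1 < p" "p \<le> 2" and \<tau>: "0 < \<tau>" "\<tau> \<le> 1"
  shows "\<exists>c>0. wcga_lebesgue_ineq (Lp_cube p :: (real ^ 'n::finite \<Rightarrow> 'k::{real_normed_field, euclidean_space}) set)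
    (lp_norm p) (haar_dictionary p) \<tau>
    (\<lambda>N. nat \<lfloor>c * (1 + ln (real N)) powr (conj_exp p * h_exp p CARD('n)) * real N\<rfloor>) 4"
proof -
  interpret greedy_space "Lp_cube p :: (real ^ 'n \<Rightarrow> 'k) set" "lp_norm p" "haar_dictionary p" p
    by (rule Lp_greedy_space[OF p])
  let ?q = "conj_exp p" and ?h = "h_exp p CARD('n)"
  have q: "2 \<le> ?q" by (rule conj_exp_ge_2[OF p])
  obtain V0 where V0: "1 \<le> V0" and l1: "\<And>(A :: ('n \<Rightarrow> haar_index) set) (c :: ('n \<Rightarrow> haar_index) \<Rightarrow> 'k) N.
    finite A \<Longrightarrow> A \<subseteq> multi_haar_indices \<Longrightarrow> card A \<le> N \<Longrightarrow> 1 \<le> N \<Longrightarrow>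
    (\<Sum>I\<in>A. norm (c I)) \<le> V0 * (1 + ln (real N)) powr ?h * real (card A) powr (1 / ?q) * lp_norm p (haar_poly p A c)"
    using l1_bound[OF p, where ?'n = 'n and ?'k = 'k] by blast
  \<comment> \<open>\<open>c1\<close> is \<open>p * ln 20 / \<kappa>\<close> with \<open>V0\<close>
    in place of \<open>V\<close>. In \<open>c\<close>, the 1 pays for the ceiling in
    \<open>\<rho>\<close> and the 4 for the budget \<open>4 * \<rho> * card T\<close>.\<close>
  define c1 where "c1 = p * ln 20 * (20 * V0 / \<tau>) powr ?q"
  define c where "c = 4 * (c1 + 1)"
  have c1: "0 < c1" using p V0 \<tau> by (simp add: c1_def)
  have "lp_norm p (\<lambda>x. f x - G (nat \<lfloor>c * (1 + ln (real N)) powr (?q * ?h) * real N\<rfloor>) x)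
      \<le> 4 * best_error (lp_norm p) (haar_dictionary p) N f"
    if N: "1 \<le> N" and f: "f \<in> Lp_cube p" and run: "wcga_run (Lp_cube p) (lp_norm p) (haar_dictionary p) \<tau> f \<phi> G"
    for N and f :: "real ^ 'n \<Rightarrow> 'k" and \<phi> G
  proof -
    let ?n = "nat \<lfloor>c * (1 + ln (real N)) powr (?q * ?h) * real N\<rfloor>" and ?L = "1 + ln (real N)"
    define V where "V = V0 * ?L powr ?h"
    have L: "1 \<le> ?L" using N by simp
    have h: "0 \<le> ?h" by (simp add: h_exp_def Suc_le_eq)
    have Lh: "1 \<le> ?L powr ?h" using L h by (simp add: ge_one_powr_ge_zero)
    have V: "1 \<le> V" unfolding V_def using V0 Lh mult_mono[of 1 V0 1 "?L powr ?h"] by simp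
    have bound: "lp_norm p (\<lambda>x. f x - G ?n x) / 4 \<le> lp_norm p (\<lambda>x. f x - g x)"
      if gs: "g \<in> sparse (haar_dictionary p) N" for g
    proof -
      obtain T where TD: "T \<subseteq> haar_dictionary p" "finite T" "card T \<le> N" and gT: "g \<in> lin_span T"
        using gs unfolding sparse_def by blast
      obtain a where g: "g = lincomb T a" using gT unfolding lin_span_eq by blast
      interpret greedy_run "Lp_cube p :: (real ^ 'n \<Rightarrow> 'k) set" "lp_norm p" "haar_dictionary p" p \<tau> V f \<phi> G T a
      proof
        fix A assume A: "A \<subseteq> T"
        then have AD: "A \<subseteq> haar_dictionary p" and finA: "finite A" using TD finite_subset by auto
        have cA: "card A \<le> N" using card_mono[OF TD(2) A] TD(3) by simp
        have "(\<Sum>b\<in>A. norm (a b)) = (\<Sum>I\<in>idx p A. norm (a (haar_fun p I)))"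
          by (rule sum.reindex_bij_betw[OF idx_bij[OF p(1) AD], symmetric])
        also have "\<dots> \<le> V * real (card (idx p A)) powr (1 / ?q) * lp_norm p (haar_poly p (idx p A) (\<lambda>I. a (haar_fun p I)))"
          unfolding V_def using N cA idx_finite[OF p(1) AD finA] by (intro l1) auto
        finally show "(\<Sum>b\<in>A. norm (a b)) \<le> V * real (card A) powr (1 / (p / (p - 1))) * lp_norm p (lincomb A a)"
          unfolding lincomb_haar_poly[OF p(1) AD] idx_finite(3)[OF p(1) AD finA] conj_exp_def .
      qed (use \<tau> V f run TD in auto)
      have "4 * \<rho> * card T \<le> ?n"
      proof (rule le_nat_floor)
        have qq: "q = ?q" by (simp add: q_def conj_exp_def)
        have "p * ln 20 / \<kappa> = c1 * ?L powr (?q * ?h)"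
        proof -
          have "1 / \<kappa> = (20 * V / \<tau>) powr ?q"
            unfolding \<kappa>_def qq using \<tau> V by (simp add: powr_divide powr_mult)
          also have "\<dots> = ((20 * V0 / \<tau>) * ?L powr ?h) powr ?q" by (simp add: V_def mult.assoc)
          also have "\<dots> = (20 * V0 / \<tau>) powr ?q * ?L powr (?q * ?h)"
            using V0 \<tau> by (subst powr_mult) (auto simp: powr_powr mult.commute)
          finally have "p * ln 20 * (1 / \<kappa>) = c1 * ?L powr (?q * ?h)" by (simp add: c1_def)
          then show ?thesis by simp
        qed
        moreover have "real \<rho> \<le> p * ln 20 / \<kappa> + 1"
        proof -
          have "0 \<le> p * ln 20 / \<kappa>" using p \<kappa>(1) by simp
          then show ?thesis unfolding \<rho>_def by linarith
        qed
        moreover have "1 \<le> ?L powr (?q * ?h)" using L h q by (intro ge_one_powr_ge_zero) auto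
        ultimately have "real \<rho> \<le> (c1 + 1) * ?L powr (?q * ?h)" by (simp add: distrib_right)
        then have "4 * (real \<rho> * real (card T)) \<le> 4 * ((c1 + 1) * ?L powr (?q * ?h) * real N)"
          using TD(3) c1 by (intro mult_left_mono mult_mono) auto
        then show "real (4 * \<rho> * card T) \<le> c * ?L powr (?q * ?h) * real N"
          by (simp only: c_def mult.assoc of_nat_mult of_nat_numeral)
      qed
      from run_error_bound[OF this] show ?thesis by (simp add: e_def \<delta>_def g)
    qed
    have "(\<lambda>x. 0) \<in> sparse (haar_dictionary p :: (real ^ 'n \<Rightarrow> 'k) set) N"
      by (auto simp: sparse_def lin_span_def intro!: exI[of _ "{}"])
    then have "lp_norm p (\<lambda>x. f x - G ?n x) / 4 \<le> best_error (lp_norm p) (haar_dictionary p) N f"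
      unfolding best_error_def dist_to_def by (intro cINF_greatest bound) auto
    then show ?thesis by simp
  qed
  then show ?thesis using c1 unfolding wcga_lebesgue_ineq_def c_def[symmetric]
    by (intro exI[of _ c]) (auto simp: c_def)
qed

section \<open>Runs on Haar polynomials\<close>

definition grid_square :: "real \<Rightarrow> nat \<Rightarrow> ('n::finite \<Rightarrow> haar_index) set \<Rightarrow> (('n \<Rightarrow> haar_index) \<Rightarrow> real) \<Rightarrow> ('n \<Rightarrow> nat) \<Rightarrow> real" where
  "grid_square p m T w k = (\<Sum>I\<in>T. (w I * \<bar>MH p m I k\<bar>)\<^sup>2)"

text \<open>The norming functional of the polynomial with coefficients \<open>w\<close> takes the values
  \<open>\<nu> powr (1 - p) * weight\<close> on the Haar functions, where \<open>\<nu>\<close> is the norm of the polynomial.\<close>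

definition weight :: "real \<Rightarrow> nat \<Rightarrow> ('n::finite \<Rightarrow> haar_index) set \<Rightarrow> (('n \<Rightarrow> haar_index) \<Rightarrow> real) \<Rightarrow> ('n \<Rightarrow> haar_index) \<Rightarrow> real" where
  "weight p m T w I = w I * ((\<Sum>k\<in>grid m. grid_square p m T w k powr ((p - 2) / 2) * (MH p m I k)\<^sup>2) / 2 ^ (m * CARD('n)))"

lemma grid_square_nonneg: "0 \<le> grid_square p m T w k"
  by (simp add: grid_square_def sum_nonneg)

text \<open>Restricting to \<open>T\<close> only removes terms of the square function; almost
  everywhere the full sum is a limit of partial sums, so the comparison is safe from default
  values.\<close>

lemma lp_norm_projection:
  fixes g :: "real ^ 'n::finite \<Rightarrow> 'k::{real_normed_field, euclidean_space}"
  assumes p: "1 < p" "p \<le> 2" and T: "T \<subseteq> MLam m" and g: "g \<in> Lp_cube p"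
  shows "lp_norm p (haar_poly p T (\<lambda>I. haar_coeff p I g)) \<le> lp_norm p g"
proof -
  have T': "finite T" "T \<subseteq> multi_haar_indices"
    using T finite_MLam finite_subset by (auto simp: multi_haar_indices_eq)
  have P: "haar_poly p T (\<lambda>I. haar_coeff p I g) \<in> Lp_cube p" using T' p by (intro haar_poly_in_Lp) auto
  have "AE x in cm. square_function p (haar_poly p T (\<lambda>I. haar_coeff p I g)) x powr p \<le> square_function p g x powr p"
    using partial_square_limit[OF g p]
  proof eventually_elim
    case (elim x)
    have "(\<Sum>I\<in>T. (norm (haar_coeff p I g) * \<bar>multi_haar p I x\<bar>)\<^sup>2) \<le> partial_square p m g x"
      unfolding partial_square_def using T by (auto simp: norm_mult intro!: sum_mono2 finite_MLam)
    also have "\<dots> \<le> (square_function p g x)\<^sup>2"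
      using elim by (rule incseq_le[rotated]) (auto simp: incseq_def partial_square_mono)
    finally have "sqrt (\<Sum>I\<in>T. (norm (haar_coeff p I g) * \<bar>multi_haar p I x\<bar>)\<^sup>2) \<le> sqrt ((square_function p g x)\<^sup>2)"
      by (rule real_sqrt_le_mono)
    then show ?case
      using p square_function_nonneg[of p g x]
      by (intro powr_mono2) (auto simp: square_function_haar_poly[OF p(1) T'] sum_nonneg)
  qed
  then have "lp_norm p (haar_poly p T (\<lambda>I. haar_coeff p I g)) powr p \<le> lp_norm p g powr p"
    unfolding lp_norm_powr[OF p(1)] by (intro integral_mono_AE square_function_integrable P g p)
  then show ?thesis by (simp add: lp_norm_le_iff[OF p(1)])
qed

text \<open>The derivative of the norm at the polynomial. Weights times coefficients add up to the
  p-th power of the norm, which gives the value there; the bound is Cauchy-Schwarz over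
  \<open>T\<close>, Hoelder on the grid with \<open>(p - 1) * q = p\<close>, and the projection onto
  \<open>T\<close>.\<close>

lemma polynomial_norming_functional:
  fixes w :: "('n::finite \<Rightarrow> haar_index) \<Rightarrow> real"
  assumes p: "1 < p" "p \<le> 2" and T: "T \<subseteq> MLam m" and w: "\<And>I. I \<in> T \<Longrightarrow> 0 < w I"
    and \<nu>: "\<nu> = lp_norm p (haar_poly p T (\<lambda>I. of_real (w I) :: 'k::{real_normed_field, euclidean_space}))" "0 < \<nu>"
  shows "norming_functional (Lp_cube p) (lp_norm p) (haar_poly p T (\<lambda>I. of_real (w I) :: 'k))
    (\<lambda>g. \<Sum>I\<in>T. of_real (\<nu> powr (1 - p) * weight p m T w I) * haar_coeff p I g)"
proof -
  let ?M = "2 ^ (m * CARD('n)) :: real" and ?q = "conj_exp p"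
  let ?r = "haar_poly p T (\<lambda>I. of_real (w I) :: 'k)" and ?S = "grid_square p m T w"
  define F :: "(real ^ 'n \<Rightarrow> 'k) \<Rightarrow> 'k" where "F g = (\<Sum>I\<in>T. of_real (\<nu> powr (1 - p) * weight p m T w I) * haar_coeff p I g)" for g
  note pq = conj_exp_sum[OF p(1)]
  have q: "2 \<le> ?q" by (rule conj_exp_ge_2[OF p])
  have qp: "(p - 1) * ?q = p" using p by (simp add: conj_exp_def)
  have T': "finite T" "T \<subseteq> multi_haar_indices"
    using T finite_MLam finite_subset by (auto simp: multi_haar_indices_eq)
  have rX: "?r \<in> Lp_cube p" using T' p by (intro haar_poly_in_Lp) auto
  have nup: "\<nu> powr p = (\<Sum>k\<in>grid m. ?S k powr (p / 2)) / ?M"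
    unfolding \<nu>(1) lp_norm_haar_poly[OF p(1) T] grid_square_def using w
    by (intro arg_cong2[of _ _ _ _ "(/)"] sum.cong refl arg_cong2[of _ _ _ _ "(powr)"]) (auto simp: power_mult_distrib)
  have wt: "0 \<le> weight p m T w I" if "I \<in> T" for I
    using w[OF that] by (auto simp: weight_def intro!: mult_nonneg_nonneg divide_nonneg_nonneg sum_nonneg)
  have Fr: "F ?r = of_real \<nu>"
  proof -
    have "F ?r = of_real (\<Sum>I\<in>T. \<nu> powr (1 - p) * weight p m T w I * w I)"
      unfolding F_def of_real_sum using T' by (intro sum.cong refl) (auto simp: haar_coeff_haar_poly[OF p(1) T'])
    also have "(\<Sum>I\<in>T. \<nu> powr (1 - p) * weight p m T w I * w I)
      = \<nu> powr (1 - p) * ((\<Sum>I\<in>T. \<Sum>k\<in>grid m. ?S k powr ((p - 2) / 2) * (w I * \<bar>MH p m I k\<bar>)\<^sup>2) / ?M)"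
      unfolding weight_def sum_distrib_left sum_divide_distrib sum_distrib_right
      by (intro sum.cong refl) (simp add: power2_eq_square mult_ac abs_mult[symmetric])
    also have "(\<Sum>I\<in>T. \<Sum>k\<in>grid m. ?S k powr ((p - 2) / 2) * (w I * \<bar>MH p m I k\<bar>)\<^sup>2)
      = (\<Sum>k\<in>grid m. ?S k powr ((p - 2) / 2) * ?S k)"
      by (subst sum.swap) (simp add: grid_square_def sum_distrib_left)
    also have "\<dots> = (\<Sum>k\<in>grid m. ?S k powr (p / 2))"
    proof (intro sum.cong refl)
      fix k :: "'n \<Rightarrow> nat"
      \<comment> \<open>Where the square function vanishes both sides are 0, because
        \<open>0 powr\<close> is 0 also for the nonpositive exponent on the left.\<close>
      show "?S k powr ((p - 2) / 2) * ?S k = ?S k powr (p / 2)"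
      proof (cases "?S k = 0")
        case False
        then have "0 < ?S k" using grid_square_nonneg[of p m T w k] by simp
        then have "?S k powr ((p - 2) / 2) * ?S k powr 1 = ?S k powr (p / 2)"
          unfolding powr_add[symmetric] by (simp add: field_simps)
        then show ?thesis using \<open>0 < ?S k\<close> by simp
      qed simp
    qed
    also have "\<nu> powr (1 - p) * ((\<Sum>k\<in>grid m. ?S k powr (p / 2)) / ?M) = \<nu>"
      unfolding nup[symmetric] powr_add[symmetric] using \<nu>(2) by simp
    finally show ?thesis .
  qed
  have Fle: "norm (F g) \<le> lp_norm p g" if g: "g \<in> Lp_cube p" for g
  proof -
    let ?c = "\<lambda>I. norm (haar_coeff p I g)"
    define R where "R k = L2_set (\<lambda>I. ?c I * \<bar>MH p m I k\<bar>) T" for k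
    have "norm (F g) \<le> (\<Sum>I\<in>T. \<nu> powr (1 - p) * weight p m T w I * ?c I)"
      unfolding F_def using wt by (intro sum_norm_le) (simp add: norm_mult abs_mult)
    also have "\<dots> = \<nu> powr (1 - p) * ((\<Sum>I\<in>T. \<Sum>k\<in>grid m. ?S k powr ((p - 2) / 2) * ((w I * \<bar>MH p m I k\<bar>) * (?c I * \<bar>MH p m I k\<bar>))) / ?M)"
      unfolding weight_def sum_distrib_left sum_divide_distrib sum_distrib_right
      by (intro sum.cong refl) (simp add: power2_eq_square mult_ac abs_mult[symmetric])
    also have "(\<Sum>I\<in>T. \<Sum>k\<in>grid m. ?S k powr ((p - 2) / 2) * ((w I * \<bar>MH p m I k\<bar>) * (?c I * \<bar>MH p m I k\<bar>)))
       = (\<Sum>k\<in>grid m. ?S k powr ((p - 2) / 2) * (\<Sum>I\<in>T. (w I * \<bar>MH p m I k\<bar>) * (?c I * \<bar>MH p m I k\<bar>)))"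
      by (subst sum.swap) (simp add: sum_distrib_left)
    also have "\<nu> powr (1 - p) * ((\<Sum>k\<in>grid m. ?S k powr ((p - 2) / 2) * (\<Sum>I\<in>T. (w I * \<bar>MH p m I k\<bar>) * (?c I * \<bar>MH p m I k\<bar>))) / ?M)
       \<le> \<nu> powr (1 - p) * ((\<Sum>k\<in>grid m. ?S k powr ((p - 1) / 2) * R k) / ?M)"
    proof (intro mult_left_mono divide_right_mono sum_mono)
      fix k :: "'n \<Rightarrow> nat"
      have "(\<Sum>I\<in>T. (w I * \<bar>MH p m I k\<bar>) * (?c I * \<bar>MH p m I k\<bar>)) = (\<Sum>I\<in>T. \<bar>w I * \<bar>MH p m I k\<bar>\<bar> * \<bar>?c I * \<bar>MH p m I k\<bar>\<bar>)"
        using w by (intro sum.cong refl) (auto simp: abs_mult less_imp_le)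
      also have "\<dots> \<le> L2_set (\<lambda>I. w I * \<bar>MH p m I k\<bar>) T * R k"
        unfolding R_def by (rule L2_set_mult_ineq)
      also have "L2_set (\<lambda>I. w I * \<bar>MH p m I k\<bar>) T = ?S k powr (1 / 2)"
        by (simp add: L2_set_def grid_square_def powr_half_sqrt sum_nonneg)
      finally have "?S k powr ((p - 2) / 2) * (\<Sum>I\<in>T. (w I * \<bar>MH p m I k\<bar>) * (?c I * \<bar>MH p m I k\<bar>))
        \<le> ?S k powr ((p - 2) / 2) * (?S k powr (1 / 2) * R k)"
        by (intro mult_left_mono) auto
      also have "\<dots> = ?S k powr ((p - 1) / 2) * R k"
        unfolding mult.assoc[symmetric] powr_add[symmetric] by (simp add: field_simps)
      finally show "?S k powr ((p - 2) / 2) * (\<Sum>I\<in>T. (w I * \<bar>MH p m I k\<bar>) * (?c I * \<bar>MH p m I k\<bar>)) \<le> ?S k powr ((p - 1) / 2) * R k" .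
    qed auto
    also have "\<dots> \<le> \<nu> powr (1 - p) * (((\<Sum>k\<in>grid m. (?S k powr ((p - 1) / 2)) powr ?q) powr (1 / ?q) * (\<Sum>k\<in>grid m. R k powr p) powr (1 / p)) / ?M)"
      using pq p q by (intro mult_left_mono divide_right_mono holder_sum) (auto simp: R_def L2_set_nonneg finite_grid)
    also have "(\<Sum>k\<in>grid m. (?S k powr ((p - 1) / 2)) powr ?q) = \<nu> powr p * ?M"
    proof -
      have "(p - 1) / 2 * ?q = p / 2" using qp by simp
      then show ?thesis unfolding powr_powr nup by simp
    qed
    also have "(\<Sum>k\<in>grid m. R k powr p) = lp_norm p (haar_poly p T (\<lambda>I. haar_coeff p I g)) powr p * ?M"
      unfolding lp_norm_haar_poly[OF p(1) T] R_def L2_set_powr by simp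
    also have "(\<nu> powr p * ?M) powr (1 / ?q) = \<nu> powr (p - 1) * ?M powr (1 / ?q)"
    proof -
      have "p * (1 / ?q) = p - 1" using p by (simp add: conj_exp_def)
      then show ?thesis using \<nu>(2) by (simp add: powr_mult powr_powr)
    qed
    also have "(lp_norm p (haar_poly p T (\<lambda>I. haar_coeff p I g)) powr p * ?M) powr (1 / p) = lp_norm p (haar_poly p T (\<lambda>I. haar_coeff p I g)) * ?M powr (1 / p)"
      using p by (simp add: powr_mult powr_powr lp_norm_nonneg)
    also have "\<nu> powr (1 - p) * (\<nu> powr (p - 1) * ?M powr (1 / ?q) * (lp_norm p (haar_poly p T (\<lambda>I. haar_coeff p I g)) * ?M powr (1 / p)) / ?M)
      = (\<nu> powr (1 - p) * \<nu> powr (p - 1)) * (?M powr (1 / ?q) * ?M powr (1 / p)) / ?M * lp_norm p (haar_poly p T (\<lambda>I. haar_coeff p I g))"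
      by simp
    also have "\<dots> = lp_norm p (haar_poly p T (\<lambda>I. haar_coeff p I g))"
      unfolding powr_add[symmetric] using pq \<nu>(2) by (simp add: add.commute)
    also have "\<dots> \<le> lp_norm p g" by (rule lp_norm_projection[OF p T g])
    finally show ?thesis .
  qed
  have int: "integrable cm g" if "g \<in> Lp_cube p" for g :: "real ^ 'n \<Rightarrow> 'k"
    using Lp_integrable[OF that] p by simp
  have "F (\<lambda>x. f x + g x) = F f + F g" if "f \<in> Lp_cube p" "g \<in> Lp_cube p" for f g
    unfolding F_def sum.distrib[symmetric]
    by (intro sum.cong refl) (use T' in \<open>auto simp: haar_coeff_add[OF int[OF that(1)] int[OF that(2)]] distrib_left\<close>)
  moreover have "F (\<lambda>x. a * f x) = a * F f" for a f
    unfolding F_def sum_distrib_left by (simp add: haar_coeff_scale mult_ac)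
  ultimately have dual: "F \<in> dual_space (Lp_cube p) (lp_norm p)"
    unfolding dual_space_def using Fle by (auto intro!: exI[of _ 1])
  let ?r1 = "\<lambda>x. of_real (1 / \<nu>) * ?r x"
  have r1: "?r1 \<in> Lp_cube p" by (rule Lp_scale[OF rX])
  have nr1: "lp_norm p ?r1 = 1" using \<nu> by (subst lp_norm_scale[OF p(1)]) (simp add: norm_divide)
  have "F ?r1 = of_real (1 / \<nu>) * F ?r" unfolding F_def sum_distrib_left haar_coeff_scale by (simp add: mult_ac)
  also have "\<dots> = of_real (1 / \<nu> * \<nu>)" unfolding Fr of_real_mult ..
  finally have Fr1: "norm (F ?r1) = 1" using \<nu>(2) by simp
  have "(SUP f\<in>{f \<in> Lp_cube p. lp_norm p f \<le> 1}. norm (F f)) = 1"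
  proof (rule antisym)
    show "(SUP f\<in>{f \<in> Lp_cube p. lp_norm p f \<le> 1}. norm (F f)) \<le> 1"
      using r1 nr1 Fle by (intro cSUP_least) (auto intro: order_trans)
    have "norm (F ?r1) \<le> (SUP f\<in>{f \<in> Lp_cube p. lp_norm p f \<le> 1}. norm (F f))"
      using r1 nr1 Fle by (intro cSUP_upper bdd_aboveI2[where M = 1]) (auto intro: order_trans)
    then show "1 \<le> (SUP f\<in>{f \<in> Lp_cube p. lp_norm p f \<le> 1}. norm (F f))" using Fr1 by simp
  qed
  then have "norming_functional (Lp_cube p) (lp_norm p) ?r F"
    unfolding norming_functional_def dual_norm_def using dual Fr \<nu>(1) by simp
  then show ?thesis by (simp add: F_def[abs_def])
qed

lemma lp_norm_haar_poly_pos: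
  assumes p: "1 < p" and U: "finite U" "U \<subseteq> multi_haar_indices" "U \<noteq> {}" and w: "\<And>I. I \<in> U \<Longrightarrow> 0 < w I"
  shows "0 < lp_norm p (haar_poly p U (\<lambda>I. of_real (w I)) :: real ^ 'n::finite \<Rightarrow> 'k::{real_normed_field, euclidean_space})"
proof -
  obtain I where I: "I \<in> U" using U by auto
  have "haar_poly p {I} (\<lambda>I. of_real (w I)) = (\<lambda>x. of_real (w I) * (haar_fun p I x :: 'k))" by (simp add: haar_poly_def)
  then have "lp_norm p (haar_poly p {I} (\<lambda>I. of_real (w I)) :: real ^ 'n \<Rightarrow> 'k) = w I"
    using I U w[OF I] by (simp add: lp_norm_scale[OF p] subsetD lp_norm_haar_fun[OF p])
  moreover have "lp_norm p (haar_poly p {I} (\<lambda>I. of_real (w I)) :: real ^ 'n \<Rightarrow> 'k) \<le> lp_norm p (haar_poly p U (\<lambda>I. of_real (w I)) :: real ^ 'n \<Rightarrow> 'k)"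
    using I by (intro lp_norm_haar_poly_mono p U) auto
  ultimately show ?thesis using w[OF I] by simp
qed

lemma haar_poly_diff:
  assumes "finite T" "U \<subseteq> T"
  shows "haar_poly p T c x - haar_poly p (T - U) c x = haar_poly p U c x"
  using sum.subset_diff[OF assms(2,1), of "\<lambda>I. c I * haar_fun p I x"] by (simp add: haar_poly_def)

text \<open>By unconditionality a best approximant may keep the coefficients of the chosen
  functions, so remainders are subpolynomials with known norming functionals. Choosing a maximal
  weight satisfies the selection rule for any \<open>\<tau> \<le> 1\<close>. One such run suffices
  to exploit an inequality assumed for all runs.\<close>

theorem greedy_run_exists:
  fixes T :: "('n::finite \<Rightarrow> haar_index) set" and w :: "('n \<Rightarrow> haar_index) \<Rightarrow> real"
  assumes p: "1 < p" "p \<le> 2" and \<tau>: "0 < \<tau>" "\<tau> \<le> 1"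
    and T: "T \<subseteq> MLam m" and w: "\<And>I. I \<in> T \<Longrightarrow> 0 < w I"
  shows "\<exists>(\<phi> :: nat \<Rightarrow> real ^ 'n \<Rightarrow> 'k::{real_normed_field, euclidean_space}) G U.
    wcga_run (Lp_cube p) (lp_norm p) (haar_dictionary p) \<tau> (haar_poly p T (\<lambda>I. of_real (w I))) \<phi> G \<and>
    (\<forall>n. (\<lambda>x. haar_poly p T (\<lambda>I. of_real (w I)) x - G n x) = haar_poly p (U n) (\<lambda>I. of_real (w I))) \<and>
    U 0 = T \<and> (\<forall>n. U n \<subseteq> T) \<and>
    (\<forall>n. U n \<noteq> {} \<longrightarrow> (\<exists>I\<in>U n. U (Suc n) = U n - {I} \<and> (\<forall>J\<in>U n. weight p m (U n) w J \<le> weight p m (U n) w I)))"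
proof -
  have T': "finite T" "T \<subseteq> multi_haar_indices"
    using T finite_MLam finite_subset by (auto simp: multi_haar_indices_eq)
  let ?c = "\<lambda>I. of_real (w I) :: 'k"
  define sel where "sel U = (SOME I. I \<in> U \<and> (\<forall>J\<in>U. weight p m U w J \<le> weight p m U w I))" for U
  have sel: "sel U \<in> U \<and> (\<forall>J\<in>U. weight p m U w J \<le> weight p m U w (sel U))" if "finite U" "U \<noteq> {}" for U
  proof -
    have "Max (weight p m U w ` U) \<in> weight p m U w ` U" using that by (intro Max_in) auto
    then obtain I where "I \<in> U" "weight p m U w I = Max (weight p m U w ` U)" by (metis imageE)
    then have "I \<in> U \<and> (\<forall>J\<in>U. weight p m U w J \<le> weight p m U w I)" using that by auto
    then show ?thesis
      unfolding sel_def by (rule someI[of "\<lambda>I. I \<in> U \<and> (\<forall>J\<in>U. weight p m U w J \<le> weight p m U w I)"])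
  qed
  define U where "U n = rec_nat T (\<lambda>_ U. U - {sel U}) n" for n
  have U0: "U 0 = T" and US: "U (Suc n) = U n - {sel (U n)}" for n by (simp_all add: U_def)
  have UT: "U n \<subseteq> T" for n by (induction n) (auto simp: U0 US)
  have Ufin: "finite (U n)" "U n \<subseteq> multi_haar_indices" "U n \<subseteq> MLam m" for n
    using UT[of n] T T' finite_subset by auto
  define \<phi> :: "nat \<Rightarrow> real ^ 'n \<Rightarrow> 'k" where "\<phi> n = haar_fun p (sel (U n))" for n
  define G :: "nat \<Rightarrow> real ^ 'n \<Rightarrow> 'k" where "G n = haar_poly p (T - U n) ?c" for n
  have rem: "(\<lambda>x. haar_poly p T ?c x - G n x) = haar_poly p (U n) ?c" for n
    unfolding G_def using haar_poly_diff[OF T'(1) UT] by (intro ext)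
  have chosen: "T - U (Suc n) = (\<lambda>k. sel (U k)) ` {..n}" if "U n \<noteq> {}" for n
    using that
  proof (induction n)
    case 0
    then show ?case using sel[OF Ufin(1)[of 0]] by (auto simp: U0 US)
  next
    case (Suc n)
    then have ne: "U n \<noteq> {}" by (auto simp: US)
    have "sel (U (Suc n)) \<in> U (Suc n)" using sel[OF Ufin(1) Suc.prems] by blast
    then have "T - U (Suc (Suc n)) = insert (sel (U (Suc n))) (T - U (Suc n))"
      using UT[of "Suc n"] by (auto simp: US[of "Suc n"])
    then show ?case using Suc.IH[OF ne] by (simp add: atMost_Suc)
  qed
  have "wcga_run (Lp_cube p) (lp_norm p) (haar_dictionary p) \<tau> (haar_poly p T ?c) \<phi> G"
    unfolding wcga_run_def rem
  proof (intro conjI allI)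
    show "G 0 = (\<lambda>x. 0)" by (simp add: G_def U0 haar_poly_def)
    fix n
    show "if lp_norm p (haar_poly p (U n) ?c) = 0 then G (Suc n) = G n
          else \<phi> n \<in> haar_dictionary p \<and>
               (\<exists>F. norming_functional (Lp_cube p) (lp_norm p) (haar_poly p (U n) ?c) F \<and>
                    \<tau> * (SUP \<psi>\<in>haar_dictionary p. norm (F \<psi>)) \<le> norm (F (\<phi> n))) \<and>
               G (Suc n) \<in> lin_span (\<phi> ` {..n}) \<and>
               lp_norm p (haar_poly p (U (Suc n)) ?c) = dist_to (lp_norm p) (haar_poly p T ?c) (lin_span (\<phi> ` {..n}))"
    proof (cases "U n = {}")
      case True
      have "lp_norm p (haar_poly p {} ?c) = 0"
        using lp_norm_scale[OF p(1), of 0 "haar_poly p {} ?c"] by (simp add: haar_poly_def)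
      then show ?thesis using True by (simp add: G_def US)
    next
      case False
      define \<nu> where "\<nu> = lp_norm p (haar_poly p (U n) ?c)"
      have \<nu>: "0 < \<nu>" unfolding \<nu>_def using UT[of n] w by (intro lp_norm_haar_poly_pos p Ufin False) auto
      have s: "sel (U n) \<in> U n" "\<And>J. J \<in> U n \<Longrightarrow> weight p m (U n) w J \<le> weight p m (U n) w (sel (U n))"
        using sel[OF Ufin(1) False] by auto
      have sI: "sel (U n) \<in> multi_haar_indices" using s Ufin by auto
      define F :: "(real ^ 'n \<Rightarrow> 'k) \<Rightarrow> 'k" where "F g = (\<Sum>I\<in>U n. of_real (\<nu> powr (1 - p) * weight p m (U n) w I) * haar_coeff p I g)" for g
      have NF: "norming_functional (Lp_cube p) (lp_norm p) (haar_poly p (U n) ?c) F"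
        unfolding F_def[abs_def] using UT[of n] w \<nu> by (intro polynomial_norming_functional p Ufin) (auto simp: \<nu>_def)
      have wt: "0 \<le> weight p m (U n) w I" if "I \<in> U n" for I
        using w[of I] that UT[of n] by (auto simp: weight_def less_imp_le intro!: mult_nonneg_nonneg divide_nonneg_nonneg sum_nonneg)
      have FH: "norm (F (haar_fun p J)) = (if J \<in> U n then \<nu> powr (1 - p) * weight p m (U n) w J else 0)"
        if J: "J \<in> multi_haar_indices" for J
      proof -
        have "F (haar_fun p J) = (\<Sum>I\<in>U n. if I = J then of_real (\<nu> powr (1 - p) * weight p m (U n) w I) else 0)"
          unfolding F_def using Ufin[of n] J by (intro sum.cong refl) (auto simp: haar_coeff_haar_fun[OF p(1)] subsetD)
        then have "F (haar_fun p J) = (if J \<in> U n then of_real (\<nu> powr (1 - p) * weight p m (U n) w J) else 0)"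
          using Ufin[of n] by (simp add: sum.delta)
        then show ?thesis using wt[of J] by (simp add: norm_mult)
      qed
      have "(SUP \<psi>\<in>haar_dictionary p. norm (F \<psi>)) \<le> norm (F (\<phi> n))"
      proof (rule cSUP_least)
        show "(haar_dictionary p :: (real ^ 'n \<Rightarrow> 'k) set) \<noteq> {}" using sI by (auto simp: haar_dictionary_eq)
        fix \<psi> :: "real ^ 'n \<Rightarrow> 'k" assume "\<psi> \<in> haar_dictionary p"
        then obtain J where "\<psi> = haar_fun p J" "J \<in> multi_haar_indices" by (auto simp: haar_dictionary_eq)
        then show "norm (F \<psi>) \<le> norm (F (\<phi> n))"
          using s wt[OF s(1)] by (auto simp: \<phi>_def FH sI intro!: mult_left_mono)
      qed
      then have "\<tau> * (SUP \<psi>\<in>haar_dictionary p. norm (F \<psi>)) \<le> 1 * norm (F (\<phi> n))"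
        using \<tau> by (meson mult_left_mono mult_right_mono norm_ge_zero order_trans less_imp_le)
      then have sup: "\<tau> * (SUP \<psi>\<in>haar_dictionary p. norm (F \<psi>)) \<le> norm (F (\<phi> n))" by simp
      have img: "\<phi> ` {..n} = haar_fun p ` (T - U (Suc n))"
        unfolding chosen[OF False] image_image \<phi>_def ..
      have inj: "inj_on (haar_fun p :: _ \<Rightarrow> real ^ 'n \<Rightarrow> 'k) (T - U (Suc n))"
        by (rule inj_on_subset[OF haar_fun_inj[OF p(1)]]) (use T' in auto)
      have lin: "lincomb (\<phi> ` {..n}) a = haar_poly p (T - U (Suc n)) (\<lambda>I. a (haar_fun p I))" for a
        unfolding lincomb_def haar_poly_def img by (intro ext) (simp add: sum.reindex[OF inj])
      have Gspan: "G (Suc n) \<in> lin_span (\<phi> ` {..n})"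
      proof -
        have "lincomb (\<phi> ` {..n}) (\<lambda>b. ?c (inv_into (T - U (Suc n)) (haar_fun p) b)) = G (Suc n)"
          unfolding lin G_def haar_poly_def by (intro ext sum.cong refl) (simp add: inv_into_f_f[OF inj])
        then show ?thesis unfolding lin_span_eq by (metis rangeI)
      qed
      have "lp_norm p (haar_poly p (U (Suc n)) ?c) = dist_to (lp_norm p) (haar_poly p T ?c) (lin_span (\<phi> ` {..n}))"
        unfolding dist_to_def
      proof (rule antisym)
        show "(INF g\<in>lin_span (\<phi> ` {..n}). lp_norm p (\<lambda>x. haar_poly p T ?c x - g x)) \<le> lp_norm p (haar_poly p (U (Suc n)) ?c)"
          unfolding rem[symmetric] by (intro cINF_lower Gspan bdd_belowI2[where m = 0] lp_norm_nonneg)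
        show "lp_norm p (haar_poly p (U (Suc n)) ?c) \<le> (INF g\<in>lin_span (\<phi> ` {..n}). lp_norm p (\<lambda>x. haar_poly p T ?c x - g x))"
        proof (rule cINF_greatest)
          fix g assume "g \<in> lin_span (\<phi> ` {..n})"
          then obtain a where "g = lincomb (\<phi> ` {..n}) a" unfolding lin_span_eq by blast
          then have g: "g = haar_poly p (T - U (Suc n)) (\<lambda>I. a (haar_fun p I))" by (simp only: lin)
          \<comment> \<open>Subtracting \<open>g\<close> alters coefficients at chosen indices only,
            so the polynomial on \<open>U (Suc n)\<close> is a part of the difference and has no
            larger norm.\<close>
          let ?d = "\<lambda>I. if I \<in> U (Suc n) then ?c I else ?c I - a (haar_fun p I)"
          have "(\<lambda>x. haar_poly p T ?c x - g x) = haar_poly p T ?d"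
          proof
            fix x
            have "haar_poly p T ?c x = (\<Sum>I\<in>T - U (Suc n). ?c I * haar_fun p I x) + (\<Sum>I\<in>U (Suc n). ?c I * haar_fun p I x)"
              unfolding haar_poly_def by (rule sum.subset_diff[OF UT T'(1)])
            moreover have "haar_poly p T ?d x = (\<Sum>I\<in>T - U (Suc n). ?d I * haar_fun p I x) + (\<Sum>I\<in>U (Suc n). ?d I * haar_fun p I x)"
              unfolding haar_poly_def by (rule sum.subset_diff[OF UT T'(1)])
            ultimately show "haar_poly p T ?c x - g x = haar_poly p T ?d x"
              by (simp add: g haar_poly_def left_diff_distrib sum_subtractf)
          qed
          moreover have "haar_poly p (U (Suc n)) ?c = haar_poly p (U (Suc n)) ?d" by (simp add: haar_poly_def)
          moreover have "lp_norm p (haar_poly p (U (Suc n)) ?d) \<le> lp_norm p (haar_poly p T ?d)"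
            by (intro lp_norm_haar_poly_mono p T' UT)
          ultimately show "lp_norm p (haar_poly p (U (Suc n)) ?c) \<le> lp_norm p (\<lambda>x. haar_poly p T ?c x - g x)" by simp
        qed (use Gspan in auto)
      qed
      moreover have "\<phi> n \<in> haar_dictionary p" using sI by (simp add: \<phi>_def haar_dictionary_eq)
      ultimately show ?thesis using NF sup Gspan \<nu> by (auto simp: \<nu>_def)
    qed
  qed
  moreover have "\<exists>I\<in>U n. U (Suc n) = U n - {I} \<and> (\<forall>J\<in>U n. weight p m (U n) w J \<le> weight p m (U n) w I)"
    if "U n \<noteq> {}" for n
    using sel[OF Ufin(1) that] US by blast
  ultimately show ?thesis using rem U0 UT by blast
qed

text \<open>While an element of \<open>B\<close> is left it outweighs \<open>A\<close>, so all
  \<open>\<psi> N\<close> steps are spent on \<open>B\<close>. The sum over \<open>A\<close> is an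
  admissible competitor, and its error is the norm of the sum over \<open>B\<close>.\<close>

lemma lower_estimate_split:
  fixes A B :: "('n::finite \<Rightarrow> haar_index) set" and w :: "('n \<Rightarrow> haar_index) \<Rightarrow> real"
  assumes p: "1 < p" "p \<le> 2" and \<tau>: "0 < \<tau>" "\<tau> \<le> 1"
    and ineq: "wcga_lebesgue_ineq (Lp_cube p :: (real ^ 'n \<Rightarrow> 'k::{real_normed_field, euclidean_space}) set) (lp_norm p) (haar_dictionary p) \<tau> \<psi> C"
    and C: "0 < C" and N: "1 \<le> N" "card A \<le> N" "card B = \<psi> N"
    and AB: "A \<subseteq> MLam m" "B \<subseteq> MLam m" "A \<inter> B = {}" and w: "\<And>I. I \<in> A \<union> B \<Longrightarrow> 0 < w I"
    and first: "\<And>B' I J. B' \<subseteq> B \<Longrightarrow> I \<in> A \<Longrightarrow> J \<in> B' \<Longrightarrow> weight p m (A \<union> B') w I < weight p m (A \<union> B') w J"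
  shows "lp_norm p (haar_poly p A (\<lambda>I. of_real (w I)) :: real ^ 'n \<Rightarrow> 'k) \<le> C * lp_norm p (haar_poly p B (\<lambda>I. of_real (w I)) :: real ^ 'n \<Rightarrow> 'k)"
proof -
  let ?c = "\<lambda>I. of_real (w I) :: 'k" and ?T = "A \<union> B"
  have T: "?T \<subseteq> MLam m" using AB by simp
  have T': "finite ?T" "?T \<subseteq> multi_haar_indices"
    using finite_subset[OF T finite_MLam] T by (auto simp: multi_haar_indices_eq)
  obtain \<phi> G U where run: "wcga_run (Lp_cube p) (lp_norm p) (haar_dictionary p) \<tau> (haar_poly p ?T ?c) \<phi> G"
    and rem: "\<And>n. (\<lambda>x. haar_poly p ?T ?c x - G n x) = haar_poly p (U n) ?c" and U0: "U 0 = ?T" and UT: "\<And>n. U n \<subseteq> ?T"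
    and US: "\<And>n. U n \<noteq> {} \<Longrightarrow> \<exists>I\<in>U n. U (Suc n) = U n - {I} \<and> (\<forall>J\<in>U n. weight p m (U n) w J \<le> weight p m (U n) w I)"
    using greedy_run_exists[where w = w and ?'k = 'k, OF p \<tau> T w] by blast
  have "n \<le> card B \<Longrightarrow> \<exists>B'\<subseteq>B. U n = A \<union> B' \<and> card B' = card B - n" for n
  proof (induction n)
    case 0
    then show ?case using U0 by auto
  next
    case (Suc n)
    then obtain B' where B': "B' \<subseteq> B" "U n = A \<union> B'" "card B' = card B - n" by auto
    have finB': "finite B'" using B' T' finite_subset by blast
    have "B' \<noteq> {}" using B' Suc.prems by auto
    then obtain J where J: "J \<in> B'" by auto
    then obtain I where I: "I \<in> U n" "U (Suc n) = U n - {I}" "\<forall>J\<in>U n. weight p m (U n) w J \<le> weight p m (U n) w I"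
      using US[of n] B' by auto
    have "I \<notin> A"
    proof
      assume "I \<in> A"
      from first[OF B'(1) this J] have "weight p m (U n) w I < weight p m (U n) w J" by (simp only: B'(2))
      moreover have "J \<in> U n" using J B'(2) by simp
      ultimately show False using I(3) by (meson not_le)
    qed
    then have "I \<in> B'" using I B' by auto
    moreover have "U (Suc n) = A \<union> (B' - {I})" using I B' \<open>I \<notin> A\<close> by auto
    ultimately show ?case using B' finB' by (intro exI[of _ "B' - {I}"]) auto
  qed
  from this[of "card B"] N(3) have AU: "A \<subseteq> U (\<psi> N)" by auto
  have Ufin: "finite (U n)" "U n \<subseteq> multi_haar_indices" for n
    using UT[of n] T' finite_subset by auto
  have "lp_norm p (haar_poly p A ?c) \<le> lp_norm p (haar_poly p (U (\<psi> N)) ?c)"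
    by (intro lp_norm_haar_poly_mono p Ufin AU)
  also have "\<dots> \<le> C * best_error (lp_norm p) (haar_dictionary p) N (haar_poly p ?T ?c)"
    using ineq N(1) run haar_poly_in_Lp[OF T', of p ?c] p unfolding wcga_lebesgue_ineq_def rem[symmetric] by auto
  also have "\<dots> \<le> C * lp_norm p (haar_poly p B ?c)"
  proof (intro mult_left_mono)
    have finA: "finite A" "A \<subseteq> multi_haar_indices" using T' by auto
    have inj: "inj_on (haar_fun p :: _ \<Rightarrow> real ^ 'n \<Rightarrow> 'k) A" by (rule inj_on_subset[OF haar_fun_inj[OF p(1)] finA(2)])
    have "haar_poly p A ?c = lincomb (haar_fun p ` A) (\<lambda>b. ?c (inv_into A (haar_fun p) b))"
      unfolding lincomb_def haar_poly_def by (intro ext) (simp add: sum.reindex[OF inj] inv_into_f_f[OF inj])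
    then have "haar_poly p A ?c \<in> lin_span (haar_fun p ` A)" unfolding lin_span_eq by blast
    moreover have "(haar_fun p ` A :: (real ^ 'n \<Rightarrow> 'k) set) \<in> {B. B \<subseteq> haar_dictionary p \<and> finite B \<and> card B \<le> N}"
      using finA N(2) card_image[OF inj] by (auto simp: haar_dictionary_eq)
    ultimately have sp: "haar_poly p A ?c \<in> sparse (haar_dictionary p) N" unfolding sparse_def by blast
    have "best_error (lp_norm p) (haar_dictionary p) N (haar_poly p ?T ?c) \<le> lp_norm p (\<lambda>x. haar_poly p ?T ?c x - haar_poly p A ?c x)"
      unfolding best_error_def dist_to_def by (intro cINF_lower sp bdd_belowI2[where m = 0] lp_norm_nonneg)
    also have "?T - B = A" using AB by auto
    then have "(\<lambda>x. haar_poly p ?T ?c x - haar_poly p A ?c x) = haar_poly p B ?c"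
      using haar_poly_diff[OF T'(1), of B p ?c] by auto
    finally show "best_error (lp_norm p) (haar_dictionary p) N (haar_poly p ?T ?c) \<le> lp_norm p (haar_poly p B ?c)" .
  qed (use C in auto)
  finally show ?thesis .
qed

section \<open>The extremal configuration\<close>

lemma MH_abs:
  assumes "k \<in> grid m"
  shows "\<bar>MH p m I k\<bar> = (if \<forall>i. hv 1 m (I i) (k i) \<noteq> 0 then 2 powr (real (\<Sum>i\<in>UNIV. lev (I i)) / p) else 0)"
proof (cases "\<forall>i. hv 1 m (I i) (k i) \<noteq> 0")
  case True
  have "\<bar>MH p m I k\<bar> = (\<Prod>i\<in>UNIV. 2 powr (real (lev (I i)) / p))"
    unfolding MH_def abs_prod using assms True by (intro prod.cong refl) (simp add: hv_abs in_grid)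
  also have "\<dots> = 2 powr (\<Sum>i\<in>UNIV. real (lev (I i)) / p)" by (rule powr_sum[symmetric]) simp
  finally show ?thesis using True by (simp add: sum_divide_distrib)
next
  case False
  then obtain i where "hv 1 m (I i) (k i) = 0" by auto
  then have "hv p m (I i) (k i) = 0" using assms hv_abs[of "k i" m p "I i"] by (simp add: in_grid)
  then have "MH p m I k = 0" unfolding MH_def by (intro prod_zero) auto
  then show ?thesis using False by simp
qed

lemma hv_active:
  "hv 1 m (Some (j, r)) k \<noteq> 0 \<longleftrightarrow> real r \<le> 2 ^ j * (real k / 2 ^ m) \<and> 2 ^ j * (real k / 2 ^ m) < real r + 1"
proof -
  have "haar_mother (y - real r) \<noteq> 0 \<longleftrightarrow> real r \<le> y \<and> y < real r + 1" for y
    by (auto simp: haar_mother_if)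
  then show ?thesis by (simp add: hv_def)
qed

lemma MH_powr_sum:
  fixes I :: "'n::finite \<Rightarrow> haar_index"
  assumes p: "1 < p" and I: "I \<in> MLam m"
  shows "(\<Sum>k\<in>grid m. \<bar>MH p m I k\<bar> powr p) = 2 ^ (m * CARD('n))"
proof -
  have "(\<Sum>k\<in>grid m. \<bar>MH p m I k\<bar> powr p) = (\<Sum>k\<in>grid m. MH p m I k * MH (conj_exp p) m I k)"
    using p by (intro sum.cong refl MH_conj[OF conj_exp_sum[OF p], symmetric]) auto
  then show ?thesis using MH_biorthogonal[OF conj_exp_sum[OF p] I I] by (simp add: divide_simps split: if_splits)
qed

lemma powr_sum_le:
  fixes x :: "'a \<Rightarrow> real"
  assumes "0 < \<alpha>" "\<alpha> \<le> 1" "finite S" "\<And>i. i \<in> S \<Longrightarrow> 0 \<le> x i"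
  shows "(\<Sum>i\<in>S. x i) powr \<alpha> \<le> (\<Sum>i\<in>S. x i powr \<alpha>)"
  using assms(3,4)
proof (induction S rule: finite_induct)
  case (insert i S)
  have "(x i + sum x S) powr \<alpha> + 0 powr \<alpha> \<le> x i powr \<alpha> + sum x S powr \<alpha>"
    using insert assms(1,2) by (intro powr_sum_majorization) (auto intro: sum_nonneg)
  then show ?case using insert by force
qed (use assms in simp)

lemma half_grid_count:
  assumes "0 < m"
  shows "(\<Sum>k\<in>(grid m :: ('n::finite \<Rightarrow> nat) set). if 2 * k i0 < 2 ^ m then 1 else 0) = (2 ^ (m * CARD('n)) / 2 :: real)"
proof -
  obtain m' where m': "m = Suc m'" using assms gr0_conv_Suc by blast
  have "2 ^ m * (\<Sum>k\<in>(grid m :: ('n \<Rightarrow> nat) set). if 2 * k i0 < 2 ^ m then 1 else 0 :: real)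
    = (\<Sum>k\<in>(grid m :: ('n \<Rightarrow> nat) set). \<Sum>l<2 ^ m. if 2 * l < (2 ^ m :: nat) then 1 else 0)"
    using sum_grid_update[of "\<lambda>k. if 2 * k i0 < 2 ^ m then 1 else 0 :: real" i0 m] by simp
  also have "(\<Sum>l<2 ^ m. if 2 * l < (2 ^ m :: nat) then 1 else 0 :: real) = real (card ({..<2 ^ m} \<inter> {l. 2 * l < (2 ^ m :: nat)}))"
    by (simp add: sum.If_cases)
  also have "{..<2 ^ m} \<inter> {l. 2 * l < (2 ^ m :: nat)} = {..<2 ^ m'}" by (auto simp: m')
  finally have "2 ^ m * (\<Sum>k\<in>(grid m :: ('n \<Rightarrow> nat) set). if 2 * k i0 < 2 ^ m then 1 else 0 :: real)
    = 2 ^ m * (2 ^ (m * CARD('n)) / 2)"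
    by (simp add: card_grid m')
  then show ?thesis by simp
qed

text \<open>\<open>A\<close> consists of all boxes of volume \<open>2\<^sup>-\<^sup>R\<^sup>-\<^sup>1\<close> in the half cube \<open>x i0 < 1/2\<close> whose levels in the other
  coordinates are below \<open>mm\<close>; \<open>L\<close> of them overlap everywhere, which makes their norm small.  \<open>B\<close>
  consists of \<open>M\<close> disjoint boxes in the other half.  The coefficient \<open>b\<close> on \<open>B\<close> is just large enough for
  the norming functional to prefer \<open>B\<close> to \<open>A\<close>.\<close>

locale extremal =
  fixes i0 :: "'n::finite" and mm R M :: nat
  assumes mm: "1 \<le> mm" and R: "(CARD('n) - 1) * (mm - 1) \<le> R"
begin

text \<open>The level along \<open>i0\<close> is what the others leave of \<open>R\<close>; the
  assumption on \<open>R\<close> keeps the natural subtraction from truncating.\<close>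

definition lv :: "('n \<Rightarrow> nat) \<Rightarrow> 'n \<Rightarrow> nat" where
  "lv j i = (if i = i0 then R - (\<Sum>s\<in>UNIV - {i0}. j s) else j i)"

text \<open>The extra level along \<open>i0\<close>, with positions still below
  \<open>2 ^ lv j i0\<close>, confines the box to the left half.\<close>

definition rect :: "('n \<Rightarrow> nat) \<Rightarrow> ('n \<Rightarrow> nat) \<Rightarrow> 'n \<Rightarrow> haar_index" where
  "rect j r = (\<lambda>i. Some (if i = i0 then Suc (lv j i) else lv j i, r i))"

definition Js :: "('n \<Rightarrow> nat) set" where "Js = PiE (UNIV - {i0}) (\<lambda>_. {..<mm})"

definition A :: "('n \<Rightarrow> haar_index) set" where
  "A = (\<lambda>(j, r). rect j r) ` (SIGMA j:Js. PiE UNIV (\<lambda>i. {..<2 ^ lv j i}))"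

text \<open>Position \<open>2 ^ M\<close> at level \<open>Suc M\<close> is the midpoint; there is
  room for the boxes because \<open>M < 2 ^ M\<close>.\<close>

definition B :: "('n \<Rightarrow> haar_index) set" where
  "B = (\<lambda>l i. if i = i0 then Some (Suc M, 2 ^ M + l) else None) ` {..<M}"

definition m where "m = R + M + 2"

definition L where "L = real mm ^ (CARD('n) - 1)"

lemma L_ge_1: "1 \<le> L" using mm by (simp add: L_def)

lemma card_Js: "card Js = mm ^ (CARD('n) - 1)" and finite_Js: "finite Js"
  by (simp_all add: Js_def card_PiE finite_PiE)

lemma sum_lv:
  assumes "j \<in> Js" shows "(\<Sum>i\<in>UNIV. lv j i) = R" "(\<Sum>s\<in>UNIV - {i0}. j s) \<le> R" "lv j i \<le> R"
proof -
  have "(\<Sum>s\<in>UNIV - {i0}. j s) \<le> (\<Sum>s\<in>UNIV - {i0}. mm - 1)"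
  proof (intro sum_mono)
    fix s assume "s \<in> UNIV - {i0}"
    from PiE_mem[OF assms[unfolded Js_def] this] show "j s \<le> mm - 1" by simp
  qed
  also have "\<dots> \<le> R" using R by simp
  finally show le: "(\<Sum>s\<in>UNIV - {i0}. j s) \<le> R" .
  have "(\<Sum>i\<in>UNIV. lv j i) = lv j i0 + (\<Sum>i\<in>UNIV - {i0}. lv j i)" by (rule sum.remove) auto
  also have "(\<Sum>i\<in>UNIV - {i0}. lv j i) = (\<Sum>s\<in>UNIV - {i0}. j s)" by (intro sum.cong) (auto simp: lv_def)
  finally show sum: "(\<Sum>i\<in>UNIV. lv j i) = R" using le by (simp add: lv_def)
  have "lv j i \<le> (\<Sum>i\<in>UNIV. lv j i)" by (intro member_le_sum) auto
  then show "lv j i \<le> R" by (simp only: sum)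
qed

lemma card_A: "card A \<le> 2 ^ R * mm ^ (CARD('n) - 1)"
proof -
  have "card A \<le> card (SIGMA j:Js. PiE (UNIV :: 'n set) (\<lambda>i. {..<2 ^ lv j i :: nat}))"
    unfolding A_def using finite_Js by (intro card_image_le finite_SigmaI finite_PiE) auto
  also have "\<dots> = (\<Sum>j\<in>Js. \<Prod>i\<in>UNIV. 2 ^ lv j i)"
    using finite_Js by (subst card_SigmaI) (auto simp: card_PiE finite_PiE)
  also have "\<dots> = (\<Sum>j\<in>Js. 2 ^ R)"
    by (intro sum.cong refl) (simp add: power_sum[symmetric] sum_lv)
  finally show ?thesis by (simp add: card_Js mult.commute)
qed

lemma A_D:
  assumes "I \<in> A"
  shows "\<exists>j r. j \<in> Js \<and> (\<forall>i. r i < 2 ^ lv j i) \<and> I = rect j r"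
  using assms unfolding A_def by (auto simp: PiE_iff)

lemma lev_A:
  assumes "I \<in> A" shows "(\<Sum>i\<in>UNIV. lev (I i)) = Suc R"
proof -
  obtain j r where j: "j \<in> Js" "I = rect j r" using A_D[OF assms] by blast
  have "(\<Sum>i\<in>UNIV. lev (I i)) = lev (I i0) + (\<Sum>i\<in>UNIV - {i0}. lev (I i))" by (rule sum.remove) auto
  also have "\<dots> = Suc (lv j i0 + (\<Sum>i\<in>UNIV - {i0}. lv j i))" by (simp add: j rect_def)
  also have "lv j i0 + (\<Sum>i\<in>UNIV - {i0}. lv j i) = (\<Sum>i\<in>UNIV. lv j i)" by (rule sum.remove[symmetric]) auto
  finally show ?thesis by (simp add: sum_lv j)
qed

lemma A_sub: "A \<subseteq> MLam m"
proof
  fix I assume "I \<in> A"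
  from A_D[OF this] obtain j r where j: "j \<in> Js" "\<And>i. r i < 2 ^ lv j i" "I = rect j r" by blast
  have "I i \<in> Lam m" for i
    using sum_lv(3)[OF j(1), of i] j(2)[of i] by (auto simp: j(3) rect_def Lam_def m_def)
  then show "I \<in> MLam m" by (simp add: in_MLam)
qed

lemma B_sub: "B \<subseteq> MLam m"
proof
  fix I assume "I \<in> B"
  then obtain l where l: "l < M" "I = (\<lambda>i. if i = i0 then Some (Suc M, 2 ^ M + l) else None)"
    by (auto simp: B_def)
  have "l < 2 ^ M" using l(1) less_exp[of M] by (rule less_trans)
  then show "I \<in> MLam m" using l by (auto simp: in_MLam Lam_def m_def)
qed

lemma card_B: "card B = M"
proof -
  have "inj_on (\<lambda>l i. if i = i0 then Some (Suc M, 2 ^ M + l) else None :: haar_index) {..<M}"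
    by (intro inj_onI) (auto dest: fun_cong[of _ _ i0])
  then show ?thesis by (simp add: B_def card_image)
qed

lemma AB_disjoint: "A \<inter> B = {}"
proof -
  have False if I: "I \<in> A" "I \<in> B" for I
  proof -
    obtain j r where j: "\<And>i. r i < 2 ^ lv j i" "I = rect j r" using A_D[OF I(1)] by blast
    obtain l where "I i0 = Some (Suc M, 2 ^ M + l)" using I(2) by (auto simp: B_def)
    then have "lv j i0 = M" "r i0 = 2 ^ M + l" by (auto simp: j(2) rect_def)
    then show False using j(1)[of i0] by simp
  qed
  then show ?thesis by blast
qed

lemma A_support:
  assumes "I \<in> A" "MH p m I k \<noteq> 0"
  shows "2 * k i0 < 2 ^ m"
proof -
  obtain j r where j: "\<And>i. r i < 2 ^ lv j i" "I = rect j r" using A_D[OF assms(1)] by blast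
  have "hv p m (I i0) (k i0) \<noteq> 0" using assms(2) by (auto simp: MH_def)
  then have "hv 1 m (Some (Suc (lv j i0), r i0)) (k i0) \<noteq> 0" by (simp add: j(2) rect_def hv_def)
  then have "2 ^ Suc (lv j i0) * (real (k i0) / 2 ^ m) < real (r i0) + 1" by (simp add: hv_active)
  also have "\<dots> \<le> 2 ^ lv j i0"
  proof -
    have "Suc (r i0) \<le> 2 ^ lv j i0" using j(1)[of i0] by simp
    then have "real (Suc (r i0)) \<le> 2 ^ lv j i0" by (metis of_nat_le_iff of_nat_numeral of_nat_power)
    then show ?thesis by simp
  qed
  also have "2 ^ Suc (lv j i0) * (real (k i0) / 2 ^ m) = 2 ^ lv j i0 * (2 * real (k i0) / 2 ^ m)" by (simp add: mult_ac)
  finally have "2 ^ lv j i0 * (2 * real (k i0) / 2 ^ m) < 2 ^ lv j i0 * 1" by (simp only: mult_1_right)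
  then have "2 * real (k i0) / 2 ^ m < 1" by (rule mult_left_less_imp_less) simp
  then have "real (2 * k i0) < real (2 ^ m)" by simp
  then show ?thesis by (simp only: of_nat_less_iff)
qed

lemma B_support:
  assumes "J \<in> B" "MH p m J k \<noteq> 0"
  shows "2 ^ m \<le> 2 * k i0" "J = (\<lambda>i. if i = i0 then Some (Suc M, nat \<lfloor>2 ^ Suc M * (real (k i0) / 2 ^ m)\<rfloor>) else None)"
proof -
  obtain l where l: "J = (\<lambda>i. if i = i0 then Some (Suc M, 2 ^ M + l) else None)"
    using assms(1) by (auto simp: B_def)
  have "hv p m (J i0) (k i0) \<noteq> 0" using assms(2) by (auto simp: MH_def)
  then have "hv 1 m (Some (Suc M, 2 ^ M + l)) (k i0) \<noteq> 0" by (simp add: l hv_def)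
  then have act: "real (2 ^ M + l) \<le> 2 ^ Suc M * (real (k i0) / 2 ^ m)" "2 ^ Suc M * (real (k i0) / 2 ^ m) < real (2 ^ M + l) + 1"
    unfolding hv_active by blast+
  have eq: "2 ^ Suc M * (real (k i0) / 2 ^ m) = 2 ^ M * (2 * real (k i0) / 2 ^ m)" by (simp add: mult_ac)
  have "2 ^ M * 1 \<le> real (2 ^ M + l)" by simp
  also have "\<dots> \<le> 2 ^ M * (2 * real (k i0) / 2 ^ m)" using act(1) unfolding eq .
  finally have "2 ^ M * 1 \<le> 2 ^ M * (2 * real (k i0) / 2 ^ m)" .
  then have "1 \<le> 2 * real (k i0) / 2 ^ m" by (rule mult_left_le_imp_le) simp
  then have "real (2 ^ m) \<le> real (2 * k i0)" by (simp add: divide_simps)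
  then show "2 ^ m \<le> 2 * k i0" by (simp only: of_nat_le_iff)
  have "\<lfloor>2 ^ Suc M * (real (k i0) / 2 ^ m)\<rfloor> = int (2 ^ M + l)"
    using act by (intro floor_unique) auto
  then have "nat \<lfloor>2 ^ Suc M * (real (k i0) / 2 ^ m)\<rfloor> = 2 ^ M + l" by (simp only: nat_int)
  then show "J = (\<lambda>i. if i = i0 then Some (Suc M, nat \<lfloor>2 ^ Suc M * (real (k i0) / 2 ^ m)\<rfloor>) else None)"
    by (simp only: l)
qed

definition y where "y p = 2 powr (real (Suc R) / p)"

lemma y_pos: "0 < y p" by (simp add: y_def)

lemma A_value:
  assumes "I \<in> A" "k \<in> grid m" "MH p m I k \<noteq> 0" shows "\<bar>MH p m I k\<bar> = y p"
  using MH_abs[OF assms(2), of p I] assms(3) by (simp add: y_def lev_A[OF assms(1)] split: if_splits)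

text \<open>Each level vector contributes the box around the point, located by floors of the scaled
  coordinates; distinct vectors give distinct boxes, all of modulus \<open>y p\<close>.\<close>

lemma A_dense:
  assumes k: "k \<in> grid m" and half: "2 * k i0 < 2 ^ m"
  shows "L * (y p)\<^sup>2 \<le> (\<Sum>I\<in>A. (MH p m I k)\<^sup>2)"
proof -
  define lx where "lx j i = (if i = i0 then Suc (lv j i) else lv j i)" for j i
  define Ik where "Ik j = rect j (\<lambda>i. nat \<lfloor>2 ^ lx j i * (real (k i) / 2 ^ m)\<rfloor>)" for j
  have r: "nat \<lfloor>2 ^ lx j i * (real (k i) / 2 ^ m)\<rfloor> < 2 ^ lv j i" for j i
  proof -
    have "2 ^ lx j i * (real (k i) / 2 ^ m) < 2 ^ lv j i"
    proof (cases "i = i0")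
      case True
      have "real (2 * k i0) < real (2 ^ m)" using half by (simp only: of_nat_less_iff)
      then have "2 ^ lv j i * (2 * real (k i0) / 2 ^ m) < 2 ^ lv j i * 1" by (intro mult_strict_left_mono) auto
      then show ?thesis using True by (simp add: lx_def mult_ac)
    next
      case False
      have "real (k i) < real (2 ^ m)" using k by (simp only: of_nat_less_iff in_grid)
      then have "2 ^ lv j i * (real (k i) / 2 ^ m) < 2 ^ lv j i * 1" by (intro mult_strict_left_mono) auto
      then show ?thesis using False by (simp add: lx_def)
    qed
    then have "\<lfloor>2 ^ lx j i * (real (k i) / 2 ^ m)\<rfloor> < 2 ^ lv j i" by (simp add: floor_less_iff)
    then show ?thesis by (simp add: nat_less_iff)
  qed
  have IkA: "Ik j \<in> A" if "j \<in> Js" for j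
    unfolding A_def Ik_def using that r by (intro image_eqI[of _ _ "(j, \<lambda>i. nat \<lfloor>2 ^ lx j i * (real (k i) / 2 ^ m)\<rfloor>)"]) auto
  have act: "MH p m (Ik j) k \<noteq> 0" if j: "j \<in> Js" for j
  proof -
    have "hv 1 m (Ik j i) (k i) \<noteq> 0" for i
    proof -
      have fl: "real (nat \<lfloor>t\<rfloor>) \<le> t \<and> t < real (nat \<lfloor>t\<rfloor>) + 1" if "0 \<le> t" for t :: real
        using that by (simp add: of_nat_nat)
      have "0 \<le> 2 ^ lx j i * (real (k i) / 2 ^ m)" by simp
      from fl[OF this] have "real (nat \<lfloor>2 ^ lx j i * (real (k i) / 2 ^ m)\<rfloor>) \<le> 2 ^ lx j i * (real (k i) / 2 ^ m)"
        "2 ^ lx j i * (real (k i) / 2 ^ m) < real (nat \<lfloor>2 ^ lx j i * (real (k i) / 2 ^ m)\<rfloor>) + 1"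
        by blast+
      moreover have "Ik j i = Some (lx j i, nat \<lfloor>2 ^ lx j i * (real (k i) / 2 ^ m)\<rfloor>)"
        by (simp add: Ik_def rect_def lx_def)
      ultimately show ?thesis by (simp only: hv_active)
    qed
    then have "\<bar>MH p m (Ik j) k\<bar> = y p"
      using MH_abs[OF k, of p "Ik j"] by (simp add: y_def lev_A[OF IkA[OF j]])
    then show ?thesis using y_pos[of p] by auto
  qed
  have inj: "inj_on Ik Js"
  proof (rule inj_onI)
    fix j j' assume jj: "j \<in> Js" "j' \<in> Js" "Ik j = Ik j'"
    show "j = j'"
    proof (rule PiE_ext[OF jj(1,2)[unfolded Js_def]])
      fix i assume "i \<in> UNIV - {i0}"
      then show "j i = j' i" using fun_cong[OF jj(3), of i] by (simp add: Ik_def rect_def lv_def)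
    qed
  qed
  have finA: "finite A" using A_sub finite_MLam finite_subset by blast
  have "L * (y p)\<^sup>2 = (\<Sum>j\<in>Js. (y p)\<^sup>2)" by (simp add: L_def card_Js)
  also have "\<dots> = (\<Sum>j\<in>Js. (MH p m (Ik j) k)\<^sup>2)"
  proof (intro sum.cong refl)
    fix j assume j: "j \<in> Js"
    have "(y p)\<^sup>2 = \<bar>MH p m (Ik j) k\<bar>\<^sup>2" by (simp only: A_value[OF IkA[OF j] k act[OF j]])
    then show "(y p)\<^sup>2 = (MH p m (Ik j) k)\<^sup>2" by simp
  qed
  also have "\<dots> = (\<Sum>I\<in>Ik ` Js. (MH p m I k)\<^sup>2)" by (simp add: sum.reindex[OF inj])
  also have "\<dots> \<le> (\<Sum>I\<in>A. (MH p m I k)\<^sup>2)" using IkA finA by (intro sum_mono2) auto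
  finally show ?thesis .
qed

text \<open>The weight of an element of \<open>B\<close> works out to
  \<open>b p powr (p - 1)\<close>; the factor 2 makes the preference over \<open>A\<close>
  strict.\<close>

definition b where "b p = (2 * L powr ((p - 2) / 2)) powr (1 / (p - 1))"

definition w where "w p I = (if I \<in> B then b p else 1)"

lemma b_pos: "0 < b p" using L_ge_1 by (simp add: b_def)

text \<open>On the support of \<open>I\<close> the squared square function is at least
  \<open>L * (y p)\<^sup>2\<close>, and its exponent \<open>(p - 2) / 2\<close> is nonpositive, so
  overlap lowers the weight; the terms of \<open>B'\<close> cannot raise it.\<close>

lemma weight_A:
  assumes p: "1 < p" "p \<le> 2" and B': "B' \<subseteq> B" and I: "I \<in> A"
  shows "weight p m (A \<union> B') (w p) I \<le> L powr ((p - 2) / 2)"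
proof -
  let ?M = "2 ^ (m * CARD('n)) :: real"
  have wI: "w p I = 1" using I AB_disjoint by (auto simp: w_def)
  have fin: "finite (A \<union> B')" using A_sub B_sub B' finite_MLam by (meson finite_Un finite_subset)
  have "(\<Sum>k\<in>grid m. grid_square p m (A \<union> B') (w p) k powr ((p - 2) / 2) * (MH p m I k)\<^sup>2)
     \<le> (\<Sum>k\<in>grid m. L powr ((p - 2) / 2) * \<bar>MH p m I k\<bar> powr p)"
  proof (intro sum_mono)
    fix k :: "'n \<Rightarrow> nat" assume k: "k \<in> grid m"
    show "grid_square p m (A \<union> B') (w p) k powr ((p - 2) / 2) * (MH p m I k)\<^sup>2 \<le> L powr ((p - 2) / 2) * \<bar>MH p m I k\<bar> powr p"
    proof (cases "MH p m I k = 0")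
      case False
      have v: "\<bar>MH p m I k\<bar> = y p" by (rule A_value[OF I k False])
      have "L * (y p)\<^sup>2 \<le> (\<Sum>I\<in>A. (MH p m I k)\<^sup>2)" by (rule A_dense[OF k A_support[OF I False]])
      also have "\<dots> = (\<Sum>I\<in>A. (w p I * \<bar>MH p m I k\<bar>)\<^sup>2)"
        using AB_disjoint by (intro sum.cong refl) (auto simp: w_def)
      also have "\<dots> \<le> grid_square p m (A \<union> B') (w p) k"
        unfolding grid_square_def using fin by (intro sum_mono2) auto
      finally have "grid_square p m (A \<union> B') (w p) k powr ((p - 2) / 2) \<le> (L * (y p)\<^sup>2) powr ((p - 2) / 2)"
        using p L_ge_1 y_pos[of p] by (intro powr_mono2') auto
      also have "\<dots> = L powr ((p - 2) / 2) * y p powr (p - 2)"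
      proof -
        have "((y p)\<^sup>2) powr ((p - 2) / 2) = y p powr (p - 2)"
          unfolding square_powr_half using y_pos[of p] by simp
        then show ?thesis by (simp add: powr_mult)
      qed
      finally have "grid_square p m (A \<union> B') (w p) k powr ((p - 2) / 2) * (y p)\<^sup>2 \<le> L powr ((p - 2) / 2) * y p powr (p - 2) * (y p)\<^sup>2"
        by (intro mult_right_mono) auto
      also have "y p powr (p - 2) * (y p)\<^sup>2 = y p powr p"
        using y_pos[of p] by (simp add: powr_diff)
      then have "L powr ((p - 2) / 2) * y p powr (p - 2) * (y p)\<^sup>2 = L powr ((p - 2) / 2) * y p powr p"
        by (simp only: mult.assoc)
      finally have "grid_square p m (A \<union> B') (w p) k powr ((p - 2) / 2) * \<bar>MH p m I k\<bar>\<^sup>2 \<le> L powr ((p - 2) / 2) * \<bar>MH p m I k\<bar> powr p"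
        unfolding v .
      then show ?thesis by simp
    qed simp
  qed
  also have "\<dots> = L powr ((p - 2) / 2) * ?M"
    unfolding sum_distrib_left[symmetric] using A_sub I by (simp add: MH_powr_sum[OF p(1)] subsetD)
  finally show ?thesis by (simp add: weight_def wI divide_simps)
qed

text \<open>On the support of \<open>J\<close> no other function of \<open>A\<close> or
  \<open>B\<close> is active, so the weight is the same whichever part \<open>B'\<close> is still
  present.\<close>

lemma weight_B:
  assumes p: "1 < p" and B': "B' \<subseteq> B" and J: "J \<in> B'"
  shows "weight p m (A \<union> B') (w p) J = 2 * L powr ((p - 2) / 2)"
proof -
  let ?M = "2 ^ (m * CARD('n)) :: real"
  have wJ: "w p J = b p" using J B' by (auto simp: w_def)
  have fin: "finite (A \<union> B')" using A_sub B_sub B' finite_MLam by (meson finite_Un finite_subset)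
  have "(\<Sum>k\<in>grid m. grid_square p m (A \<union> B') (w p) k powr ((p - 2) / 2) * (MH p m J k)\<^sup>2)
     = (\<Sum>k\<in>grid m. b p powr (p - 2) * \<bar>MH p m J k\<bar> powr p)"
  proof (intro sum.cong refl)
    fix k :: "'n \<Rightarrow> nat" assume k: "k \<in> grid m"
    show "grid_square p m (A \<union> B') (w p) k powr ((p - 2) / 2) * (MH p m J k)\<^sup>2 = b p powr (p - 2) * \<bar>MH p m J k\<bar> powr p"
    proof (cases "MH p m J k = 0")
      case False
      let ?v = "\<bar>MH p m J k\<bar>"
      have v: "0 < ?v" using False by simp
      have JB: "J \<in> B" using J B' by auto
      have zero: "MH p m I k = 0" if "I \<in> A \<union> B'" "I \<noteq> J" for I
      proof (rule ccontr)
        assume nz: "MH p m I k \<noteq> 0"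
        show False
        proof (cases "I \<in> A")
          case True
          then show False using A_support[OF True nz] B_support(1)[OF JB False] by simp
        next
          case notA: False
          then have "I \<in> B" using that B' by auto
          then show False using that B_support(2)[OF _ nz] B_support(2)[OF JB False] by simp
        qed
      qed
      have "grid_square p m (A \<union> B') (w p) k = (\<Sum>I\<in>{J}. (w p I * \<bar>MH p m I k\<bar>)\<^sup>2)"
        unfolding grid_square_def using fin J by (intro sum.mono_neutral_right) (auto simp: zero)
      then have "grid_square p m (A \<union> B') (w p) k = (b p * ?v)\<^sup>2" by (simp add: wJ)
      moreover have "\<bar>b p * ?v\<bar> = b p * ?v" using b_pos[of p] by simp
      ultimately have "grid_square p m (A \<union> B') (w p) k powr ((p - 2) / 2) = (b p * ?v) powr (p - 2)"
        by (simp only: square_powr_half)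
      also have "\<dots> = b p powr (p - 2) * ?v powr (p - 2)" by (simp add: powr_mult)
      finally have "grid_square p m (A \<union> B') (w p) k powr ((p - 2) / 2) * ?v\<^sup>2 = b p powr (p - 2) * (?v powr (p - 2) * ?v\<^sup>2)"
        by (simp only: mult.assoc)
      also have "?v powr (p - 2) * ?v\<^sup>2 = ?v powr p" using v by (simp add: powr_diff)
      finally show ?thesis by simp
    qed simp
  qed
  also have "\<dots> = b p powr (p - 2) * ?M"
    unfolding sum_distrib_left[symmetric] using B_sub B' J by (simp add: MH_powr_sum[OF p] subsetD)
  finally have "weight p m (A \<union> B') (w p) J = b p powr (p - 2) * b p"
    by (simp add: weight_def wJ mult.commute)
  also have "\<dots> = b p powr (p - 2) * b p powr 1" using b_pos[of p] by simp
  also have "\<dots> = b p powr (p - 1)" unfolding powr_add[symmetric] by simp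
  also have "\<dots> = 2 * L powr ((p - 2) / 2)" unfolding b_def using p by (simp add: powr_powr)
  finally show ?thesis .
qed

text \<open>The half cube has measure \<open>1 / 2\<close> and
  \<open>y p powr p = 2 ^ Suc R\<close>, which leaves \<open>2 ^ R\<close>.\<close>

lemma norm_A:
  assumes p: "1 < p"
  shows "L powr (p / 2) * 2 ^ R \<le> lp_norm p (haar_poly p A (\<lambda>I. of_real (w p I)) :: real ^ 'n \<Rightarrow> 'k::{real_normed_field, euclidean_space}) powr p"
proof -
  let ?M = "2 ^ (m * CARD('n)) :: real" and ?H = "\<lambda>k. if 2 * k i0 < 2 ^ m then 1 else 0 :: real"
  have "(L * (y p)\<^sup>2) powr (p / 2) = L powr (p / 2) * y p powr p"
  proof -
    have "((y p)\<^sup>2) powr (p / 2) = y p powr p"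
      unfolding square_powr_half using y_pos[of p] by simp
    then show ?thesis by (simp add: powr_mult)
  qed
  also have "y p powr p = 2 ^ Suc R" using p by (simp add: y_def powr_powr powr_realpow[symmetric] del: power_Suc of_nat_Suc)
  finally have Ly: "(L * (y p)\<^sup>2) powr (p / 2) = L powr (p / 2) * 2 ^ Suc R" .
  have "L powr (p / 2) * 2 ^ R = (\<Sum>k\<in>(grid m :: ('n \<Rightarrow> nat) set). (L * (y p)\<^sup>2) powr (p / 2) * ?H k) / ?M"
    unfolding sum_distrib_left[symmetric] Ly by (subst half_grid_count) (auto simp: m_def)
  also have "\<dots> \<le> (\<Sum>k\<in>grid m. (\<Sum>I\<in>A. (norm (of_real (w p I) :: 'k) * \<bar>MH p m I k\<bar>)\<^sup>2) powr (p / 2)) / ?M"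
  proof (intro divide_right_mono sum_mono)
    fix k :: "'n \<Rightarrow> nat" assume k: "k \<in> grid m"
    have "(\<Sum>I\<in>A. (norm (of_real (w p I) :: 'k) * \<bar>MH p m I k\<bar>)\<^sup>2) = (\<Sum>I\<in>A. (MH p m I k)\<^sup>2)"
      using AB_disjoint by (intro sum.cong refl) (auto simp: w_def)
    then show "(L * (y p)\<^sup>2) powr (p / 2) * ?H k \<le> (\<Sum>I\<in>A. (norm (of_real (w p I) :: 'k) * \<bar>MH p m I k\<bar>)\<^sup>2) powr (p / 2)"
      using A_dense[OF k, of p] p L_ge_1 by (auto intro!: powr_mono2)
  qed simp
  also have "\<dots> = lp_norm p (haar_poly p A (\<lambda>I. of_real (w p I)) :: real ^ 'n \<Rightarrow> 'k) powr p"
    by (rule lp_norm_haar_poly[OF p A_sub, symmetric])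
  finally show ?thesis .
qed

lemma norm_B:
  assumes p: "1 < p" "p \<le> 2"
  shows "lp_norm p (haar_poly p B (\<lambda>I. of_real (w p I)) :: real ^ 'n \<Rightarrow> 'k::{real_normed_field, euclidean_space}) powr p \<le> b p powr p * real M"
proof -
  let ?M = "2 ^ (m * CARD('n)) :: real"
  have finB: "finite B" using B_sub finite_MLam finite_subset by blast
  have "lp_norm p (haar_poly p B (\<lambda>I. of_real (w p I)) :: real ^ 'n \<Rightarrow> 'k) powr p
    = (\<Sum>k\<in>grid m. (\<Sum>I\<in>B. (norm (of_real (w p I) :: 'k) * \<bar>MH p m I k\<bar>)\<^sup>2) powr (p / 2)) / ?M"
    by (rule lp_norm_haar_poly[OF p(1) B_sub])
  also have "\<dots> \<le> (\<Sum>k\<in>grid m. \<Sum>I\<in>B. ((norm (of_real (w p I) :: 'k) * \<bar>MH p m I k\<bar>)\<^sup>2) powr (p / 2)) / ?M"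
    using p finB by (intro divide_right_mono sum_mono powr_sum_le) auto
  also have "(\<Sum>k\<in>grid m. \<Sum>I\<in>B. ((norm (of_real (w p I) :: 'k) * \<bar>MH p m I k\<bar>)\<^sup>2) powr (p / 2))
    = (\<Sum>k\<in>grid m. \<Sum>I\<in>B. b p powr p * \<bar>MH p m I k\<bar> powr p)"
  proof (intro sum.cong refl)
    fix k I assume I: "I \<in> B"
    let ?x = "b p * \<bar>MH p m I k\<bar>"
    have x: "0 \<le> ?x" using b_pos[of p] by simp
    then have "(?x\<^sup>2) powr (p / 2) = ?x powr p" unfolding square_powr_half by simp
    then show "((norm (of_real (w p I) :: 'k) * \<bar>MH p m I k\<bar>)\<^sup>2) powr (p / 2) = b p powr p * \<bar>MH p m I k\<bar> powr p"
      using I b_pos[of p] by (simp add: w_def powr_mult)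
  qed
  also have "\<dots> = (\<Sum>I\<in>B. b p powr p * (\<Sum>k\<in>grid m. \<bar>MH p m I k\<bar> powr p))"
    by (subst sum.swap) (simp add: sum_distrib_left)
  also have "\<dots> = (\<Sum>I\<in>B. b p powr p * ?M)"
    using B_sub by (intro sum.cong refl) (simp add: MH_powr_sum[OF p(1)] subsetD)
  finally show ?thesis by (simp add: card_B mult_ac)
qed

end

section \<open>The lower estimate\<close>

lemma lower_estimate_count:
  assumes p: "1 < p" "p \<le> 2" and \<tau>: "0 < \<tau>" "\<tau> \<le> 1"
    and ineq: "wcga_lebesgue_ineq (Lp_cube p :: (real ^ 'n::finite \<Rightarrow> 'k::{real_normed_field, euclidean_space}) set) (lp_norm p) (haar_dictionary p) \<tau> \<psi> C"
    and C: "0 < C" and N: "1 \<le> N" and mm: "1 \<le> mm" and R: "(CARD('n) - 1) * (mm - 1) \<le> R"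
    and RN: "2 ^ R * mm ^ (CARD('n) - 1) \<le> N" and L: "L = real mm ^ (CARD('n) - 1)"
  shows "L powr (p / 2) * 2 ^ R \<le> C powr p * (((2 * L powr ((p - 2) / 2)) powr (1 / (p - 1))) powr p * real (\<psi> N))"
proof -
  obtain i0 :: 'n where True by blast
  interpret E: extremal i0 mm R "\<psi> N" by unfold_locales (rule mm R)+
  have EL: "E.L = L" by (simp add: E.L_def L)
  let ?w = "\<lambda>I. of_real (E.w p I) :: 'k"
  have wpos: "0 < E.w p I" for I by (simp add: E.w_def E.b_pos)
  have Lp: "0 < E.L powr ((p - 2) / 2)" using E.L_ge_1 by simp
  have "lp_norm p (haar_poly p E.A ?w) \<le> C * lp_norm p (haar_poly p E.B ?w)"
  proof (rule lower_estimate_split[OF p \<tau> ineq C N _ E.card_B E.A_sub E.B_sub E.AB_disjoint wpos])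
    show "card E.A \<le> N" using E.card_A RN by simp
    show "weight p E.m (E.A \<union> B') (E.w p) I < weight p E.m (E.A \<union> B') (E.w p) J"
      if "B' \<subseteq> E.B" "I \<in> E.A" "J \<in> B'" for B' I J
      using E.weight_A[OF p that(1,2)] E.weight_B[OF p(1) that(1,3)] Lp by linarith
  qed
  then have "lp_norm p (haar_poly p E.A ?w) powr p \<le> (C * lp_norm p (haar_poly p E.B ?w)) powr p"
    using p by (intro powr_mono2) (auto simp: lp_norm_nonneg)
  also have "\<dots> = C powr p * lp_norm p (haar_poly p E.B ?w) powr p"
    using C by (simp add: powr_mult)
  also have "\<dots> \<le> C powr p * (E.b p powr p * real (\<psi> N))"
    by (intro mult_left_mono E.norm_B p) auto
  finally show ?thesis using E.norm_A[OF p(1), where ?'k = 'k] by (simp add: EL E.b_def)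
qed

text \<open>\<open>n = mm - 1\<close> takes a share \<open>1 / (2 * d)\<close> of
  \<open>log 2 N\<close>. Since \<open>mm \<le> 2 ^ n\<close>, the product
  \<open>2 ^ ((d - 1) * n) * mm ^ (d - 1)\<close> is at most \<open>N\<close>, so the largest
  admissible \<open>R\<close> is at least \<open>(d - 1) * n\<close>, while \<open>mm\<close> is
  still comparable to the logarithm.\<close>

lemma extremal_parameters:
  fixes N d :: nat
  assumes N: "1 \<le> N" and d: "1 \<le> d"
  obtains mm R where "1 \<le> mm" "(d - 1) * (mm - 1) \<le> R" "2 ^ R * mm ^ (d - 1) \<le> N" "N < 2 * (2 ^ R * mm ^ (d - 1))"
    "1 + ln (real N) \<le> 4 * real d * real mm"
proof -
  define n where "n = nat \<lfloor>log 2 (real N) / (2 * real d)\<rfloor>"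
  define mm where "mm = Suc n"
  have lg: "0 \<le> log 2 (real N)" using N by simp
  have n_le: "real n \<le> log 2 (real N) / (2 * real d)" unfolding n_def using lg by simp
  have n_gt: "log 2 (real N) / (2 * real d) < real mm" unfolding mm_def n_def using lg by linarith
  let ?P = "\<lambda>r. N < 2 ^ r * mm ^ (d - 1)"
  have start: "2 ^ ((d - 1) * n) * mm ^ (d - 1) \<le> N"
  proof -
    have "mm \<le> 2 ^ n" unfolding mm_def by (rule Suc_leI[OF less_exp])
    then have "2 ^ ((d - 1) * n) * mm ^ (d - 1) \<le> 2 ^ ((d - 1) * n) * (2 ^ n) ^ (d - 1)"
      by (intro mult_left_mono power_mono) auto
    also have "\<dots> = 2 ^ ((d - 1) * n + (d - 1) * n)" by (simp add: power_add power_mult[symmetric] mult.commute)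
    also have "\<dots> \<le> 2 ^ (2 * d * n)" by (intro power_increasing) (auto simp: algebra_simps diff_mult_distrib)
    also have "2 ^ (2 * d * n) \<le> N"
    proof -
      have "real (2 * d * n) \<le> log 2 (real N)" using n_le d by (simp add: divide_simps mult_ac)
      then have "2 powr real (2 * d * n) \<le> real N" using N by (simp add: le_log_iff)
      then have "real (2 ^ (2 * d * n)) \<le> real N" by (simp add: powr_realpow[symmetric])
      then show ?thesis by (simp only: of_nat_le_iff)
    qed
    finally show ?thesis .
  qed
  have "?P N"
  proof -
    have "N < 2 ^ N * 1" using less_exp[of N] by simp
    also have "\<dots> \<le> 2 ^ N * mm ^ (d - 1)" by (intro mult_left_mono) (auto simp: mm_def)
    finally show ?thesis .
  qed
  define r where "r = (LEAST r. ?P r)"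
  have P: "?P r" unfolding r_def using \<open>?P N\<close> by (rule LeastI)
  have r_gt: "(d - 1) * n < r"
  proof (rule ccontr)
    assume "\<not> (d - 1) * n < r"
    then have "2 ^ r * mm ^ (d - 1) \<le> 2 ^ ((d - 1) * n) * mm ^ (d - 1)"
      by (intro mult_right_mono power_increasing) (auto simp: mm_def)
    also note start
    finally show False using P by linarith
  qed
  then obtain R where R: "r = Suc R" by (cases r) auto
  have "\<not> ?P R" using not_less_Least[of R ?P] R by (simp add: r_def)
  moreover have "N < 2 * (2 ^ R * mm ^ (d - 1))" using P unfolding R by (simp only: power_Suc mult.assoc)
  moreover have "1 + ln (real N) \<le> 4 * real d * real mm"
  proof -
    have "exp 1 \<ge> (2::real)" using exp_ge_add_one_self[of 1] by simp
    then have "ln 2 \<le> (1::real)" by (metis ln_exp ln_le_cancel_iff exp_gt_zero zero_less_numeral)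
    then have "ln (real N) \<le> log 2 (real N)" using N unfolding log_def by (simp add: divide_simps mult_left_le)
    also have "\<dots> \<le> 2 * real d * real mm" using n_gt d by (simp add: divide_simps mult_ac)
    finally have 1: "ln (real N) \<le> 2 * real d * real mm" .
    have "1 * 1 \<le> real d * real mm" using d by (intro mult_mono) (auto simp: mm_def)
    then show ?thesis using 1 by simp
  qed
  ultimately show ?thesis using r_gt R by (intro that[of mm R]) (auto simp: mm_def)
qed

theorem wcga_lower_estimate:
  assumes p: "1 < p" "p \<le> 2" and \<tau>: "0 < \<tau>" "\<tau> \<le> 1"
    and ineq: "wcga_lebesgue_ineq (Lp_cube p :: (real ^ 'n::finite \<Rightarrow> 'k::{real_normed_field, euclidean_space}) set) (lp_norm p) (haar_dictionary p) \<tau> \<psi> C"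
    and C: "0 < C"
  shows "\<exists>c'>0. \<forall>N\<ge>1. c' * (1 + ln (real N)) powr (conj_exp p * h_exp p CARD('n)) * real N \<le> real (\<psi> N)"
proof -
  let ?q = "conj_exp p" and ?d = "CARD('n)"
  define s where "s = ?q * h_exp p ?d"
  define K where "K = C powr p * 2 powr ?q"
  \<comment> \<open>The 2 comes from \<open>N < 2 * (L * 2 ^ R)\<close>, the power of
    \<open>4 * d\<close> from \<open>1 + ln N \<le> 4 * d * mm\<close>.\<close>
  define c' where "c' = 1 / (2 * K * (4 * real ?d) powr s)"
  have q: "2 \<le> ?q" by (rule conj_exp_ge_2[OF p])
  have pq: "p * ?q = p + ?q" using p by (simp add: conj_exp_def field_simps)
  have d: "1 \<le> ?d" by (simp add: Suc_le_eq)
  have s: "s = (real ?d - 1) * (?q / 2 - 1)"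
  proof -
    have "\<bar>1 / 2 - 1 / p\<bar> = 1 / p - 1 / 2" using p by (simp add: divide_simps)
    moreover have "?q * (1 / p - 1 / 2) = ?q / 2 - 1" using pq p by (simp add: field_simps)
    ultimately show ?thesis by (simp add: s_def h_exp_def mult.left_commute)
  qed
  have s0: "0 \<le> s" unfolding s using q d by (intro mult_nonneg_nonneg) auto
  have K: "0 < K" using C by (simp add: K_def)
  have c': "0 < c'" using K d by (simp add: c'_def)
  have "c' * (1 + ln (real N)) powr s * real N \<le> real (\<psi> N)" if N: "1 \<le> N" for N
  proof -
    obtain mm R where mm: "1 \<le> mm" "(?d - 1) * (mm - 1) \<le> R" "2 ^ R * mm ^ (?d - 1) \<le> N" "N < 2 * (2 ^ R * mm ^ (?d - 1))"
      and ln: "1 + ln (real N) \<le> 4 * real ?d * real mm"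
      by (rule extremal_parameters[OF N d])
    define L where "L = real mm ^ (?d - 1)"
    have L: "1 \<le> L" using mm(1) by (simp add: L_def)
    have "L powr (p / 2) * 2 ^ R \<le> C powr p * (((2 * L powr ((p - 2) / 2)) powr (1 / (p - 1))) powr p * real (\<psi> N))"
      by (rule lower_estimate_count[OF p \<tau> ineq C N mm(1-3) L_def])
    also have "((2 * L powr ((p - 2) / 2)) powr (1 / (p - 1))) powr p = 2 powr ?q * L powr ((p - 2) / 2 * ?q)"
      using L by (simp add: powr_powr powr_mult conj_exp_def)
    also have "C powr p * (2 powr ?q * L powr ((p - 2) / 2 * ?q) * real (\<psi> N)) = L powr ((p - 2) / 2 * ?q) * (K * real (\<psi> N))"
      by (simp add: K_def)
    finally have "L powr (- ((p - 2) / 2 * ?q)) * (L powr (p / 2) * 2 ^ R)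
      \<le> L powr (- ((p - 2) / 2 * ?q)) * (L powr ((p - 2) / 2 * ?q) * (K * real (\<psi> N)))"
      by (intro mult_left_mono) auto
    also have "\<dots> = K * real (\<psi> N)" using L by (simp add: mult.assoc[symmetric] powr_add[symmetric])
    also have "L powr (- ((p - 2) / 2 * ?q)) * (L powr (p / 2) * 2 ^ R) = L powr (- ((p - 2) / 2 * ?q) + p / 2) * 2 ^ R"
      by (simp only: powr_add mult.assoc)
    \<comment> \<open>\<open>p * q = p + q\<close> turns the exponent into \<open>q / 2\<close>; one
      factor \<open>L\<close> completes \<open>L * 2 ^ R\<close>, which is comparable to
      \<open>N\<close>, and \<open>q / 2 - 1\<close> is left for the logarithm.\<close>
    also have "- ((p - 2) / 2 * ?q) + p / 2 = (?q / 2 - 1) + 1" using pq by (simp add: field_simps)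
    also have "L powr ((?q / 2 - 1) + 1) = L powr (?q / 2 - 1) * L" using L unfolding powr_add by simp
    also have "L powr (?q / 2 - 1) = real mm powr s"
      unfolding L_def s using mm(1) d by (simp add: powr_powr of_nat_diff flip: powr_realpow)
    finally have *: "real mm powr s * (L * 2 ^ R) \<le> K * real (\<psi> N)" by (simp only: mult.assoc)
    have "(1 + ln (real N)) powr s \<le> (4 * real ?d * real mm) powr s"
      using ln s0 N by (intro powr_mono2) auto
    also have "\<dots> = (4 * real ?d) powr s * real mm powr s" by (simp add: powr_mult)
    finally have A: "(1 + ln (real N)) powr s \<le> (4 * real ?d) powr s * real mm powr s" .
    have "real N \<le> real (2 * (2 ^ R * mm ^ (?d - 1)))" using mm(4) by (simp only: of_nat_le_iff less_imp_le)
    then have B: "real N \<le> 2 * (L * 2 ^ R)" by (simp add: L_def mult.commute)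
    have "(1 + ln (real N)) powr s * real N \<le> ((4 * real ?d) powr s * real mm powr s) * (2 * (L * 2 ^ R))"
      using A B by (intro mult_mono) auto
    also have "\<dots> = 2 * (4 * real ?d) powr s * (real mm powr s * (L * 2 ^ R))" by simp
    also have "\<dots> \<le> 2 * (4 * real ?d) powr s * (K * real (\<psi> N))" by (intro mult_left_mono *) auto
    finally have "c' * ((1 + ln (real N)) powr s * real N) \<le> c' * (2 * (4 * real ?d) powr s * (K * real (\<psi> N)))"
      using c' by (intro mult_left_mono) auto
    also have "\<dots> = real (\<psi> N)" using K d by (simp add: c'_def)
    finally show ?thesis by (simp only: mult.assoc)
  qed
  then show ?thesis using c' by (auto simp: s_def[symmetric])
qed

theorem theorem1p19:
  fixes p \<tau> :: real
    and X D :: "(real ^ 'n::finite \<Rightarrow> 'k::{real_normed_field, euclidean_space}) set"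
  assumes "1 < p" and "p \<le> 2" and "0 < \<tau>" and "\<tau> \<le> 1"
    and "X = Lp_cube p" and "D = haar_dictionary p"
  shows "(\<exists>c>0. \<exists>C>0. wcga_lebesgue_ineq X (lp_norm p) D \<tau>
             (\<lambda>N. nat \<lfloor>c * (1 + ln (real N)) powr (conj_exp p * h_exp p CARD('n)) * real N\<rfloor>) C) \<and>
         (\<forall>(\<psi> :: nat \<Rightarrow> nat) C. C > 0 \<and> wcga_lebesgue_ineq X (lp_norm p) D \<tau> \<psi> C \<longrightarrow>
             (\<exists>c'>0. \<forall>N\<ge>1. real (\<psi> N) \<ge>
                c' * (1 + ln (real N)) powr (conj_exp p * h_exp p CARD('n)) * real N))"
proof (intro conjI allI impI)
  from wcga_upper_estimate[OF assms(1-4), where ?'n = 'n and ?'k = 'k]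
  show "\<exists>c>0. \<exists>C>0. wcga_lebesgue_ineq X (lp_norm p) D \<tau>
      (\<lambda>N. nat \<lfloor>c * (1 + ln (real N)) powr (conj_exp p * h_exp p CARD('n)) * real N\<rfloor>) C"
    unfolding assms(5,6) by (metis zero_less_numeral)
next
  fix \<psi> :: "nat \<Rightarrow> nat" and C
  assume "C > 0 \<and> wcga_lebesgue_ineq X (lp_norm p) D \<tau> \<psi> C"
  then show "\<exists>c'>0. \<forall>N\<ge>1. real (\<psi> N) \<ge>
      c' * (1 + ln (real N)) powr (conj_exp p * h_exp p CARD('n)) * real N"
    using wcga_lower_estimate[OF assms(1-4), where ?'n = 'n and ?'k = 'k] unfolding assms(5,6) by blast
qed

end
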